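(* Let $n\ge 4$ and let $\pi:\mathcal{X}\to\mathbb{P}^1$ be a very general pencil of hypersurfaces of degree $n+1$ in $\mathbb{P}^n$ over $\mathbb{C}$. Then sections of $\pi$ are Zariski dense, i.e., the union of the images of all sections $\mathbb{P}^1\to\mathcal{X}$ of $\pi$ is Zariski dense in $\mathcal{X}$.
   Context: A pencil of hypersurfaces of degree $n+1$ in $\mathbb{P}^n$ is given by a two-dimensional space of forms spanned by $f_1,f_2$ of degree $n+1$ on $\mathbb{P}^n$, with total space $\mathcal{X}=\{s_1f_1+s_2f_2=0\}\subset\mathbb{P}^n\times\mathbb{P}^1$ (where $[s_1,s_2]$ are the coordinates on $\mathbb{P}^1$) and $\pi$ the projection to $\mathbb{P}^1$. "Very general" means: for all pencils in the Grassmannian parametrizing such pencils lying outside some countable union of proper Zariski closed subsets. *)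

theory Defs
  imports "HOL-Analysis.Analysis" "HOL-Library.Poly_Mapping"
begin

type_synonym 'v monom = "'v \<Rightarrow>\<^sub>0 nat"
type_synonym 'v cpoly = "'v monom \<Rightarrow>\<^sub>0 complex"

definition cpoly_eval :: "'v cpoly \<Rightarrow> ('v \<Rightarrow> complex) \<Rightarrow> complex" where
  "cpoly_eval p x =
     (\<Sum>m\<in>Poly_Mapping.keys p. Poly_Mapping.lookup p m *
        (\<Prod>v\<in>Poly_Mapping.keys m. x v ^ Poly_Mapping.lookup m v))"

definition monom_degree :: "'v monom \<Rightarrow> nat" where
  "monom_degree m = (\<Sum>v\<in>Poly_Mapping.keys m. Poly_Mapping.lookup m v)"

text \<open>The zero polynomial is homogeneous of every degree, so the homogeneous polynomials
  of a fixed degree form a vector space.\<close>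

definition homogeneous :: "nat \<Rightarrow> 'v cpoly \<Rightarrow> bool" where
  "homogeneous d p \<longleftrightarrow> (\<forall>m\<in>Poly_Mapping.keys p. monom_degree m = d)"

definition bihomogeneous :: "nat \<Rightarrow> nat \<Rightarrow> ('u + 'v) cpoly \<Rightarrow> bool" where
  "bihomogeneous d e p \<longleftrightarrow>
     (\<forall>m\<in>Poly_Mapping.keys p.
        (\<Sum>u | Inl u \<in> Poly_Mapping.keys m. Poly_Mapping.lookup m (Inl u)) = d \<and>
        (\<Sum>v | Inr v \<in> Poly_Mapping.keys m. Poly_Mapping.lookup m (Inr v)) = e)"

definition cpoly_scale :: "complex \<Rightarrow> 'v cpoly \<Rightarrow> 'v cpoly" where
  "cpoly_scale c p = Poly_Mapping.map (\<lambda>a. c * a) p"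

lemma lookup_cpoly_scale [simp]:
  "Poly_Mapping.lookup (cpoly_scale c p) m = c * Poly_Mapping.lookup p m"
  unfolding cpoly_scale_def by (simp add: Poly_Mapping.map.rep_eq when_def)

interpretation cpoly: vector_space cpoly_scale
  by unfold_locales (auto intro!: poly_mapping_eqI simp: lookup_add algebra_simps)

text \<open>A point of projective space is a line through the origin of the coordinate space, so
  the dimension of the projective space is one less than the number of coordinates.\<close>

definition proj_space :: "(complex ^ 'n) set set" where
  "proj_space = {L. vec.subspace L \<and> vec.dim L = 1}"

definition proj_closed :: "(complex ^ 'n) set set \<Rightarrow> bool" where
  "proj_closed Z \<longleftrightarrow>
     (\<exists>S. (\<forall>F\<in>S. \<exists>d. homogeneous d F) \<and>
          Z = {L \<in> proj_space. \<forall>F\<in>S. \<forall>x\<in>L. cpoly_eval F (\<lambda>i. x $ i) = 0})"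

definition biproj_closed :: "((complex ^ 'm) set \<times> (complex ^ 'n) set) set \<Rightarrow> bool" where
  "biproj_closed Z \<longleftrightarrow>
     (\<exists>S. (\<forall>F\<in>S. \<exists>d e. bihomogeneous d e F) \<and>
          Z = {(L, M) \<in> proj_space \<times> proj_space.
                 \<forall>F\<in>S. \<forall>x\<in>L. \<forall>y\<in>M. cpoly_eval F (case_sum (\<lambda>i. x $ i) (\<lambda>j. y $ j)) = 0})"

text \<open>Used for X Zariski closed in the product, where this is density in the subspace
  topology of X.\<close>

definition biproj_dense_in ::
    "((complex ^ 'm) set \<times> (complex ^ 'n) set) set \<Rightarrow>
     ((complex ^ 'm) set \<times> (complex ^ 'n) set) set \<Rightarrow> bool" where
  "biproj_dense_in X A \<longleftrightarrow> A \<subseteq> X \<and> (\<forall>Z. biproj_closed Z \<and> A \<subseteq> Z \<longrightarrow> X \<subseteq> Z)"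

text \<open>Morphisms between projective spaces: Zariski locally on the source, the map is given by
  homogeneous polynomials of one common degree without common zeros.\<close>

definition proj_morphism :: "((complex ^ 'm) set \<Rightarrow> (complex ^ 'n) set) \<Rightarrow> bool" where
  "proj_morphism \<phi> \<longleftrightarrow>
     (\<forall>L\<in>proj_space. \<exists>Z d F.
        proj_closed Z \<and> L \<notin> Z \<and> (\<forall>i. homogeneous d (F i)) \<and>
        (\<forall>M\<in>proj_space - Z. \<forall>x\<in>M - {0}.
           (\<chi> i. cpoly_eval (F i) (\<lambda>j. x $ j)) \<noteq> 0 \<and>
           \<phi> M = vec.span {\<chi> i. cpoly_eval (F i) (\<lambda>j. x $ j)}))"

text \<open>The points of the Grassmannian of pencils.\<close>

definition pencils :: "nat \<Rightarrow> 'n cpoly set set" where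
  "pencils d = {W. cpoly.subspace W \<and> cpoly.dim W = 2 \<and> (\<forall>f\<in>W. homogeneous d f)}"

text \<open>Pluecker coordinates with respect to the monomial basis, indexed by ordered pairs of
  monomials. Only the pairs of monomials of degree d matter for a pencil of degree d; the
  other coordinates are zero. Another choice of basis of the pencil multiplies all coordinates
  by one nonzero scalar.\<close>

definition pluecker :: "'n cpoly \<Rightarrow> 'n cpoly \<Rightarrow> 'n monom \<times> 'n monom \<Rightarrow> complex" where
  "pluecker f g = (\<lambda>(a, b).
     Poly_Mapping.lookup f a * Poly_Mapping.lookup g b -
     Poly_Mapping.lookup f b * Poly_Mapping.lookup g a)"

definition pencils_closed :: "nat \<Rightarrow> 'n cpoly set set \<Rightarrow> bool" where
  "pencils_closed d Z \<longleftrightarrow>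
     (\<exists>S. (\<forall>F\<in>S. \<exists>e. homogeneous e F) \<and>
          Z = {W \<in> pencils d. \<forall>F\<in>S. \<forall>f g. W = cpoly.span {f, g} \<longrightarrow>
                 cpoly_eval F (pluecker f g) = 0})"

definition very_general_pencil :: "nat \<Rightarrow> ('n cpoly set \<Rightarrow> bool) \<Rightarrow> bool" where
  "very_general_pencil d P \<longleftrightarrow>
     (\<exists>\<Z>. countable \<Z> \<and> (\<forall>Z\<in>\<Z>. pencils_closed d Z \<and> Z \<noteq> pencils d) \<and>
          (\<forall>W\<in>pencils d - \<Union>\<Z>. P W))"

definition pencil_total ::
    "'n cpoly \<Rightarrow> 'n cpoly \<Rightarrow> ((complex ^ 'n) set \<times> (complex ^ 2) set) set" where
  "pencil_total f1 f2 =
     {(L, M) \<in> proj_space \<times> proj_space. \<forall>x\<in>L. \<forall>s\<in>M.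
        s $ 1 * cpoly_eval f1 (\<lambda>i. x $ i) + s $ 2 * cpoly_eval f2 (\<lambda>i. x $ i) = 0}"

text \<open>A map into the product of two projective spaces is a morphism iff both of its components
  are. The projection to the base of the pencil is \<open>snd\<close>.\<close>

definition pencil_section ::
    "'n cpoly \<Rightarrow> 'n cpoly \<Rightarrow> ((complex ^ 2) set \<Rightarrow> (complex ^ 'n) set \<times> (complex ^ 2) set) \<Rightarrow> bool"
  where
  "pencil_section f1 f2 \<sigma> \<longleftrightarrow>
     proj_morphism (fst \<circ> \<sigma>) \<and> proj_morphism (snd \<circ> \<sigma>) \<and>
     (\<forall>t\<in>proj_space. \<sigma> t \<in> pencil_total f1 f2 \<and> snd (\<sigma> t) = t)"

end

theory Submission
  imports Defs "HOL-Computational_Algebra.Fundamental_Theorem_Algebra"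
    "HOL-Computational_Algebra.Formal_Laurent_Series" "HOL-Computational_Algebra.Polynomial_FPS"
    "HOL-Library.Function_Algebras"
begin

text \<open>
  Consider the special pencil spanned by F1 = (x^3 - z^3) prod_j (x - c_j y) and
  F2 = (y^3 - z^3) prod_j w_j. On the planes w_j = zeta_j (x - c_j y) it restricts, up to a common
  factor, to the pencil of cubics (x^3 - z^3) + zeta t (y^3 - z^3), where zeta = prod_j zeta_j.
  Starting from the base point (1, 1, 1), iterating the tangent map of the cubics gives sections of
  arbitrarily high degree e. For suitable c_j these are unobstructed sections of the special pencil,
  by a partial fraction argument, so by Hensel's lemma they lift to every formal deformation
  F + eps g of the pencil. A form of bidegree (d, k) with d + 3 k < e that vanishes on these
  sections for all zeta in a large enough grid is a multiple of the pencil; dividing by eps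
  repeatedly, the same is true of the lifted sections over power series and then over Laurent
  series.

  Normalise a pencil to echelon form with respect to the monomials x^(n+1) and y^3 prod_j w_j. If
  its other coefficients g are algebraically independent over the rationals, then so are those of
  F + eps g, and a field homomorphism from a countable subfield of the Laurent series to the complex
  numbers sends F + eps g to g. It carries the lifted sections, and the linear algebra certificate
  that every form of bidegree (d, k) vanishing on them is a multiple of the pencil, to the pencil g.
  A pencil violates the independence only if its Pluecker coordinates satisfy one of countably many
  equations with integer coefficients.
\<close>

section \<open>Evaluation of polynomials\<close>

text \<open>Density is tested on one bidegree (d, k) at a time: finitely many sections should force
  every form of that bidegree vanishing on them into the ideal of the pencil. The sections may
  depend on (d, k); algebraic independence of the normalised coefficients is a single condition that
  serves all bidegrees. A very general pencil is not close to the special one, and nothing makes the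
  formal sections converge. What is available is that g and F + eps g satisfy the same polynomial
  relations over the integers, namely none, so whatever is expressed by finitely many equations
  passes from one to the other; hence explicit cofactors instead of mere vanishing. The two
  monomials of the echelon form are chosen because F1 and F2 have coefficients 1, 0 and 0, 1 there,
  so these four entries agree for F and g and stay fixed. The bound d + 3 k arises by eliminating t
  on a plane: replacing t by a quotient of two cubics and clearing denominators turns a form of
  bidegree (d, k) into one of degree d + 3 k, which vanishes at the e points where a line through a
  fixed point meets the section.\<close>

definition mon :: "'v monom \<Rightarrow> ('v \<Rightarrow> 'a::comm_ring_1) \<Rightarrow> 'a" where
  "mon m x = (\<Prod>v\<in>Poly_Mapping.keys m. x v ^ Poly_Mapping.lookup m v)"

lemma mon_superset:
  assumes "finite S" "Poly_Mapping.keys m \<subseteq> S"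
  shows "mon m x = (\<Prod>v\<in>S. x v ^ Poly_Mapping.lookup m v)"
  unfolding mon_def using assms
  by (intro prod.mono_neutral_left) (auto simp: in_keys_iff)

lemma mon_zero [simp]: "mon 0 x = 1"
  by (simp add: mon_def)

lemma mon_add: "mon (m + m') x = mon m x * mon m' x"
proof -
  let ?S = "Poly_Mapping.keys m \<union> Poly_Mapping.keys m'"
  have "mon (m + m') x = (\<Prod>v\<in>?S. x v ^ Poly_Mapping.lookup (m + m') v)"
    by (intro mon_superset) (auto simp: in_keys_iff lookup_add)
  also have "\<dots> = (\<Prod>v\<in>?S. x v ^ Poly_Mapping.lookup m v) * (\<Prod>v\<in>?S. x v ^ Poly_Mapping.lookup m' v)"
    by (simp add: lookup_add power_add prod.distrib)
  also have "\<dots> = mon m x * mon m' x"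
    by (intro arg_cong2[where f = "(*)"] mon_superset[symmetric]) auto
  finally show ?thesis .
qed

lemma mon_single [simp]: "mon (Poly_Mapping.single v k) x = x v ^ k"
  by (cases "k = 0") (auto simp: mon_def)

lemma mon_scale: "mon m (\<lambda>v. s * x v) = s ^ monom_degree m * mon m x"
  by (simp add: mon_def monom_degree_def power_mult_distrib prod.distrib power_sum)

text \<open>A predicate on functions, because constant embeddings, evaluation at a point, the
  constant term of a power series and substitution s -> Z s all pass through the same
  lemmas.\<close>

definition rhom :: "('a::comm_ring_1 \<Rightarrow> 'b::comm_ring_1) \<Rightarrow> bool" where
  "rhom h \<longleftrightarrow> h 1 = 1 \<and> (\<forall>x y. h (x + y) = h x + h y) \<and> (\<forall>x y. h (x * y) = h x * h y)"

lemma rhomD: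
  assumes "rhom h"
  shows rhom_1: "h 1 = 1" and rhom_add: "h (x + y) = h x + h y"
    and rhom_mult: "h (x * y) = h x * h y"
  using assms by (auto simp: rhom_def)

lemma rhom_0: "rhom h \<Longrightarrow> h 0 = 0"
  using rhom_add[of h 0 0] by simp

lemma rhom_uminus: "rhom h \<Longrightarrow> h (- x) = - h x"
  using rhom_add[of h x "- x"] by (simp add: rhom_0 eq_neg_iff_add_eq_0 add.commute)

lemma rhom_diff: "rhom h \<Longrightarrow> h (x - y) = h x - h y"
  using rhom_add[of h x "- y"] by (simp add: rhom_uminus)

lemma rhom_power: "rhom h \<Longrightarrow> h (x ^ n) = h x ^ n"
  by (induction n) (auto simp: rhom_1 rhom_mult)

lemma rhom_sum: "rhom h \<Longrightarrow> h (\<Sum>i\<in>A. f i) = (\<Sum>i\<in>A. h (f i))"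
  by (induction A rule: infinite_finite_induct) (auto simp: rhom_0 rhom_add)

lemma rhom_prod: "rhom h \<Longrightarrow> h (\<Prod>i\<in>A. f i) = (\<Prod>i\<in>A. h (f i))"
  by (induction A rule: infinite_finite_induct) (auto simp: rhom_1 rhom_mult)

lemma rhom_mon: "rhom h \<Longrightarrow> h (mon m x) = mon m (\<lambda>v. h (x v))"
  by (simp add: mon_def rhom_prod rhom_power)

lemma rhom_id: "rhom (\<lambda>x. x)"
  by (simp add: rhom_def)

lemma rhom_comp: "rhom g \<Longrightarrow> rhom h \<Longrightarrow> rhom (\<lambda>x. g (h x))"
  by (simp add: rhom_def)

text \<open>The coefficient map h lets one complex or integer polynomial be evaluated in
  polynomials, power series and Laurent series alike.\<close>

definition evalp :: "('c::comm_ring_1 \<Rightarrow> 'a::comm_ring_1) \<Rightarrow> ('v monom \<Rightarrow>\<^sub>0 'c) \<Rightarrow> ('v \<Rightarrow> 'a) \<Rightarrow> 'a" where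
  "evalp h P x = (\<Sum>m\<in>Poly_Mapping.keys P. h (Poly_Mapping.lookup P m) * mon m x)"

lemma cpoly_eval_evalp: "cpoly_eval P x = evalp (\<lambda>c. c) P x"
  by (simp add: cpoly_eval_def evalp_def mon_def)

lemma evalp_superset:
  assumes "rhom h" "finite S" "Poly_Mapping.keys P \<subseteq> S"
  shows "evalp h P x = (\<Sum>m\<in>S. h (Poly_Mapping.lookup P m) * mon m x)"
  unfolding evalp_def using assms
  by (intro sum.mono_neutral_left) (auto simp: in_keys_iff rhom_0)

lemma evalp_add: assumes "rhom h" shows "evalp h (P + Q) x = evalp h P x + evalp h Q x"
proof -
  let ?S = "Poly_Mapping.keys P \<union> Poly_Mapping.keys Q"
  have "evalp h (P + Q) x = (\<Sum>m\<in>?S. h (Poly_Mapping.lookup (P + Q) m) * mon m x)"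
    by (intro evalp_superset assms) (auto simp: in_keys_iff lookup_add)
  also have "\<dots> = (\<Sum>m\<in>?S. h (Poly_Mapping.lookup P m) * mon m x) + (\<Sum>m\<in>?S. h (Poly_Mapping.lookup Q m) * mon m x)"
    using assms by (simp add: lookup_add rhom_add distrib_right sum.distrib)
  also have "\<dots> = evalp h P x + evalp h Q x"
    by (intro arg_cong2[where f = "(+)"] evalp_superset[symmetric] assms) auto
  finally show ?thesis .
qed

lemma evalp_zero [simp]: "evalp h 0 x = 0"
  by (simp add: evalp_def)

lemma evalp_single: "rhom h \<Longrightarrow> evalp h (Poly_Mapping.single m c) x = h c * mon m x"
  by (cases "c = 0") (auto simp: evalp_def rhom_0)

lemma evalp_one: "rhom h \<Longrightarrow> evalp h 1 x = 1"
  using evalp_single[of h 0 1 x] by (simp add: rhom_1)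

lemma evalp_sum: "rhom h \<Longrightarrow> evalp h (\<Sum>i\<in>A. f i) x = (\<Sum>i\<in>A. evalp h (f i) x)"
  by (induction A rule: infinite_finite_induct) (auto simp: evalp_add)

lemma poly_mapping_eq_sum:
  "P = (\<Sum>m\<in>Poly_Mapping.keys P. Poly_Mapping.single m (Poly_Mapping.lookup P m))"
  by (rule poly_mapping_eqI)
     (auto simp: lookup_sum lookup_single when_def in_keys_iff sum.delta' cong: if_cong)

lemma evalp_mult:
  assumes "rhom h" shows "evalp h (P * Q) x = evalp h P x * evalp h Q x"
proof -
  have "P * Q = (\<Sum>m\<in>Poly_Mapping.keys P. \<Sum>m'\<in>Poly_Mapping.keys Q.
       Poly_Mapping.single (m + m') (Poly_Mapping.lookup P m * Poly_Mapping.lookup Q m'))"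
    by (subst (1) poly_mapping_eq_sum[of P], subst (1) poly_mapping_eq_sum[of Q])
       (simp add: sum_product mult_single)
  then have "evalp h (P * Q) x = (\<Sum>m\<in>Poly_Mapping.keys P. \<Sum>m'\<in>Poly_Mapping.keys Q.
       h (Poly_Mapping.lookup P m) * h (Poly_Mapping.lookup Q m') * (mon m x * mon m' x))"
    using assms by (simp add: evalp_sum evalp_single rhom_mult mon_add)
  also have "\<dots> = evalp h P x * evalp h Q x"
    by (simp add: evalp_def sum_product mult_ac)
  finally show ?thesis .
qed

lemma rhom_evalp: "rhom h \<Longrightarrow> rhom (\<lambda>P. evalp h P x)"
  by (auto simp: rhom_def[of "\<lambda>P. evalp h P x"] evalp_one evalp_add evalp_mult)

lemma evalp_rhom:
  assumes "rhom g" shows "g (evalp h P x) = evalp (\<lambda>c. g (h c)) P (\<lambda>v. g (x v))"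
  using assms by (simp add: evalp_def rhom_sum rhom_mult rhom_mon)

section \<open>Degrees of monomials and homogeneous polynomials\<close>

lemma monom_degree_superset:
  assumes "finite S" "Poly_Mapping.keys m \<subseteq> S"
  shows "monom_degree m = (\<Sum>v\<in>S. Poly_Mapping.lookup m v)"
  unfolding monom_degree_def using assms
  by (intro sum.mono_neutral_left) (auto simp: in_keys_iff)

lemma monom_degree_zero [simp]: "monom_degree 0 = 0"
  by (simp add: monom_degree_def)

lemma monom_degree_single [simp]: "monom_degree (Poly_Mapping.single v k) = k"
  by (cases "k = 0") (auto simp: monom_degree_def)

lemma monom_degree_add: "monom_degree (m + m') = monom_degree m + monom_degree m'"
proof -
  let ?S = "Poly_Mapping.keys m \<union> Poly_Mapping.keys m'"
  have "monom_degree (m + m') = (\<Sum>v\<in>?S. Poly_Mapping.lookup (m + m') v)"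
    by (intro monom_degree_superset) (auto simp: in_keys_iff lookup_add)
  also have "\<dots> = (\<Sum>v\<in>?S. Poly_Mapping.lookup m v) + (\<Sum>v\<in>?S. Poly_Mapping.lookup m' v)"
    by (simp add: lookup_add sum.distrib)
  also have "\<dots> = monom_degree m + monom_degree m'"
    by (intro arg_cong2[where f = "(+)"] monom_degree_superset[symmetric]) auto
  finally show ?thesis .
qed

lemma homogeneous_zero: "homogeneous d 0"
  by (simp add: homogeneous_def)

lemma homogeneous_single: "monom_degree m = d \<Longrightarrow> homogeneous d (Poly_Mapping.single m c)"
  by (auto simp: homogeneous_def)

lemma homogeneous_add: "homogeneous d P \<Longrightarrow> homogeneous d Q \<Longrightarrow> homogeneous d (P + Q)"
  using keys_add[of P Q] by (auto simp: homogeneous_def)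

lemma homogeneous_sum:
  "(\<And>i. i \<in> A \<Longrightarrow> homogeneous d (f i)) \<Longrightarrow> homogeneous d (\<Sum>i\<in>A. f i)"
  by (induction A rule: infinite_finite_induct) (auto simp: homogeneous_zero homogeneous_add)

lemma homogeneous_mult: "homogeneous d P \<Longrightarrow> homogeneous e Q \<Longrightarrow> homogeneous (d + e) (P * Q)"
  using keys_mult[of P Q] by (fastforce simp: homogeneous_def monom_degree_add)

lemma homogeneous_one: "homogeneous 0 1"
  by (simp add: homogeneous_def)

lemma homogeneous_power: "homogeneous d P \<Longrightarrow> homogeneous (k * d) (P ^ k)"
  by (induction k) (auto simp: homogeneous_one homogeneous_mult)

lemma homogeneous_prod:
  "finite A \<Longrightarrow> (\<And>i. i \<in> A \<Longrightarrow> homogeneous (d i) (f i)) \<Longrightarrow> homogeneous (\<Sum>i\<in>A. d i) (\<Prod>i\<in>A. f i)"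
  by (induction A rule: finite_induct) (auto simp: homogeneous_one homogeneous_mult)

lemma finite_monom_degree: "finite {m :: 'v::finite monom. monom_degree m = d}"
proof (rule finite_subset)
  let ?A = "{m :: 'v monom. monom_degree m = d}"
  show "?A \<subseteq> (\<lambda>f. Abs_poly_mapping f) ` (PiE UNIV (\<lambda>_. {..d}))"
  proof
    fix m :: "'v monom" assume m: "m \<in> ?A"
    have "Poly_Mapping.lookup m v \<le> d" for v
    proof -
      have "d = (\<Sum>v\<in>UNIV. Poly_Mapping.lookup m v)"
        using m monom_degree_superset[of UNIV m] by auto
      then show ?thesis by (simp add: member_le_sum)
    qed
    then have "Poly_Mapping.lookup m \<in> PiE UNIV (\<lambda>_. {..d})" by (auto simp: PiE_def)
    then show "m \<in> (\<lambda>f. Abs_poly_mapping f) ` (PiE UNIV (\<lambda>_. {..d}))"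
      by (metis image_eqI poly_mapping.lookup_inverse)
  qed
  show "finite ((\<lambda>f. Abs_poly_mapping f) ` (PiE (UNIV::'v set) (\<lambda>_. {..d})))"
    by (intro finite_imageI finite_PiE) auto
qed

section \<open>Extension of field homomorphisms\<close>

text \<open>A subfield as a set and a homomorphism as a total function constrained only on it: the
  domain grows by adjoining elements one at a time, which types cannot follow.\<close>

definition field_hom_on :: "'a::field set \<Rightarrow> ('a \<Rightarrow> 'b::field) \<Rightarrow> bool" where
  "field_hom_on K h \<longleftrightarrow> 1 \<in> K \<and> (\<forall>x\<in>K. \<forall>y\<in>K. x - y \<in> K \<and> x * y \<in> K) \<and> (\<forall>x\<in>K. inverse x \<in> K) \<and>
     h 1 = 1 \<and> (\<forall>x\<in>K. \<forall>y\<in>K. h (x - y) = h x - h y \<and> h (x * y) = h x * h y)"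

context
  fixes K :: "'a::field set" and h :: "'a \<Rightarrow> 'b::field"
  assumes fh: "field_hom_on K h"
begin

lemma fh_1: "1 \<in> K" "h 1 = 1"
  and fh_diff: "x \<in> K \<Longrightarrow> y \<in> K \<Longrightarrow> x - y \<in> K" "x \<in> K \<Longrightarrow> y \<in> K \<Longrightarrow> h (x - y) = h x - h y"
  and fh_mult: "x \<in> K \<Longrightarrow> y \<in> K \<Longrightarrow> x * y \<in> K" "x \<in> K \<Longrightarrow> y \<in> K \<Longrightarrow> h (x * y) = h x * h y"
  and fh_inverse_in: "x \<in> K \<Longrightarrow> inverse x \<in> K"
  using fh by (auto simp: field_hom_on_def)

lemma fh_0: "0 \<in> K" "h 0 = 0"
  using fh_diff[OF fh_1(1) fh_1(1)] by auto

lemma fh_uminus: "x \<in> K \<Longrightarrow> - x \<in> K" "x \<in> K \<Longrightarrow> h (- x) = - h x"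
  using fh_diff[OF fh_0(1), of x] by (auto simp: fh_0)

lemma fh_add: "x \<in> K \<Longrightarrow> y \<in> K \<Longrightarrow> x + y \<in> K" "x \<in> K \<Longrightarrow> y \<in> K \<Longrightarrow> h (x + y) = h x + h y"
  using fh_diff[of x "- y"] by (auto simp: fh_uminus)

lemma fh_sum_in: "(\<And>i. i \<in> A \<Longrightarrow> f i \<in> K) \<Longrightarrow> (\<Sum>i\<in>A. f i) \<in> K"
  by (induction A rule: infinite_finite_induct) (auto simp: fh_0 fh_add)

lemma fh_sum: "(\<And>i. i \<in> A \<Longrightarrow> f i \<in> K) \<Longrightarrow> h (\<Sum>i\<in>A. f i) = (\<Sum>i\<in>A. h (f i))"
  by (induction A rule: infinite_finite_induct) (auto simp: fh_0 fh_add fh_sum_in)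

lemma fh_nonzero: assumes "x \<in> K" "x \<noteq> 0" shows "h x \<noteq> 0"
proof
  assume "h x = 0"
  moreover have "h x * h (inverse x) = h (x * inverse x)"
    by (rule fh_mult(2)[symmetric]) (use assms fh_inverse_in in auto)
  moreover have "h (x * inverse x) = 1" using assms fh_1 by simp
  ultimately show False by simp
qed

lemma fh_eq_0_iff: "x \<in> K \<Longrightarrow> h x = 0 \<longleftrightarrow> x = 0"
  using fh_nonzero fh_0 by auto

section \<open>Polynomials with coefficients in the subfield\<close>

definition coeffs_in :: "'a poly set" where "coeffs_in = {P. \<forall>i. coeff P i \<in> K}"

lemma coeffs_in_0: "0 \<in> coeffs_in" and coeffs_in_1: "1 \<in> coeffs_in"
  by (auto simp: coeffs_in_def fh_0 fh_1 one_pCons coeff_pCons split: nat.splits)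

lemma coeffs_in_diff: "P \<in> coeffs_in \<Longrightarrow> Q \<in> coeffs_in \<Longrightarrow> P - Q \<in> coeffs_in"
  by (auto simp: coeffs_in_def fh_diff)

lemma coeffs_in_add: "P \<in> coeffs_in \<Longrightarrow> Q \<in> coeffs_in \<Longrightarrow> P + Q \<in> coeffs_in"
  by (auto simp: coeffs_in_def fh_add)

lemma coeffs_in_uminus: "P \<in> coeffs_in \<Longrightarrow> - P \<in> coeffs_in"
  by (auto simp: coeffs_in_def fh_uminus)

lemma coeffs_in_mult: "P \<in> coeffs_in \<Longrightarrow> Q \<in> coeffs_in \<Longrightarrow> P * Q \<in> coeffs_in"
  by (auto simp: coeffs_in_def coeff_mult fh_mult fh_sum_in)

lemma coeffs_in_monom: "c \<in> K \<Longrightarrow> monom c n \<in> coeffs_in"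
  by (auto simp: coeffs_in_def fh_0)

lemma coeff_map_h: "coeff (map_poly h P) i = h (coeff P i)"
  by (simp add: coeff_map_poly fh_0)

lemma map_h_diff: "P \<in> coeffs_in \<Longrightarrow> Q \<in> coeffs_in \<Longrightarrow> map_poly h (P - Q) = map_poly h P - map_poly h Q"
  by (rule poly_eqI) (auto simp: coeff_map_h coeffs_in_def fh_diff)

lemma map_h_add: "P \<in> coeffs_in \<Longrightarrow> Q \<in> coeffs_in \<Longrightarrow> map_poly h (P + Q) = map_poly h P + map_poly h Q"
  by (rule poly_eqI) (auto simp: coeff_map_h coeffs_in_def fh_add)

lemma map_h_mult: "P \<in> coeffs_in \<Longrightarrow> Q \<in> coeffs_in \<Longrightarrow> map_poly h (P * Q) = map_poly h P * map_poly h Q"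
  by (rule poly_eqI) (auto simp: coeff_map_h coeffs_in_def fh_mult fh_sum coeff_mult)

lemma map_h_1: "map_poly h 1 = 1"
  by (rule poly_eqI) (auto simp: coeff_map_h one_pCons coeff_pCons fh_0 fh_1 split: nat.splits)

lemma degree_map_h: "P \<in> coeffs_in \<Longrightarrow> degree (map_poly h P) = degree P"
proof (rule antisym)
  assume P: "P \<in> coeffs_in"
  show "degree (map_poly h P) \<le> degree P"
    by (rule degree_le) (simp add: coeff_map_h coeff_eq_0 fh_0)
  show "degree P \<le> degree (map_poly h P)"
  proof (cases "P = 0")
    case False
    then show ?thesis using P by (intro le_degree) (simp add: coeff_map_h coeffs_in_def fh_eq_0_iff)
  qed auto
qed

text \<open>Long division inverts only the leading coefficient of the divisor, so it never leaves K.
  Induction on the degree of the dividend keeps track of this.\<close>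

lemma coeffs_in_division:
  assumes P: "P \<in> coeffs_in" "P \<noteq> 0" and "Q \<in> coeffs_in"
  shows "\<exists>D\<in>coeffs_in. \<exists>R\<in>coeffs_in. Q = P * D + R \<and> (R = 0 \<or> degree R < degree P)"
  using assms(3)
proof (induction "degree Q" arbitrary: Q rule: less_induct)
  case less
  show ?case
  proof (cases "Q = 0 \<or> degree Q < degree P")
    case True
    then show ?thesis using less.prems by (intro bexI[of _ 0] bexI[of _ Q]) (auto simp: coeffs_in_0)
  next
    case False
    then have dQ: "degree P \<le> degree Q" "Q \<noteq> 0" by auto
    define u where "u = lead_coeff Q * inverse (lead_coeff P)"
    define M where "M = monom u (degree Q - degree P)"
    have u: "u \<noteq> 0" "u * lead_coeff P = lead_coeff Q" using P dQ by (auto simp: u_def)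
    have M: "M \<in> coeffs_in" unfolding M_def u_def
      using P less.prems by (intro coeffs_in_monom fh_mult fh_inverse_in) (auto simp: coeffs_in_def)
    define Q' where "Q' = Q - P * M"
    have Q': "Q' \<in> coeffs_in" unfolding Q'_def using M P less.prems by (intro coeffs_in_diff coeffs_in_mult)
    have M0: "M \<noteq> 0" "degree M = degree Q - degree P" using u
      by (auto simp: M_def degree_monom_eq)
    have degPM: "degree (P * M) = degree Q" using M0 P dQ by (simp add: degree_mult_eq)
    have "lead_coeff (P * M) = lead_coeff Q" using u by (simp add: lead_coeff_mult M_def degree_monom_eq mult.commute)
    then have c0: "coeff Q' (degree Q) = 0" using degPM by (simp add: Q'_def)
    have dle: "degree Q' \<le> degree Q" unfolding Q'_def using degPM by (intro degree_diff_le) auto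
    show ?thesis
    proof (cases "Q' = 0")
      case True
      then have "Q = P * M + 0" by (simp add: Q'_def)
      then show ?thesis using M coeffs_in_0 by blast
    next
      case False
      then have "degree Q' < degree Q" using c0 dle by (metis le_neq_implies_less leading_coeff_0_iff)
      from less.hyps[OF this Q'] obtain D R where "D \<in> coeffs_in" "R \<in> coeffs_in" "Q' = P * D + R"
         "R = 0 \<or> degree R < degree P" by blast
      then have "M + D \<in> coeffs_in" "R \<in> coeffs_in" "Q = P * (M + D) + R" "R = 0 \<or> degree R < degree P"
        using M by (auto simp: Q'_def algebra_simps coeffs_in_add)
      then show ?thesis by blast
    qed
  qed
qed

lemma countable_coeffs_in: assumes "countable K" shows "countable coeffs_in"
proof -
  have "coeffs_in \<subseteq> Poly ` lists K"
  proof
    fix P assume "P \<in> coeffs_in"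
    then have "coeffs P \<in> lists K" by (auto simp: coeffs_in_def coeffs_def)
    then show "P \<in> Poly ` lists K" by (metis Poly_coeffs image_eqI)
  qed
  then show ?thesis using assms by (metis countable_subset countable_image countable_lists)
qed

end

text \<open>Two evaluations of R with the same kernel have isomorphic images, and the isomorphism
  extends to the fraction field of the image of \<open>ev1\<close>, which is K. Countability of R is
  passed on to K.\<close>

lemma fraction_field_hom:
  fixes ev1 :: "'p::comm_ring_1 \<Rightarrow> 'a::field" and ev2 :: "'p \<Rightarrow> 'b::field"
  assumes R: "1 \<in> R" "\<And>x y. x \<in> R \<Longrightarrow> y \<in> R \<Longrightarrow> x - y \<in> R" "\<And>x y. x \<in> R \<Longrightarrow> y \<in> R \<Longrightarrow> x * y \<in> R"
    and ev1: "ev1 1 = 1" "\<And>x y. x \<in> R \<Longrightarrow> y \<in> R \<Longrightarrow> ev1 (x - y) = ev1 x - ev1 y"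
      "\<And>x y. x \<in> R \<Longrightarrow> y \<in> R \<Longrightarrow> ev1 (x * y) = ev1 x * ev1 y"
    and ev2: "ev2 1 = 1" "\<And>x y. x \<in> R \<Longrightarrow> y \<in> R \<Longrightarrow> ev2 (x - y) = ev2 x - ev2 y"
      "\<And>x y. x \<in> R \<Longrightarrow> y \<in> R \<Longrightarrow> ev2 (x * y) = ev2 x * ev2 y"
    and ker: "\<And>x. x \<in> R \<Longrightarrow> ev1 x = 0 \<longleftrightarrow> ev2 x = 0"
    and "countable R"
  shows "\<exists>K h. field_hom_on K h \<and> countable K \<and> (\<forall>x\<in>R. ev1 x \<in> K \<and> h (ev1 x) = ev2 x)"
proof -
  define F where "F z x y \<longleftrightarrow> x \<in> R \<and> y \<in> R \<and> ev1 y \<noteq> 0 \<and> z = ev1 x / ev1 y" for z x y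
  define K where "K = {z. \<exists>x y. F z x y}"
  define h where "h z = (let p = (SOME p. F z (fst p) (snd p)) in ev2 (fst p) / ev2 (snd p))" for z
  have h: "h z = ev2 x / ev2 y" if "F z x y" for z x y
  proof -
    define p where "p = (SOME p. F z (fst p) (snd p))"
    have "F z (fst (x, y)) (snd (x, y))" using that by simp
    then have p: "F z (fst p) (snd p)" unfolding p_def by (rule someI)
    have y: "x \<in> R" "y \<in> R" "fst p \<in> R" "snd p \<in> R" "ev1 y \<noteq> 0" "ev1 (snd p) \<noteq> 0"
      "ev2 y \<noteq> 0" "ev2 (snd p) \<noteq> 0"
      using p that ker by (auto simp: F_def)
    have "ev1 x / ev1 y = ev1 (fst p) / ev1 (snd p)" using p that by (simp add: F_def)
    \<comment> \<open>Independence of the chosen fraction: the cross-multiplied difference lies in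
      the kernel of \<open>ev1\<close>, hence in that of \<open>ev2\<close>.\<close>
    moreover have "ev1 (x * snd p - fst p * y) = ev1 x * ev1 (snd p) - ev1 (fst p) * ev1 y"
      using y by (simp only: ev1 R)
    ultimately have "ev1 (x * snd p - fst p * y) = 0"
      using y by (simp add: frac_eq_eq)
    moreover have "x * snd p - fst p * y \<in> R" by (intro R y)
    ultimately have "ev2 (x * snd p - fst p * y) = 0" using ker by simp
    moreover have "ev2 (x * snd p - fst p * y) = ev2 x * ev2 (snd p) - ev2 (fst p) * ev2 y"
      using y by (simp only: ev2 R)
    ultimately have "ev2 x / ev2 y = ev2 (fst p) / ev2 (snd p)"
      using y by (simp add: frac_eq_eq)
    then show ?thesis by (simp add: h_def p_def Let_def)
  qed
  have R0: "0 \<in> R" using R(2)[OF R(1) R(1)] by simp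
  have ev10: "ev1 0 = 0" using ev1(2)[OF R(1) R(1)] by simp
  have ev20: "ev2 0 = 0" using ev2(2)[OF R(1) R(1)] by simp
  have F1: "F (ev1 x) x 1" if "x \<in> R" for x using that R ev1 by (simp add: F_def)
  have Fd: "F (z - z') (x * y' - x' * y) (y * y')" if "F z x y" "F z' x' y'" for z z' x y x' y'
    using that by (auto simp: F_def R ev1 field_simps)
  have Fm: "F (z * z') (x * x') (y * y')" if "F z x y" "F z' x' y'" for z z' x y x' y'
    using that by (auto simp: F_def R ev1 field_simps)
  have Fi: "F (inverse z) y x" if "F z x y" "z \<noteq> 0" for z x y
    using that by (auto simp: F_def R ev1 field_simps)
  have nz: "ev2 y \<noteq> 0" "x \<in> R" "y \<in> R" if "F z x y" for z x y using that ker by (auto simp: F_def)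
  have "field_hom_on K h"
    unfolding field_hom_on_def
  proof (intro conjI ballI)
    show "1 \<in> K" using F1[OF R(1)] ev1 by (auto simp: K_def)
    show "h 1 = 1" using h[OF F1[OF R(1)]] ev1 ev2 by simp
  next
    fix z assume "z \<in> K"
    then obtain x y where "F z x y" by (auto simp: K_def)
    then show "inverse z \<in> K" using Fi[of z x y] F1[OF R0] ev10 by (cases "z = 0") (auto simp: K_def)
  next
    fix z z' assume "z \<in> K" "z' \<in> K"
    then obtain x y x' y' where F: "F z x y" "F z' x' y'" by (auto simp: K_def)
    show "z - z' \<in> K" using Fd[OF F] by (auto simp: K_def)
    show "z * z' \<in> K" using Fm[OF F] by (auto simp: K_def)
    show "h (z - z') = h z - h z'" unfolding h[OF Fd[OF F]] h[OF F(1)] h[OF F(2)]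
      using nz[OF F(1)] nz[OF F(2)] by (simp add: ev2 R field_simps)
    show "h (z * z') = h z * h z'" unfolding h[OF Fm[OF F]] h[OF F(1)] h[OF F(2)]
      using nz[OF F(1)] nz[OF F(2)] by (simp add: ev2 R)
  qed
  moreover have "countable K"
  proof -
    have "K \<subseteq> (\<lambda>(x, y). ev1 x / ev1 y) ` (R \<times> R)" by (auto simp: K_def F_def)
    then show ?thesis using \<open>countable R\<close> by (meson countable_SIGMA countable_image countable_subset)
  qed
  moreover have "ev1 x \<in> K \<and> h (ev1 x) = ev2 x" if "x \<in> R" for x
    using F1[OF that] h[OF F1[OF that]] ev2 by (auto simp: K_def)
  ultimately show ?thesis by blast
qed

text \<open>If c is transcendental over K, any c' outside the countable set of roots of the images
  of nonzero polynomials will do. If c is algebraic, c' is a root of the image of its minimal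
  polynomial. The equivalence says that sending c to c' is well defined and injective.\<close>

lemma field_hom_extend_poly:
  fixes c :: "'a::field" and h :: "'a \<Rightarrow> complex"
  assumes fh: "field_hom_on K h" and "countable K"
  shows "\<exists>c'. \<forall>P\<in>coeffs_in K. poly P c = 0 \<longleftrightarrow> poly (map_poly h P) c' = 0"
proof (cases "\<exists>P\<in>coeffs_in K. P \<noteq> 0 \<and> poly P c = 0")
  case False
  have "countable (\<Union>P\<in>coeffs_in K - {0}. {z. poly (map_poly h P) z = 0})"
  proof (intro countable_UN)
    show "countable (coeffs_in K - {0})" using countable_coeffs_in[OF fh \<open>countable K\<close>] by auto
    fix P assume P: "P \<in> coeffs_in K - {0}"
    then have "coeff P (degree P) \<noteq> 0" by simp
    then have "coeff (map_poly h P) (degree P) \<noteq> 0" using P fh_nonzero[OF fh] by (simp add: coeff_map_h[OF fh] coeffs_in_def[OF fh])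
    then have "map_poly h P \<noteq> 0" by auto
    then show "countable {z. poly (map_poly h P) z = 0}" by (intro countable_finite poly_roots_finite)
  qed
  then obtain c' where c': "c' \<notin> (\<Union>P\<in>coeffs_in K - {0}. {z. poly (map_poly h P) z = 0})"
    using uncountable_UNIV_complex by (metis UNIV_eq_I)
  have "poly P c = 0 \<longleftrightarrow> poly (map_poly h P) c' = 0" if P: "P \<in> coeffs_in K" for P
    using that False c' by (cases "P = 0") auto
  then show ?thesis by blast
next
  case True
  define A where "A = {P \<in> coeffs_in K. P \<noteq> 0 \<and> poly P c = 0}"
  obtain P0 where "P0 \<in> A" using True by (auto simp: A_def)
  then have "\<exists>P\<in>A. \<forall>Q\<in>A. degree P \<le> degree Q"
    using exists_least_iff[of "\<lambda>k. \<exists>P\<in>A. degree P = k"] by (metis not_le)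
  then obtain P where P: "P \<in> coeffs_in K" "P \<noteq> 0" "poly P c = 0" and min: "\<And>Q. Q \<in> coeffs_in K \<Longrightarrow> Q \<noteq> 0 \<Longrightarrow> poly Q c = 0 \<Longrightarrow> degree P \<le> degree Q"
    by (auto simp: A_def)
  have degP: "degree P > 0"
  proof (rule ccontr)
    assume "\<not> ?thesis"
    then obtain a where "P = [:a:]" by (auto elim: degree_eq_zeroE)
    then show False using P by simp
  qed
  have "degree (map_poly h P) > 0" using degP degree_map_h[OF fh P(1)] by simp
  then obtain c' where c': "poly (map_poly h P) c' = 0"
    using fundamental_theorem_of_algebra[of "map_poly h P"] by (auto simp: constant_degree)
  have fwd: "poly (map_poly h Q) c' = 0" if Q: "Q \<in> coeffs_in K" "poly Q c = 0" for Q
  proof -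
    obtain D R where D: "D \<in> coeffs_in K" "R \<in> coeffs_in K" "Q = P * D + R" "R = 0 \<or> degree R < degree P"
      using coeffs_in_division[OF fh P(1,2) Q(1)] by blast
    have "poly R c = 0" using D(3) Q(2) P(3) by simp
    then have "R = 0" using min[of R] D by fastforce
    then show ?thesis using D(1,3) P(1) c' by (simp add: map_h_mult[OF fh])
  qed
  \<comment> \<open>Polynomials of smaller degree than the minimal one are invertible at c. Dividing
    P by R gives a remainder of smaller degree with value -R D at c, so an inverse of the remainder
    yields one of R.\<close>
  have inv: "\<exists>S\<in>coeffs_in K. poly (S * R) c = 1" if "R \<in> coeffs_in K" "R \<noteq> 0" "degree R < degree P" for R
    using that
  proof (induction "degree R" arbitrary: R rule: less_induct)
    case less
    obtain D R' where D: "D \<in> coeffs_in K" "R' \<in> coeffs_in K" "P = R * D + R'" "R' = 0 \<or> degree R' < degree R"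
      using coeffs_in_division[OF fh less.prems(1,2) P(1)] by blast
    show ?case
    proof (cases "R' = 0")
      case True
      then have PRD: "P = R * D" using D by simp
      then have D0: "D \<noteq> 0" using P by auto
      \<comment> \<open>By minimality R does not vanish at c, so D does; minimality applied to D
        leaves degree 0 for R.\<close>
      have Rc: "poly R c \<noteq> 0" using min[OF less.prems(1,2)] less.prems(3) by auto
      then have "poly D c = 0" using PRD P(3) by simp
      then have "degree P \<le> degree D" using min D(1) D0 by blast
      then have "degree R = 0" using PRD D0 less.prems(2) by (simp add: degree_mult_eq)
      then obtain a where a: "R = [:a:]" by (metis degree_eq_zeroE)
      have "\<forall>i. coeff R i \<in> K" using less.prems(1) by (simp add: coeffs_in_def[OF fh])
      then have "coeff R 0 \<in> K" ..
      then have "a \<in> K" "a \<noteq> 0" using a less.prems(2) by simp_all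
      then show ?thesis using a fh_inverse_in[OF fh]
        by (intro bexI[of _ "monom (inverse a) 0"] coeffs_in_monom[OF fh]) (auto simp: monom_0)
    next
      case False
      then obtain S where S: "S \<in> coeffs_in K" "poly (S * R') c = 1"
        using less.hyps[of R'] D less.prems by auto
      have "poly (- S * D * R) c = 1"
      proof -
        have "poly P c = poly R c * poly D c + poly R' c" using D(3) by simp
        then have "poly R' c = - (poly R c * poly D c)" using P(3) by (simp add: eq_neg_iff_add_eq_0 add.commute)
        then show ?thesis using S(2) by (simp add: mult_ac)
      qed
      then show ?thesis using S D by (intro bexI[of _ "- S * D"] coeffs_in_mult[OF fh] coeffs_in_uminus[OF fh])
    qed
  qed
  have bwd: "poly (map_poly h Q) c' \<noteq> 0" if Q: "Q \<in> coeffs_in K" "poly Q c \<noteq> 0" for Q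
  proof -
    obtain D R where D: "D \<in> coeffs_in K" "R \<in> coeffs_in K" "Q = P * D + R" "R = 0 \<or> degree R < degree P"
      using coeffs_in_division[OF fh P(1,2) Q(1)] by blast
    have Rc: "poly R c = poly Q c" using D(3) P(3) by simp
    then have "R \<noteq> 0" using Q by auto
    then obtain S where S: "S \<in> coeffs_in K" "poly (S * R) c = 1" using inv D by blast
    \<comment> \<open>Nonvanishing is turned into the vanishing of S Q - 1, which \<open>fwd\<close>
      transports to c'.\<close>
    then have "poly (S * Q - 1) c = 0" using Rc by simp
    then have "poly (map_poly h (S * Q - 1)) c' = 0"
      by (rule fwd[rotated]) (intro coeffs_in_diff[OF fh] coeffs_in_mult[OF fh] S Q coeffs_in_1[OF fh])
    then have "poly (map_poly h S) c' * poly (map_poly h Q) c' = 1"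
      using S(1) Q(1) by (simp add: map_h_diff[OF fh] map_h_mult[OF fh] map_h_1[OF fh] coeffs_in_mult[OF fh] coeffs_in_1[OF fh])
    then show ?thesis by auto
  qed
  show ?thesis using fwd bwd by blast
qed

text \<open>The ring in the fraction field construction is K[X], evaluated at c on one side and,
  after applying h, at c' on the other.\<close>

lemma field_hom_extend:
  fixes c :: "'a::field" and h :: "'a \<Rightarrow> complex"
  assumes fh: "field_hom_on K h" and "countable K"
  shows "\<exists>K' h'. field_hom_on K' h' \<and> countable K' \<and> K \<subseteq> K' \<and> c \<in> K' \<and> (\<forall>x\<in>K. h' x = h x)"
proof -
  obtain c' where c': "\<forall>P\<in>coeffs_in K. poly P c = 0 \<longleftrightarrow> poly (map_poly h P) c' = 0"
    using field_hom_extend_poly[OF assms] by blast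
  have "\<exists>K' h'. field_hom_on K' h' \<and> countable K' \<and>
     (\<forall>P\<in>coeffs_in K. poly P c \<in> K' \<and> h' (poly P c) = poly (map_poly h P) c')"
  proof (rule fraction_field_hom)
    show "countable (coeffs_in K)" using countable_coeffs_in[OF fh] assms by simp
  qed (use c' in \<open>auto simp: coeffs_in_1[OF fh] coeffs_in_diff[OF fh] coeffs_in_mult[OF fh]
        map_h_diff[OF fh] map_h_mult[OF fh] map_h_1[OF fh]\<close>)
  then obtain K' h' where K': "field_hom_on K' h'" "countable K'"
     "\<And>P. P \<in> coeffs_in K \<Longrightarrow> poly P c \<in> K' \<and> h' (poly P c) = poly (map_poly h P) c'" by blast
  have "x \<in> K' \<and> h' x = h x" if "x \<in> K" for x
    using K'(3)[of "[:x:]"] that by (auto simp: coeffs_in_def[OF fh] coeff_pCons fh_0[OF fh] map_poly_pCons split: nat.splits)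
  moreover have "c \<in> K'"
    using K'(3)[of "[:0, 1:]"] by (auto simp: coeffs_in_def[OF fh] coeff_pCons fh_0[OF fh] fh_1[OF fh] split: nat.splits)
  ultimately show ?thesis using K' by blast
qed

lemma field_hom_extend_finite:
  fixes h :: "'a::field \<Rightarrow> complex"
  assumes "finite C" "field_hom_on K h" "countable K"
  shows "\<exists>K' h'. field_hom_on K' h' \<and> countable K' \<and> K \<union> C \<subseteq> K' \<and> (\<forall>x\<in>K. h' x = h x)"
  using assms(1)
proof (induction C rule: finite_induct)
  case empty
  then show ?case using assms by auto
next
  case (insert c C)
  then obtain K1 h1 where 1: "field_hom_on K1 h1" "countable K1" "K \<union> C \<subseteq> K1" "\<forall>x\<in>K. h1 x = h x" by blast
  obtain K2 h2 where "field_hom_on K2 h2" "countable K2" "K1 \<subseteq> K2" "c \<in> K2" "\<forall>x\<in>K1. h2 x = h1 x"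
    using field_hom_extend[OF 1(1,2), of c] by blast
  then show ?case using 1 by (intro exI[of _ K2] exI[of _ h2]) auto
qed

section \<open>Sections of a pencil of plane cubics\<close>

text \<open>Gaussian elimination: the equation b is solved for an unknown a0 that occurs in it,
  which leaves one equation and one unknown less.\<close>

lemma homogeneous_system_nontrivial:
  fixes M :: "'i \<Rightarrow> 'j \<Rightarrow> 'a::field"
  assumes "finite B" "finite A" "card B < card A"
  shows "\<exists>c. (\<exists>a\<in>A. c a \<noteq> 0) \<and> (\<forall>b\<in>B. (\<Sum>a\<in>A. c a * M a b) = 0)"
  using assms
proof (induction B arbitrary: A M rule: finite_induct)
  case empty
  then have "A \<noteq> {}" by auto
  then show ?case by (intro exI[of _ "\<lambda>_. 1"]) auto
next
  case (insert b B)
  show ?case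
  proof (cases "\<forall>a\<in>A. M a b = 0")
    case True
    have "card B < card A" using insert by simp
    from insert.IH[OF insert.prems(1) this, of M] show ?thesis using True by auto
  next
    case False
    then obtain a0 where a0: "a0 \<in> A" "M a0 b \<noteq> 0" by auto
    define A' where "A' = A - {a0}"
    define M' where "M' a b' = M a b' - M a b / M a0 b * M a0 b'" for a b'
    have A': "finite A'" "card B < card A'" "A = insert a0 A'" "a0 \<notin> A'"
      using insert.prems insert.hyps a0 by (auto simp: A'_def)
    obtain c where c: "\<exists>a\<in>A'. c a \<noteq> 0" "\<forall>b'\<in>B. (\<Sum>a\<in>A'. c a * M' a b') = 0"
      using insert.IH[OF A'(1,2), of M'] by blast
    define c0 where "c0 = - (\<Sum>a\<in>A'. c a * (M a b / M a0 b))"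
    have ex: "(\<Sum>a\<in>A. (c(a0 := c0)) a * M a b') = c0 * M a0 b' + (\<Sum>a\<in>A'. c a * M a b')" for b'
    proof -
      have "(\<Sum>a\<in>A'. (c(a0 := c0)) a * M a b') = (\<Sum>a\<in>A'. c a * M a b')"
        using A'(4) by (intro sum.cong) auto
      then show ?thesis using A' by simp
    qed
    have "c0 * M a0 b + (\<Sum>a\<in>A'. c a * M a b) = 0"
      using a0 by (simp add: c0_def sum_distrib_right)
    moreover have "c0 * M a0 b' + (\<Sum>a\<in>A'. c a * M a b') = 0" if "b' \<in> B" for b'
    proof -
      have "c0 * M a0 b' = - (\<Sum>a\<in>A'. c a * (M a b / M a0 b * M a0 b'))"
        by (simp only: c0_def minus_mult_left[symmetric] sum_distrib_right mult.assoc)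
      moreover have "(\<Sum>a\<in>A'. c a * M' a b') = (\<Sum>a\<in>A'. c a * M a b') - (\<Sum>a\<in>A'. c a * (M a b / M a0 b * M a0 b'))"
        by (simp add: M'_def right_diff_distrib sum_subtractf)
      ultimately show ?thesis using c(2) that by simp
    qed
    ultimately have "\<forall>b'\<in>insert b B. (\<Sum>a\<in>A. (c(a0 := c0)) a * M a b') = 0"
      unfolding ex by auto
    moreover have "\<exists>a\<in>A. (c(a0 := c0)) a \<noteq> 0" using c(1) A' by (auto intro: bexI)
    ultimately show ?thesis by blast
  qed
qed

text \<open>Injective square systems are surjective. The right-hand side is adjoined as one more
  unknown \<open>None\<close>; a nontrivial solution of the enlarged homogeneous system has a
  nonzero entry there by injectivity, and dividing by it solves the system.\<close>

lemma square_system_solvable: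
  fixes M :: "'i \<Rightarrow> 'j \<Rightarrow> 'a::field"
  assumes "finite A" "finite B" "card A = card B"
    and inj: "\<And>c. (\<And>b. b \<in> B \<Longrightarrow> (\<Sum>a\<in>A. c a * M a b) = 0) \<Longrightarrow> (\<And>a. a \<in> A \<Longrightarrow> c a = 0)"
  shows "\<exists>c. \<forall>b\<in>B. (\<Sum>a\<in>A. c a * M a b) = r b"
proof -
  define M' where "M' a b = (case a of None \<Rightarrow> r b | Some a \<Rightarrow> M a b)" for a b
  have "card B < card (insert None (Some ` A))"
    using assms by (simp add: card_image)
  then obtain c where c: "\<exists>a\<in>insert None (Some ` A). c a \<noteq> 0"
     "\<forall>b\<in>B. (\<Sum>a\<in>insert None (Some ` A). c a * M' a b) = 0"
    using homogeneous_system_nontrivial[of B "insert None (Some ` A)" M'] assms by auto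
  have eq: "c None * r b + (\<Sum>a\<in>A. c (Some a) * M a b) = 0" if "b \<in> B" for b
    using bspec[OF c(2) that] assms(1) by (simp add: sum.reindex M'_def)
  have "c None \<noteq> 0"
  proof
    assume 0: "c None = 0"
    then have "c (Some a) = 0" if "a \<in> A" for a
      using inj[of "\<lambda>a. c (Some a)"] eq that by auto
    then show False using c(1) 0 by auto
  qed
  then have "(\<Sum>a\<in>A. - c (Some a) / c None * M a b) = r b" if "b \<in> B" for b
  proof -
    define S where "S = (\<Sum>a\<in>A. c (Some a) * M a b)"
    have "S = - (c None * r b)" using eq[OF that] by (simp add: S_def eq_neg_iff_add_eq_0 add.commute)
    moreover have "(\<Sum>a\<in>A. - c (Some a) / c None * M a b) = - S / c None"
      by (simp add: S_def sum_negf sum_divide_distrib)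
    ultimately show ?thesis using \<open>c None \<noteq> 0\<close> by simp
  qed
  then show ?thesis by (intro exI[of _ "\<lambda>a. - c (Some a) / c None"]) auto
qed

text \<open>An element of least degree in the ideal divides all three polynomials, so it has no root
  and is constant.\<close>

lemma bezout_no_common_root:
  fixes p q r :: "complex poly"
  assumes nc: "\<And>s. \<not> (poly p s = 0 \<and> poly q s = 0 \<and> poly r s = 0)"
  shows "\<exists>a b c. a * p + b * q + c * r = 1"
proof -
  define I where "I = {g. g \<noteq> 0 \<and> (\<exists>a b c. a * p + b * q + c * r = g)}"
  have memI: "a * p + b * q + c * r = 0 \<or> a * p + b * q + c * r \<in> I" for a b c by (auto simp: I_def)
  have "\<exists>g. g \<in> I"
    using memI[of 1 0 0] memI[of 0 1 0] memI[of 0 0 1] nc by auto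
  then have "\<exists>g\<in>I. \<forall>f\<in>I. degree g \<le> degree f"
    using exists_least_iff[of "\<lambda>k. \<exists>P\<in>I. degree P = k"] by (metis not_le)
  then obtain g where g: "g \<in> I" and min: "\<And>f. f \<in> I \<Longrightarrow> degree g \<le> degree f" by blast
  obtain a b c where abc: "a * p + b * q + c * r = g" and g0: "g \<noteq> 0" using g by (auto simp: I_def)
  have dv: "g dvd f" if f: "\<exists>a b c. a * p + b * q + c * r = f" for f
  proof -
    obtain a' b' c' where f': "a' * p + b' * q + c' * r = f" using f by blast
    let ?d = "f div g"
    have "(a' - ?d * a) * p + (b' - ?d * b) * q + (c' - ?d * c) * r = f - ?d * g"
      by (simp add: f'[symmetric] abc[symmetric] algebra_simps)
    also have "\<dots> = f mod g" by (simp add: minus_div_mult_eq_mod)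
    finally have "f mod g = 0 \<or> f mod g \<in> I" using memI by metis
    moreover have "f mod g = 0 \<or> degree (f mod g) < degree g" using g0 by (simp add: degree_mod_less)
    ultimately have "f mod g = 0" using min by (meson not_le)
    then show ?thesis by (simp add: mod_eq_0_iff_dvd)
  qed
  have "1 * p + 0 * q + 0 * r = p" "0 * p + 1 * q + 0 * r = q" "0 * p + 0 * q + 1 * r = r" by auto
  then have "g dvd p" "g dvd q" "g dvd r" using dv by blast+
  then have "\<not> (\<exists>s. poly g s = 0)" using nc by (metis dvd_trans poly_eq_0_iff_dvd)
  then have "degree g = 0" using fundamental_theorem_of_algebra[of g] by (auto simp: constant_degree)
  then obtain k where k: "g = [:k:]" "k \<noteq> 0" using g0 by (metis degree_eq_zeroE pCons_0_0)
  have "[:1/k:] * g = 1" using k by (simp add: one_pCons)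
  then have "([:1/k:] * a) * p + ([:1/k:] * b) * q + ([:1/k:] * c) * r = 1"
    by (simp add: abc[symmetric] distrib_left mult.assoc del: mult_pCons_left)
  then show ?thesis by blast
qed

text \<open>Here m and n only bound the degrees. The coefficient at such a bound plays the role of
  the value at infinity of a form of that degree.\<close>

lemma coeff_mult_top:
  fixes p q :: "'a::comm_ring_1 poly"
  assumes "degree p \<le> m" "degree q \<le> n"
  shows "coeff (p * q) (m + n) = coeff p m * coeff q n"
proof -
  have "coeff p i * coeff q (m + n - i) = (if i = m then coeff p m * coeff q n else 0)" if "i \<le> m + n" for i
  proof (cases i m rule: linorder_cases)
    case less
    then have "coeff q (m + n - i) = 0" using assms by (intro coeff_eq_0) auto
    then show ?thesis using less by simp
  next
    case greater
    then have "coeff p i = 0" using assms by (intro coeff_eq_0) auto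
    then show ?thesis using greater by simp
  qed auto
  then have "coeff (p * q) (m + n) = (\<Sum>i\<le>m+n. if i = m then coeff p m * coeff q n else 0)"
    by (simp add: coeff_mult)
  then show ?thesis by simp
qed

lemma degree_mult_le_add:
  fixes p q :: "'a::comm_ring_1 poly"
  shows "degree p \<le> m \<Longrightarrow> degree q \<le> n \<Longrightarrow> degree (p * q) \<le> m + n"
  using degree_mult_le[of p q] by simp

section \<open>Iterating the tangent construction on the cubics\<close>

abbreviation (input) T :: "complex poly" where "T \<equiv> [:0, 1:]"
abbreviation (input) T1 :: "complex poly" where "T1 \<equiv> [:1, 1:]"

text \<open>Sections of degree e of the pencil of cubics spanned by x^3 - z^3 and y^3 - z^3 that meet
  every fibre, the one at infinity included, in a smooth point.\<close>

definition smooth_section :: "nat \<Rightarrow> complex poly \<Rightarrow> complex poly \<Rightarrow> complex poly \<Rightarrow> bool" where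
  "smooth_section e x y z \<longleftrightarrow> degree x \<le> e \<and> degree y \<le> e \<and> degree z \<le> e \<and>
     x^3 + T * y^3 = T1 * z^3 \<and>
     (\<forall>s. \<not> (poly x s = 0 \<and> s * poly y s = 0 \<and> (1 + s) * poly z s = 0)) \<and>
     coeff y e \<noteq> 0 \<and> coeff y e ^ 3 = coeff z e ^ 3"

text \<open>The case distinction separates the singular fibres s = 0 and s = -1, each three
  concurrent lines, from the others. For the others, x \<noteq> 0 would give 2 (1 + s) z^3 = x^3 and
  (1 + s) z^3 = 2 x^3, hence 3 x^3 = 0; with x = 0 the other coordinates vanish in turn.\<close>

lemma smooth_point_tangent:
  fixes x y z s :: complex
  assumes eq: "x^3 + s * y^3 = (1 + s) * z^3"
    and nz: "\<not> (x = 0 \<and> s * y = 0 \<and> (1 + s) * z = 0)"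
  shows "\<not> (x * (s * y^3 + (1 + s) * z^3) = 0 \<and> s * (y * ((1 + s) * z^3 + x^3)) = 0 \<and>
    (1 + s) * (z * (s * y^3 - x^3)) = 0)"
proof
  assume A: "x * (s * y^3 + (1 + s) * z^3) = 0 \<and> s * (y * ((1 + s) * z^3 + x^3)) = 0 \<and>
    (1 + s) * (z * (s * y^3 - x^3)) = 0"
  consider "s = 0" | "s = -1" | "s \<noteq> 0" "1 + s \<noteq> 0" by (metis add.right_inverse add_left_cancel)
  then show False
  proof cases
    case 1
    then show ?thesis using A eq nz by (auto simp: power3_eq_cube)
  next
    case 2
    then show ?thesis using A eq nz by (auto simp: power3_eq_cube)
  next
    case 3
    have e: "s * y^3 = (1 + s) * z^3 - x^3" using eq by (simp add: eq_diff_eq add.commute)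
    have "x = 0 \<or> (1 + s) * z^3 - x^3 + (1 + s) * z^3 = 0" using A[unfolded e] by (metis mult_eq_0_iff)
    then have 1: "x = 0 \<or> 2 * ((1 + s) * z^3) = x^3" by (auto simp: algebra_simps)
    have "z = 0 \<or> (1 + s) * z^3 - x^3 - x^3 = 0" using A[unfolded e] 3 by (metis mult_eq_0_iff)
    then have 4: "z = 0 \<or> (1 + s) * z^3 = 2 * x^3" by auto
    show ?thesis
    proof (cases "x = 0")
      case True
      then have "z = 0" using 4 3 by auto
      then have "y = 0" using e True 3 by auto
      then show ?thesis using nz True \<open>z = 0\<close> by simp
    next
      case False
      then have a: "2 * ((1 + s) * z^3) = x^3" using 1 by simp
      then have "z \<noteq> 0" using False by auto
      then have "(1 + s) * z^3 = 2 * x^3" using 4 by simp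
      then have "4 * x^3 = x^3" using a by simp
      then have "3 * x^3 = 0" by (simp add: algebra_simps)
      then show ?thesis using False by simp
    qed
  qed
qed

text \<open>The tangent line of A x^3 + B y^3 + C z^3 = 0 at a point meets the cubic again in (x (B
  y^3 - C z^3), y (C z^3 - A x^3), z (A x^3 - B y^3)). Here A = 1, B = s, C = -(1 + s); the new
  coordinates are products of factors of degree e and 3 e + 1.\<close>

lemma smooth_section_step:
  assumes g: "smooth_section e x y z"
  shows "smooth_section (4 * e + 1) (x * (T * y^3 + T1 * z^3)) (- (y * (T1 * z^3 + x^3))) (- (z * (T * y^3 - x^3)))"
proof -
  have d: "degree x \<le> e" "degree y \<le> e" "degree z \<le> e" and eq: "x^3 + T * y^3 = T1 * z^3"
    and nv: "\<And>s. \<not> (poly x s = 0 \<and> s * poly y s = 0 \<and> (1 + s) * poly z s = 0)"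
    and top: "coeff y e \<noteq> 0" "coeff y e ^ 3 = coeff z e ^ 3"
    using g by (auto simp: smooth_section_def)
  have d3: "degree (p ^ 3) \<le> 3 * e" "coeff (p^3) (3 * e) = coeff p e ^ 3" if "degree p \<le> e" for p :: "complex poly"
  proof -
    have p2: "degree (p * p) \<le> e + e" using degree_mult_le_add[OF that that] .
    show "degree (p ^ 3) \<le> 3 * e" using degree_mult_le_add[OF p2 that] by (simp add: power3_eq_cube)
    have "3 * e = e + e + e" by simp
    then show "coeff (p^3) (3 * e) = coeff p e ^ 3"
      unfolding power3_eq_cube using coeff_mult_top[OF p2 that] coeff_mult_top[OF that that] by (simp only:)
  qed
  have dT: "degree ([:a, 1:] * p ^ 3) \<le> 3 * e + 1" "coeff ([:a, 1:] * p^3) (3 * e + 1) = coeff p e ^ 3"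
    if "degree p \<le> e" for p :: "complex poly" and a
  proof -
    have a1: "degree [:a, 1:] \<le> 1" by simp
    show "degree ([:a, 1:] * p ^ 3) \<le> 3 * e + 1" using degree_mult_le_add[OF a1 d3(1)[OF that]] by simp
    show "coeff ([:a, 1:] * p^3) (3 * e + 1) = coeff p e ^ 3"
      using coeff_mult_top[OF a1 d3(1)[OF that]] d3(2)[OF that] by (simp del: mult_pCons_left)
  qed
  let ?A = "T * y^3 + T1 * z^3" and ?B = "T1 * z^3 + x^3" and ?C = "T * y^3 - x^3"
  have x3: "degree (x ^ 3) \<le> 3 * e + 1" "coeff (x^3) (3 * e + 1) = 0"
    using d3(1)[OF d(1)] by (auto intro: coeff_eq_0)
  have dABC: "degree ?A \<le> 3 * e + 1" "degree ?B \<le> 3 * e + 1" "degree ?C \<le> 3 * e + 1"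
    by (intro degree_add_le degree_diff_le dT(1) d x3)+
  have cABC: "coeff ?B (3 * e + 1) = coeff z e ^ 3" "coeff ?C (3 * e + 1) = coeff y e ^ 3"
    using dT(2)[OF d(2)] dT(2)[OF d(3)] x3 by (auto simp del: mult_pCons_left)
  have e41: "4 * e + 1 = e + (3 * e + 1)" by simp
  have cy: "coeff (- (y * ?B)) (4 * e + 1) = - (coeff y e * coeff z e ^ 3)"
    unfolding e41 coeff_minus using coeff_mult_top[OF d(2) dABC(2)] cABC by simp
  have cz: "coeff (- (z * ?C)) (4 * e + 1) = - (coeff z e * coeff y e ^ 3)"
    unfolding e41 coeff_minus using coeff_mult_top[OF d(3) dABC(3)] cABC by simp
  show ?thesis unfolding smooth_section_def
  proof (intro conjI)
    show "degree (x * ?A) \<le> 4 * e + 1" "degree (- (y * ?B)) \<le> 4 * e + 1" "degree (- (z * ?C)) \<le> 4 * e + 1"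
      unfolding e41 degree_minus by (intro degree_mult_le_add d dABC)+
    show "coeff (- (y * ?B)) (4 * e + 1) \<noteq> 0"
      unfolding cy using top by (metis mult_eq_0_iff neg_equal_0_iff_equal power_eq_0_iff zero_neq_numeral)
    show "coeff (- (y * ?B)) (4 * e + 1) ^ 3 = coeff (- (z * ?C)) (4 * e + 1) ^ 3"
      unfolding cy cz by (simp add: power_mult_distrib top(2))
    show "(x * ?A) ^ 3 + T * (- (y * ?B)) ^ 3 = T1 * (- (z * ?C)) ^ 3"
    proof -
      \<comment> \<open>In the three terms of the equation the claim becomes a (b + c)^3 - b (c +
        a)^3 + c (b - a)^3 = 0, an identity when c = a + b.\<close>
      define a b c where "a = x^3" and "b = T * y^3" and "c = T1 * z^3"
      have c: "c = a + b" using eq by (simp add: a_def b_def c_def)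
      have "(x * ?A) ^ 3 + T * (- (y * ?B)) ^ 3 - T1 * (- (z * ?C)) ^ 3 = a * (b + c)^3 - b * (c + a)^3 + c * (b - a)^3"
        by (simp add: a_def b_def c_def power_mult_distrib power_minus_odd mult.assoc del: mult_pCons_left)
      also have "\<dots> = 0" unfolding c by algebra
      finally show ?thesis by simp
    qed
    show "\<forall>s. \<not> (poly (x * ?A) s = 0 \<and> s * poly (- (y * ?B)) s = 0 \<and> (1 + s) * poly (- (z * ?C)) s = 0)"
    proof
      fix s
      have "poly x s ^ 3 + s * poly y s ^ 3 = (1 + s) * poly z s ^ 3"
        using arg_cong[OF eq, of "\<lambda>p. poly p s"] by (simp add: algebra_simps)
      note sp = smooth_point_tangent[OF this nv]
      have ev: "poly (x * ?A) s = poly x s * (s * poly y s ^ 3 + (1 + s) * poly z s ^ 3)"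
        "poly (- (y * ?B)) s = - (poly y s * ((1 + s) * poly z s ^ 3 + poly x s ^ 3))"
        "poly (- (z * ?C)) s = - (poly z s * (s * poly y s ^ 3 - poly x s ^ 3))"
        by (simp_all add: algebra_simps)
      show "\<not> (poly (x * ?A) s = 0 \<and> s * poly (- (y * ?B)) s = 0 \<and> (1 + s) * poly (- (z * ?C)) s = 0)"
        unfolding ev mult_minus_right neg_equal_0_iff_equal by (rule sp)
    qed
  qed
qed

lemma smooth_section_exists: "\<exists>e x y z. e \<ge> N \<and> smooth_section e x y z"
proof (induction N)
  case 0
  have "smooth_section 0 1 1 1" by (simp add: smooth_section_def one_pCons)
  then show ?case by blast
next
  case (Suc N)
  then obtain e x y z where e: "e \<ge> N" "smooth_section e x y z" by blast
  have "4 * e + 1 \<ge> Suc N" using e by simp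
  with smooth_section_step[OF e(2)] show ?case by blast
qed

context
  fixes e :: nat and x y z :: "complex poly"
  assumes sec: "smooth_section e x y z"
begin

lemma sec_degree: "degree x \<le> e" "degree y \<le> e" "degree z \<le> e"
  and sec_eq: "x^3 + T * y^3 = T1 * z^3"
  and sec_nv: "\<not> (poly x s = 0 \<and> s * poly y s = 0 \<and> (1 + s) * poly z s = 0)"
  and sec_top: "coeff y e \<noteq> 0" "coeff y e ^ 3 = coeff z e ^ 3"
  using sec by (auto simp: smooth_section_def)

lemma sec_poly_eq: "poly x s ^ 3 + s * poly y s ^ 3 = (1 + s) * poly z s ^ 3"
  using arg_cong[OF sec_eq, of "\<lambda>p. poly p s"] by (simp add: algebra_simps)

lemma sec_xy: "\<not> (poly x s = 0 \<and> poly y s = 0)"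
  using sec_poly_eq[of s] sec_nv[of s] by auto

lemma sec_y_nz: "y \<noteq> 0" "degree y = e"
  using sec_top sec_degree le_degree by (auto intro: antisym)

text \<open>Both (u, v, w) and (x, y, z) are orthogonal to the gradient (\<open>p0\<close>,
  \<open>p1\<close>, \<open>p2\<close>), whose entries have no common zero, so their cross product
  is l times the gradient. The cross product has degree at most 2 e but \<open>p1\<close> has degree
  2 e + 1, so l = 0 and (u, v, w) = q (x, y, z). By degrees q is constant, and the condition on the
  top coefficient of v makes it zero: this removes the trivial direction of rescaling the
  section.\<close>

lemma syzygies:
  assumes d: "degree u \<le> e" "degree v \<le> e" "degree w \<le> e"
    and eq: "x^2 * u + T * y^2 * v - T1 * z^2 * w = 0" and "coeff v e = 0"
  shows "u = 0 \<and> v = 0 \<and> w = 0"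
proof -
  define p0 p1 p2 where "p0 = x^2" and "p1 = T * y^2" and "p2 = - (T1 * z^2)"
  have pU: "p0 * u + p1 * v + p2 * w = 0" using eq by (simp add: p0_def p1_def p2_def del: mult_pCons_left)
  have pX: "p0 * x + p1 * y + p2 * z = 0" using sec_eq
    by (simp add: p0_def p1_def p2_def power2_eq_square power3_eq_cube mult.assoc del: mult_pCons_left)
  have "\<not> (poly p0 s = 0 \<and> poly p1 s = 0 \<and> poly p2 s = 0)" for s
  proof -
    have "poly p0 s = poly x s ^ 2" "poly p1 s = s * poly y s ^ 2" "poly p2 s = - ((1 + s) * poly z s ^ 2)"
      by (auto simp: p0_def p1_def p2_def algebra_simps)
    then show ?thesis using sec_nv[of s] by auto
  qed
  then obtain a b c where abc: "a * p0 + b * p1 + c * p2 = 1" using bezout_no_common_root by blast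
  define k0 k1 k2 where "k0 = y * w - z * v" and "k1 = z * u - x * w" and "k2 = x * v - y * u"
  define l where "l = a * k0 + b * k1 + c * k2"
  have k01: "p0 * k1 = p1 * k0" using pU pX unfolding k0_def k1_def by algebra
  have k12: "p1 * k2 = p2 * k1" using pU pX unfolding k2_def k1_def by algebra
  have k02: "p0 * k2 = p2 * k0" using pU pX unfolding k2_def k0_def by algebra
  have k1: "k1 = l * p1" unfolding l_def using abc k01 k12 by algebra
  have k0: "k0 = l * p0" unfolding l_def using abc k01 k02 by algebra
  have k2: "k2 = l * p2" unfolding l_def using abc k12 k02 by algebra
  have "degree k1 \<le> e + e" unfolding k1_def
    by (intro degree_diff_le degree_mult_le_add d sec_degree)
  moreover have "degree p1 = 2 * e + 1" "p1 \<noteq> 0" using sec_y_nz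
    by (auto simp: p1_def degree_mult_eq degree_power_eq)
  ultimately have "l = 0" using k1 by (metis One_nat_def add.commute degree_mult_eq le_add2 mult_2 not_less_eq_eq plus_1_eq_Suc le_trans)
  then have K: "y * w = z * v" "z * u = x * w" "x * v = y * u" using k0 k1 k2 by (auto simp: k0_def k1_def k2_def)
  obtain \<alpha> \<beta> \<gamma> where "\<alpha> * x + \<beta> * y + \<gamma> * 0 = 1" using bezout_no_common_root[of x y 0] sec_xy by auto
  then have ab: "\<alpha> * x + \<beta> * y = 1" by simp
  define q where "q = \<alpha> * u + \<beta> * v"
  have u: "u = x * q" unfolding q_def using ab K by algebra
  have v: "v = y * q" unfolding q_def using ab K by algebra
  have "y * w = y * (z * q)" using K v by algebra
  then have w: "w = z * q" using sec_y_nz by simp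
  have "q = 0"
  proof (rule ccontr)
    assume "q \<noteq> 0"
    then have "degree v = e + degree q" using v sec_y_nz by (simp add: degree_mult_eq)
    then have "degree q \<le> 0" using d by simp
    from coeff_mult_top[OF sec_degree(2) this] have "coeff v e = coeff y e * coeff q 0" using v by simp
    then have "coeff q 0 = 0" using sec_top assms by simp
    then show False using \<open>degree q \<le> 0\<close> \<open>q \<noteq> 0\<close> by (metis le_zero_eq leading_coeff_0_iff)
  qed
  then show ?thesis using u v w by simp
qed

text \<open>The map is the derivative of the cubic equation along the section, up to the factor 3.
  Removing the top coefficient of v leaves 3 (e + 1) - 1 unknowns for the 3 e + 2 coefficients of P,
  and this square system is injective by the preceding lemma.\<close>

lemma tangent_map_onto:
  assumes "degree P \<le> 3 * e + 1"
  shows "\<exists>u v w. degree u \<le> e \<and> degree v \<le> e \<and> degree w \<le> e \<and> x^2 * u + T * y^2 * v - T1 * z^2 * w = P"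
proof -
  \<comment> \<open>The pair (i, j) indexes the coefficient of s^j in the i-th unknown polynomial;
    (1, e) is the top coefficient of v, which is set to 0.\<close>
  define A where "A = ({..<3::nat} \<times> {..e}) - {(1, e)}"
  define p where "p i = (if i = 0 then x^2 else if i = Suc 0 then T * y^2 else - (T1 * z^2))" for i :: nat
  define B where "B = {..3 * e + 1}"
  define M where "M a b = coeff (p (fst a) * monom 1 (snd a)) b" for a b
  define U where "U c i = (\<Sum>j\<le>e. monom (if (i, j) = (1, e) then 0 else c (i, j)) j)"
    for c :: "nat \<times> nat \<Rightarrow> complex" and i :: nat
  have degU: "degree (U c i) \<le> e" for c i
    unfolding U_def by (intro degree_sum_le) (auto intro: order_trans[OF degree_monom_le])
  have cU: "coeff (U c i) j = (if j \<le> e \<and> (i, j) \<noteq> (1, e) then c (i, j) else 0)" for c i j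
    unfolding U_def coeff_sum coeff_monom by (auto simp: sum.delta)
  have A: "finite A" "card A = card B" by (auto simp: A_def B_def)
  have SU: "(\<Sum>a\<in>A. c a * M a b) = coeff (x^2 * U c 0 + T * y^2 * U c 1 - T1 * z^2 * U c 2) b" for c b
  proof -
    have "(\<Sum>a\<in>A. c a * M a b) = (\<Sum>a\<in>{..<3}\<times>{..e}. (if a = (1, e) then 0 else c a) * M a b)"
      unfolding A_def by (intro sum.mono_neutral_cong_left) auto
    also have "\<dots> = (\<Sum>i<3. \<Sum>j\<le>e. (if (i, j) = (1, e) then 0 else c (i, j)) * coeff (p i * monom 1 j) b)"
      by (simp add: sum.cartesian_product M_def case_prod_unfold) (auto intro!: sum.cong simp: prod_eq_iff)
    also have "\<dots> = (\<Sum>i<3. coeff (p i * U c i) b)"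
    proof (intro sum.cong refl)
      fix i
      have "p i * U c i = (\<Sum>j\<le>e. smult (if (i, j) = (1, e) then 0 else c (i, j)) (p i * monom 1 j))"
        unfolding U_def sum_distrib_left by (intro sum.cong refl) (simp add: mult_smult_right[symmetric] smult_monom)
      then show "(\<Sum>j\<le>e. (if (i, j) = (1, e) then 0 else c (i, j)) * coeff (p i * monom 1 j) b) = coeff (p i * U c i) b"
        by (simp only: coeff_sum coeff_smult)
    qed
    also have "\<dots> = coeff (p 0 * U c 0 + p 1 * U c 1 + p 2 * U c 2) b"
      by (simp add: numeral_3_eq_3 numeral_2_eq_2)
    finally show ?thesis by (simp add: p_def del: mult_pCons_left)
  qed
  have dxyz: "degree (x^2 * U c 0 + T * y^2 * U c 1 - T1 * z^2 * U c 2) \<le> 3 * e + 1" for c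
  proof -
    have a: "degree (x^2 * U c 0) \<le> (e + e) + e" unfolding power2_eq_square
      by (intro degree_mult_le_add sec_degree degU)
    have b: "degree (T * y^2 * U c 1) \<le> (1 + (e + e)) + e" unfolding power2_eq_square
      by (intro degree_mult_le_add sec_degree degU) auto
    have c: "degree (T1 * z^2 * U c 2) \<le> (1 + (e + e)) + e" unfolding power2_eq_square
      by (intro degree_mult_le_add sec_degree degU) auto
    show ?thesis using a b c by (intro degree_diff_le degree_add_le) auto
  qed
  have "\<exists>c. \<forall>b\<in>B. (\<Sum>a\<in>A. c a * M a b) = coeff P b"
  proof (rule square_system_solvable)
    fix c a assume 0: "\<And>b. b \<in> B \<Longrightarrow> (\<Sum>a\<in>A. c a * M a b) = 0" and a: "a \<in> A"
    have "x^2 * U c 0 + T * y^2 * U c 1 - T1 * z^2 * U c 2 = 0"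
    proof (rule poly_eqI)
      fix b show "coeff (x^2 * U c 0 + T * y^2 * U c 1 - T1 * z^2 * U c 2) b = coeff 0 b"
      proof (cases "b \<in> B")
        case True then show ?thesis using 0[OF True] SU[of c b] by simp
      next
        case False
        have "coeff (x^2 * U c 0 + T * y^2 * U c 1 - T1 * z^2 * U c 2) b = 0"
          by (rule coeff_eq_0, rule le_less_trans[OF dxyz]) (use False in \<open>simp add: B_def\<close>)
        then show ?thesis by simp
      qed
    qed
    from syzygies[OF degU degU degU this] have U0: "U c 0 = 0" "U c 1 = 0" "U c 2 = 0" by (auto simp: cU)
    obtain i j where ij: "a = (i, j)" "i < 3" "j \<le> e" "(i, j) \<noteq> (1, e)" using a by (auto simp: A_def)
    then have "i = 0 \<or> i = 1 \<or> i = 2" by auto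
    then have "coeff (U c i) j = 0" using U0 by auto
    then show "c a = 0" using ij by (auto simp: cU)
  qed (use A in \<open>auto simp: B_def\<close>)
  then obtain c where c: "\<forall>b\<in>B. (\<Sum>a\<in>A. c a * M a b) = coeff P b" by blast
  have "x^2 * U c 0 + T * y^2 * U c 1 - T1 * z^2 * U c 2 = P"
  proof (rule poly_eqI)
    fix b show "coeff (x^2 * U c 0 + T * y^2 * U c 1 - T1 * z^2 * U c 2) b = coeff P b"
    proof (cases "b \<in> B")
      case True then show ?thesis using c SU[of c b] by simp
    next
      case False
      have "coeff (x^2 * U c 0 + T * y^2 * U c 1 - T1 * z^2 * U c 2) b = 0"
        by (rule coeff_eq_0, rule le_less_trans[OF dxyz]) (use False in \<open>simp add: B_def\<close>)
      moreover have "coeff P b = 0"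
        by (rule coeff_eq_0, rule le_less_trans[OF assms]) (use False in \<open>simp add: B_def\<close>)
      ultimately show ?thesis by simp
    qed
  qed
  then show ?thesis using degU by blast
qed

end

section \<open>Deformations that leave the plane: partial fractions\<close>

lemma degree_prod_le_card:
  fixes f :: "'i \<Rightarrow> 'a::comm_ring_1 poly"
  assumes "\<And>i. i \<in> A \<Longrightarrow> degree (f i) \<le> k"
  shows "degree (\<Prod>i\<in>A. f i) \<le> card A * k"
  using assms
proof (induction A rule: infinite_finite_induct)
  case (insert a A)
  then have "degree (f a * (\<Prod>i\<in>A. f i)) \<le> k + card A * k" by (intro degree_mult_le_add) auto
  then show ?case using insert by simp
qed auto

text \<open>Modulo b j only the j-th summand survives, and its factor is invertible there; so q j
  can be chosen as a remainder modulo b j, and the rest is divisible by every b j. In the induction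
  the new b k is absorbed into g.\<close>

lemma partial_fractions:
  fixes b :: "'i \<Rightarrow> complex poly"
  assumes "finite J" "\<And>j. j \<in> J \<Longrightarrow> degree (b j) = e" "\<And>j. j \<in> J \<Longrightarrow> b j \<noteq> 0"
    and "\<And>i j s. i \<in> J \<Longrightarrow> j \<in> J \<Longrightarrow> i \<noteq> j \<Longrightarrow> \<not> (poly (b i) s = 0 \<and> poly (b j) s = 0)"
    and "\<And>j s. j \<in> J \<Longrightarrow> \<not> (poly (b j) s = 0 \<and> poly g s = 0)"
  shows "\<exists>R q. (\<forall>j. degree (q j) \<le> e) \<and> P = (\<Prod>j\<in>J. b j) * R + (\<Sum>j\<in>J. (\<Prod>i\<in>J-{j}. b i) * g * q j)"
  using assms
proof (induction J arbitrary: g rule: finite_induct)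
  case empty
  show ?case by (intro exI[of _ P] exI[of _ "\<lambda>_. 0"]) auto
next
  case (insert k J)
  have nc: "\<not> (poly (b j) s = 0 \<and> poly (g * b k) s = 0)" if "j \<in> J" for j s
    using insert.prems(3)[of j k s] insert.prems(4)[of j s] insert.hyps that by auto
  have "\<exists>R' q. (\<forall>j. degree (q j) \<le> e) \<and>
    P = (\<Prod>j\<in>J. b j) * R' + (\<Sum>j\<in>J. (\<Prod>i\<in>J-{j}. b i) * (g * b k) * q j)"
  proof (rule insert.IH)
    fix i j s assume "i \<in> J" "j \<in> J" "i \<noteq> j"
    then show "\<not> (poly (b i) s = 0 \<and> poly (b j) s = 0)" using insert.prems(3)[of i j s] by blast
  qed (use insert.prems nc in auto)
  then obtain R' q where q: "\<forall>j. degree (q j) \<le> e"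
    "P = (\<Prod>j\<in>J. b j) * R' + (\<Sum>j\<in>J. (\<Prod>i\<in>J-{j}. b i) * (g * b k) * q j)"
    by blast
  obtain a1 a2 a3 where "a1 * b k + a2 * g + a3 * 0 = 1"
    using bezout_no_common_root[of "b k" g 0] insert.prems(4)[of k] by auto
  then have a: "a1 * b k + a2 * g = 1" by simp
  \<comment> \<open>With a1 b_k + a2 g = 1, the term R' a2 g is reduced modulo b_k; the quotient
    goes into R, so only v of degree at most e is left as a coefficient of g.\<close>
  define v where "v = (R' * a2) mod b k"
  define R where "R = R' * a1 + (R' * a2 div b k) * g"
  have Rk: "R' = b k * R + g * v"
  proof -
    have "R' * a2 = (R' * a2 div b k) * b k + v" by (metis v_def div_mult_mod_eq)
    moreover have "R' = R' * a1 * b k + R' * a2 * g"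
      using arg_cong[OF a, of "\<lambda>u. R' * u"] by (simp add: algebra_simps)
    ultimately have "R' = R' * a1 * b k + ((R' * a2 div b k) * b k + v) * g" by metis
    then show ?thesis unfolding R_def by (simp add: algebra_simps)
  qed
  have "degree v \<le> e" unfolding v_def
    using degree_mod_less[of "b k" "R' * a2"] insert.prems(1,2) by fastforce
  define q' where "q' = q(k := v)"
  have "(\<Sum>j\<in>insert k J. (\<Prod>i\<in>insert k J-{j}. b i) * g * q' j) = (\<Prod>j\<in>J. b j) * g * v + (\<Sum>j\<in>J. (\<Prod>i\<in>J-{j}. b i) * (g * b k) * q j)"
  proof -
    have "insert k J - {j} = insert k (J - {j})" if "j \<in> J" for j using that insert.hyps by auto
    then have "(\<Sum>j\<in>J. (\<Prod>i\<in>insert k J-{j}. b i) * g * q' j) = (\<Sum>j\<in>J. (\<Prod>i\<in>J-{j}. b i) * (g * b k) * q j)"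
      using insert.hyps by (intro sum.cong refl) (auto simp: q'_def)
    moreover have "insert k J - {k} = J" using insert.hyps by auto
    ultimately show ?thesis using insert.hyps by (simp add: q'_def)
  qed
  then have "P = (\<Prod>j\<in>insert k J. b j) * R + (\<Sum>j\<in>insert k J. (\<Prod>i\<in>insert k J-{j}. b i) * g * q' j)"
    using q(2) Rk insert.hyps by (simp add: algebra_simps)
  moreover have "\<forall>j. degree (q' j) \<le> e" using q(1) \<open>degree v \<le> e\<close> by (auto simp: q'_def)
  ultimately show ?case by blast
qed

context
  fixes e :: nat and x y z :: "complex poly"
  assumes sec: "smooth_section e x y z" and e: "e \<ge> 1"
begin

text \<open>Otherwise x^3 = y^3 = z^3, and a root of y, which exists because its degree is e, would
  be a root of x as well.\<close>

lemma sec_fiber_nz: "T * (y^3 - z^3) \<noteq> 0"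
proof
  assume "T * (y^3 - z^3) = 0"
  then have yz: "y^3 = z^3" by (metis mult_eq_0_iff pCons_eq_0_iff right_minus_eq zero_neq_one)
  have "T1 = 1 + T" by (simp add: one_pCons)
  then have "x^3 = y^3" using sec_eq[OF sec] yz by (simp only: ring_distribs) simp
  have "degree y > 0" using sec_y_nz[OF sec] e by simp
  then obtain s where "poly y s = 0" using fundamental_theorem_of_algebra[of y] by (auto simp: constant_degree)
  moreover then have "poly x s = 0" using arg_cong[OF \<open>x^3 = y^3\<close>, of "\<lambda>p. poly p s"] by simp
  ultimately show False using sec_xy[OF sec] by auto
qed

text \<open>The forbidden values of c j are those of x / y at infinity and at the zeros of s (y^3 -
  z^3), a finite set. Avoiding them makes x - c_j y of exact degree e and coprime to s (y^3 -
  z^3).\<close>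

lemma exists_transversal_lines:
  assumes "finite J"
  shows "\<exists>c. inj_on c J \<and> (\<forall>j\<in>J. coeff (x - smult (c j) y) e \<noteq> 0 \<and>
    (\<forall>s. \<not> (poly (x - smult (c j) y) s = 0 \<and> poly (T * (y^3 - z^3)) s = 0)))"
proof -
  define bad where "bad = insert (coeff x e / coeff y e) ((\<lambda>s. poly x s / poly y s) ` {s. poly (T * (y^3 - z^3)) s = 0})"
  have "finite bad" unfolding bad_def using poly_roots_finite[OF sec_fiber_nz] by simp
  then have "infinite (- bad)" using infinite_UNIV_char_0 by (metis finite_compl)
  then obtain B where B: "B \<subseteq> - bad" "finite B" "card B = card J"
    using infinite_arbitrarily_large by blast
  then obtain c where c: "bij_betw c J B" using assms finite_same_card_bij by metis
  have "coeff (x - smult (c j) y) e \<noteq> 0 \<and>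
    (\<forall>s. \<not> (poly (x - smult (c j) y) s = 0 \<and> poly (T * (y^3 - z^3)) s = 0))" if j: "j \<in> J" for j
  proof (intro conjI allI notI)
    have nb: "c j \<notin> bad" using bij_betwE[OF c] B j by auto
    show False if "coeff (x - smult (c j) y) e = 0"
    proof -
      have "c j = coeff x e / coeff y e" using that sec_top(1)[OF sec] by (simp add: field_simps)
      then show False using nb by (simp add: bad_def)
    qed
    fix s assume A: "poly (x - smult (c j) y) s = 0 \<and> poly (T * (y^3 - z^3)) s = 0"
    then have "poly y s \<noteq> 0" using sec_xy[OF sec, of s] by auto
    then have "c j = poly x s / poly y s" using A by (simp add: field_simps)
    then show False using nb A by (auto simp: bad_def)
  qed
  then show ?thesis using c by (auto simp: bij_betw_def)
qed

text \<open>The first summand comes from moving the section within its plane, the q j from moving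
  its coordinates w_j out of the plane. Partial fractions split off the latter; since the product of
  the b j has exact degree \<open>card J * e\<close>, the cofactor R has degree at most 3 e + 1 and
  is in the image of the tangent map of the cubics.\<close>

lemma unobstructed:
  fixes c :: "'i \<Rightarrow> complex"
  defines "b \<equiv> \<lambda>j. x - smult (c j) y"
  assumes J: "finite J" "inj_on c J"
    and top: "\<And>j. j \<in> J \<Longrightarrow> coeff (b j) e \<noteq> 0"
    and nc: "\<And>j s. j \<in> J \<Longrightarrow> \<not> (poly (b j) s = 0 \<and> poly (T * (y^3 - z^3)) s = 0)"
    and P: "degree P \<le> (card J + 3) * e + 1"
  shows "\<exists>u v w q. degree u \<le> e \<and> degree v \<le> e \<and> degree w \<le> e \<and> (\<forall>j. degree (q j) \<le> e) \<and>
     P = (\<Prod>j\<in>J. b j) * (x^2 * u + T * y^2 * v - T1 * z^2 * w) +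
       (\<Sum>j\<in>J. (\<Prod>i\<in>J-{j}. b i) * (T * (y^3 - z^3)) * q j)"
proof -
  let ?g = "T * (y^3 - z^3)"
  have db: "degree (b j) \<le> e" for j unfolding b_def
    using sec_degree[OF sec] by (intro degree_diff_le) (auto intro: order_trans[OF degree_smult_le])
  have db': "degree (b j) = e" "b j \<noteq> 0" if "j \<in> J" for j
    using top[OF that] db[of j] le_degree[of "b j" e] by auto
  have "\<not> (poly (b i) s = 0 \<and> poly (b j) s = 0)" if "i \<in> J" "j \<in> J" "i \<noteq> j" for i j s
  proof
    assume A: "poly (b i) s = 0 \<and> poly (b j) s = 0"
    moreover have "(c i - c j) * poly y s = poly (b j) s - poly (b i) s" by (simp add: b_def algebra_simps)
    ultimately have "(c i - c j) * poly y s = 0" by simp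
    then have "poly y s = 0" using that J by (auto simp: inj_on_def)
    then show False using A sec_xy[OF sec, of s] by (simp add: b_def)
  qed
  from partial_fractions[where P = P and b = b and J = J and e = e and g = ?g, OF J(1) db' this nc]
  obtain R q where q: "\<forall>j. degree (q j) \<le> e"
     and PR: "P = (\<Prod>j\<in>J. b j) * R + (\<Sum>j\<in>J. (\<Prod>i\<in>J-{j}. b i) * ?g * q j)"
    by blast
  have d3: "degree (p ^ 3) \<le> e + e + e" if "degree p \<le> e" for p :: "complex poly"
    unfolding power3_eq_cube by (intro degree_mult_le_add that)
  have dg: "degree ?g \<le> 1 + (e + e + e)"
    by (intro degree_mult_le_add degree_diff_le d3 sec_degree[OF sec]) auto
  have "degree (\<Sum>j\<in>J. (\<Prod>i\<in>J-{j}. b i) * ?g * q j) \<le> (card J + 3) * e + 1"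
  proof (rule degree_sum_le[OF J(1)])
    fix j assume j: "j \<in> J"
    have "degree ((\<Prod>i\<in>J-{j}. b i) * ?g * q j) \<le> card (J - {j}) * e + (1 + (e + e + e)) + e"
      by (intro degree_mult_le_add[OF degree_mult_le_add] degree_prod_le_card db dg) (use q in auto)
    also have "\<dots> = (card J + 3) * e + 1" using J j by (cases "card J") (auto simp: algebra_simps)
    finally show "degree ((\<Prod>i\<in>J-{j}. b i) * ?g * q j) \<le> (card J + 3) * e + 1" .
  qed
  then have "degree (P - (\<Sum>j\<in>J. (\<Prod>i\<in>J-{j}. b i) * ?g * q j)) \<le> (card J + 3) * e + 1"
    using P by (intro degree_diff_le)
  moreover have "P - (\<Sum>j\<in>J. (\<Prod>i\<in>J-{j}. b i) * ?g * q j) = (\<Prod>j\<in>J. b j) * R"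
    using PR by simp
  ultimately have dR: "degree ((\<Prod>j\<in>J. b j) * R) \<le> (card J + 3) * e + 1" by simp
  have "degree R \<le> 3 * e + 1"
  proof (cases "R = 0")
    case False
    have "degree (\<Prod>j\<in>J. b j) = card J * e" "(\<Prod>j\<in>J. b j) \<noteq> 0"
      using db' J by (auto simp: degree_prod_eq_sum_degree)
    then have "card J * e + degree R \<le> (card J + 3) * e + 1"
      using dR False by (simp add: degree_mult_eq)
    then show ?thesis by (simp add: algebra_simps)
  qed simp
  then obtain u v w where "degree u \<le> e" "degree v \<le> e" "degree w \<le> e" "x^2 * u + T * y^2 * v - T1 * z^2 * w = R"
    using tangent_map_onto[OF sec] by blast
  then show ?thesis using PR q by blast
qed

end

unbundle no vec_syntax
unbundle fps_syntax

section \<open>Hensel lifting\<close>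

definition fagree :: "nat \<Rightarrow> 'a::comm_ring_1 fps \<Rightarrow> 'a fps \<Rightarrow> bool" where
  "fagree k a b \<longleftrightarrow> (\<forall>i\<le>k. a $ i = b $ i)"

lemma fagree_refl [simp]: "fagree k a a"
  by (simp add: fagree_def)

lemma fagree_add: "fagree k a b \<Longrightarrow> fagree k a' b' \<Longrightarrow> fagree k (a + a') (b + b')"
  by (simp add: fagree_def)

lemma fagree_mult: "fagree k a b \<Longrightarrow> fagree k a' b' \<Longrightarrow> fagree k (a * a') (b * b')"
  by (auto simp: fagree_def fps_mult_nth intro!: sum.cong)

lemma fagree_power: "fagree k a b \<Longrightarrow> fagree k (a ^ n) (b ^ n)"
  by (induction n) (auto intro: fagree_mult)

lemma fagree_sum: "(\<And>i. i \<in> A \<Longrightarrow> fagree k (f i) (g i)) \<Longrightarrow> fagree k (\<Sum>i\<in>A. f i) (\<Sum>i\<in>A. g i)"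
  by (induction A rule: infinite_finite_induct) (auto intro: fagree_add)

lemma fagree_prod: "(\<And>i. i \<in> A \<Longrightarrow> fagree k (f i) (g i)) \<Longrightarrow> fagree k (\<Prod>i\<in>A. f i) (\<Prod>i\<in>A. g i)"
  by (induction A rule: infinite_finite_induct) (auto intro: fagree_mult)

lemma fagree_mon: "(\<And>v. fagree k (X v) (Y v)) \<Longrightarrow> fagree k (mon m X) (mon m Y)"
  unfolding mon_def by (intro fagree_prod fagree_power)

text \<open>Invariant of a perturbation step: B is a first order perturbation of the constant term
  of A, and A' is A perturbed in order k + 1 by the same first order term.\<close>

definition fperturb :: "nat \<Rightarrow> 'a::comm_ring_1 fps \<Rightarrow> 'a fps \<Rightarrow> 'a fps \<Rightarrow> bool" where
  "fperturb k A A' B \<longleftrightarrow> fagree k A A' \<and> A' $ Suc k = A $ Suc k + B $ 1 \<and> B $ 0 = A $ 0"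

lemma fperturb_const: "fperturb k (fps_const c) (fps_const c) (fps_const c)"
  by (simp add: fperturb_def)

lemma fperturb_one: "fperturb k 1 1 1"
  by (simp add: fperturb_def)

lemma fperturb_zero: "fperturb k 0 0 0"
  by (simp add: fperturb_def)

lemma fperturb_add: "fperturb k A A' B \<Longrightarrow> fperturb k C C' D \<Longrightarrow> fperturb k (A + C) (A' + C') (B + D)"
  by (auto simp: fperturb_def intro: fagree_add)

lemma fperturb_mult:
  assumes "fperturb k A A' B" "fperturb k C C' D"
  shows "fperturb k (A * C) (A' * C') (B * D)"
proof -
  have A: "\<And>i. i \<le> k \<Longrightarrow> A' $ i = A $ i" "A' $ Suc k = A $ Suc k + B $ 1" "B $ 0 = A $ 0"
    and C: "\<And>i. i \<le> k \<Longrightarrow> C' $ i = C $ i" "C' $ Suc k = C $ Suc k + D $ 1" "D $ 0 = C $ 0"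
    using assms by (auto simp: fperturb_def fagree_def)
  \<comment> \<open>Only the two end terms of this coefficient involve an index k + 1; the middle
    sum is the same before and after the perturbation.\<close>
  have split: "(X * Y) $ Suc k = X $ 0 * Y $ Suc k + (\<Sum>i=1..k. X $ i * Y $ (Suc k - i)) + X $ Suc k * Y $ 0"
    for X Y :: "'a fps"
    by (simp add: fps_mult_nth sum.atLeast_Suc_atMost[of 0 "k"] sum.atLeast0_atMost_Suc)
  have "(\<Sum>i=1..k. A' $ i * C' $ (Suc k - i)) = (\<Sum>i=1..k. A $ i * C $ (Suc k - i))"
    by (intro sum.cong) (auto simp: A C)
  then have "(A' * C') $ Suc k = (A * C) $ Suc k + (A $ 0 * D $ 1 + B $ 1 * C $ 0)"
    unfolding split using A C by (simp add: algebra_simps)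
  also have "A $ 0 * D $ 1 + B $ 1 * C $ 0 = (B * D) $ 1"
    using A C by (simp add: fps_mult_nth)
  finally show ?thesis using assms A C by (auto simp: fperturb_def intro: fagree_mult)
qed

lemma fperturb_power: "fperturb k A A' B \<Longrightarrow> fperturb k (A ^ n) (A' ^ n) (B ^ n)"
  by (induction n) (auto intro: fperturb_mult fperturb_one)

lemma fperturb_prod:
  "(\<And>i. i \<in> I \<Longrightarrow> fperturb k (A i) (A' i) (B i)) \<Longrightarrow> fperturb k (\<Prod>i\<in>I. A i) (\<Prod>i\<in>I. A' i) (\<Prod>i\<in>I. B i)"
  by (induction I rule: infinite_finite_induct) (auto intro: fperturb_mult fperturb_one)

lemma fperturb_sum:
  "(\<And>i. i \<in> I \<Longrightarrow> fperturb k (A i) (A' i) (B i)) \<Longrightarrow> fperturb k (\<Sum>i\<in>I. A i) (\<Sum>i\<in>I. A' i) (\<Sum>i\<in>I. B i)"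
  by (induction I rule: infinite_finite_induct) (auto intro: fperturb_add fperturb_zero)

lemma fperturb_mon:
  "(\<And>v. fperturb k (A v) (A' v) (B v)) \<Longrightarrow> fperturb k (mon m A) (mon m A') (mon m B)"
  unfolding mon_def by (intro fperturb_prod fperturb_power)

text \<open>Hensel lifting for polynomial solutions of bounded degree of an equation whose coefficients
  p0 + eps p1 depend on a parameter eps: surjectivity of the derivative of the equation at the
  solution x0 for eps = 0 suffices.\<close>

lemma hensel_bounded_degree:
  fixes p0 p1 :: "'v monom \<Rightarrow> complex poly" and x0 :: "'v \<Rightarrow> complex poly" and S :: "'v monom set"
  defines "G0 \<equiv> \<lambda>X. \<Sum>m\<in>S. fps_const (p0 m) * mon m X"
  defines "G \<equiv> \<lambda>X. \<Sum>m\<in>S. (fps_const (p0 m) + fps_X * fps_const (p1 m)) * mon m X"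
  assumes sol: "(\<Sum>m\<in>S. p0 m * mon m x0) = 0" and deg0: "\<And>v. degree (x0 v) \<le> e"
    and degG: "\<And>X k. (\<And>v i. degree (X v $ i) \<le> e) \<Longrightarrow> degree (G X $ k) \<le> N"
    and onto: "\<And>P. degree P \<le> N \<Longrightarrow> \<exists>y. (\<forall>v. degree (y v) \<le> e) \<and>
        G0 (\<lambda>v. fps_const (x0 v) + fps_X * fps_const (y v)) $ 1 = P"
  shows "\<exists>X. G X = 0 \<and> (\<forall>v. X v $ 0 = x0 v) \<and> (\<forall>v i. degree (X v $ i) \<le> e)"
proof -
  define ok where "ok k X \<longleftrightarrow> (\<forall>i\<le>k. G X $ i = 0) \<and> (\<forall>v. X v $ 0 = x0 v) \<and> (\<forall>v i. degree (X v $ i) \<le> e)" for k X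
  have hom0: "rhom (\<lambda>a :: complex poly fps. a $ 0)"
    by (simp add: rhom_def)
  have ok0: "ok 0 (\<lambda>v. fps_const (x0 v))"
  proof -
    have "G (\<lambda>v. fps_const (x0 v)) $ 0 = 0"
      using sol by (simp add: G_def fps_sum_nth rhom_mon[OF hom0])
    then show ?thesis using deg0 by (auto simp: ok_def)
  qed
  have step: "\<exists>X'. ok (Suc k) X' \<and> (\<forall>v. fagree k (X v) (X' v))" if X: "ok k X" for k X
  proof -
    have X0: "\<And>v. X v $ 0 = x0 v" and Xd: "\<And>v i. degree (X v $ i) \<le> e" using X by (auto simp: ok_def)
    \<comment> \<open>The correction eps^(k+1) y is chosen so that its first order effect cancels
      the error in order k + 1.\<close>
    have "degree (- (G X $ Suc k)) \<le> N" using degG[OF Xd] by simp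
    then obtain y where y: "\<forall>v. degree (y v) \<le> e"
      "G0 (\<lambda>v. fps_const (x0 v) + fps_X * fps_const (y v)) $ 1 = - (G X $ Suc k)"
      using onto by blast
    define X' where "X' v = X v + fps_X ^ Suc k * fps_const (y v)" for v
    let ?B = "\<lambda>v. fps_const (x0 v) + fps_X * fps_const (y v)"
    have pX: "fperturb k (X v) (X' v) (?B v)" for v
      using X0 by (simp add: fperturb_def fagree_def X'_def fps_X_power_mult_nth del: power_Suc)
    have pm: "fperturb k (mon m X) (mon m X') (mon m ?B)" for m
      by (intro fperturb_mon pX)
    have pg: "fperturb k ((fps_const (p0 m) + fps_X * fps_const (p1 m)) * mon m X)
       ((fps_const (p0 m) + fps_X * fps_const (p1 m)) * mon m X') (fps_const (p0 m) * mon m ?B)" for m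
    proof -
      have a: "fperturb k (fps_const (p0 m) * mon m X) (fps_const (p0 m) * mon m X') (fps_const (p0 m) * mon m ?B)"
        by (intro fperturb_mult fperturb_const pm)
      \<comment> \<open>The deformation terms p1 carry a factor eps, so they feel a change of X in
        order k + 1 only from order k + 2 on: their first order contribution is 0.\<close>
      have b: "fperturb k (fps_X * fps_const (p1 m) * mon m X) (fps_X * fps_const (p1 m) * mon m X') 0"
      proof -
        have "fagree k (mon m X) (mon m X')" using pm by (simp add: fperturb_def)
        then show ?thesis by (auto simp: fperturb_def fagree_def mult.assoc fps_X_mult_nth)
      qed
      show ?thesis using fperturb_add[OF a b] by (simp add: distrib_right)
    qed
    have "fperturb k (G X) (G X') (G0 ?B)"
      unfolding G_def G0_def by (intro fperturb_sum pg)
    then have "G X' $ i = 0" if "i \<le> Suc k" for i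
      using X y that by (auto simp: fperturb_def fagree_def ok_def le_Suc_eq)
    moreover have "X' v $ 0 = x0 v" for v using X0 by (simp add: X'_def)
    moreover have "degree (X' v $ i) \<le> e" for v i
      using Xd y by (auto simp: X'_def fps_X_power_mult_nth simp del: power_Suc intro!: degree_add_le)
    ultimately have "ok (Suc k) X'" by (auto simp: ok_def)
    then show ?thesis using pX by (auto simp: fperturb_def)
  qed
  have "\<exists>Z. \<forall>k. ok k (Z k) \<and> (\<forall>v. fagree k (Z k v) (Z (Suc k) v))"
  proof (rule dependent_nat_choice)
    show "\<exists>X. ok 0 X" using ok0 by blast
    show "\<exists>X'. ok (Suc k) X' \<and> (\<forall>v. fagree k (X v) (X' v))" if "ok k X" for X k
      by (rule step[OF that])
  qed
  then obtain Z where Z: "\<And>k. ok k (Z k)" "\<And>k v. fagree k (Z k v) (Z (Suc k) v)"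
    by blast
  have mono: "Z (i + j) v $ i = Z i v $ i" for i j v
  proof (induction j)
    case (Suc j)
    then show ?case using Z(2)[of "i + j" v] by (simp add: fagree_def)
  qed simp
  \<comment> \<open>The coefficient of eps^i no longer changes after stage i, so the diagonal is the
    limit.\<close>
  define X :: "'v \<Rightarrow> complex poly fps" where "X v = Abs_fps (\<lambda>i. Z i v $ i)" for v
  have XZ: "fagree k (X v) (Z k v)" for k v
    unfolding fagree_def
  proof (intro allI impI)
    fix i assume "i \<le> k"
    then show "X v $ i = Z k v $ i" using mono[of i "k - i" v] by (simp add: X_def)
  qed
  have "G X $ k = 0" for k
  proof -
    have "fagree k (G X) (G (Z k))"
      unfolding G_def by (intro fagree_sum fagree_mult fagree_refl fagree_mon XZ)
    then show ?thesis using Z(1)[of k] by (auto simp: fagree_def ok_def)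
  qed
  then have "G X = 0" by (simp add: fps_eq_iff)
  moreover have "X v $ 0 = x0 v" for v using Z(1)[of 0] by (simp add: X_def ok_def)
  moreover have "degree (X v $ i) \<le> e" for v i using Z(1)[of i] by (simp add: X_def ok_def)
  ultimately show ?thesis by blast
qed

section \<open>The special pencil\<close>

text \<open>The product rule for the derivative at eps = 0.\<close>

lemma fps_nth_1_prod:
  fixes f :: "'i \<Rightarrow> 'a::comm_ring_1 fps"
  assumes "finite J"
  shows "(\<Prod>j\<in>J. f j) $ 1 = (\<Sum>j\<in>J. f j $ 1 * (\<Prod>i\<in>J-{j}. f i $ 0))"
  using assms
proof (induction J rule: finite_induct)
  case (insert k J)
  have e: "insert k J - {j} = insert k (J - {j})" if "j \<in> J" for j using that insert.hyps by auto
  have "(\<Sum>j\<in>J. f j $ 1 * (\<Prod>i\<in>insert k J-{j}. f i $ 0)) = f k $ 0 * (\<Sum>j\<in>J. f j $ 1 * (\<Prod>i\<in>J-{j}. f i $ 0))"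
    unfolding sum_distrib_left using insert.hyps e by (intro sum.cong) (auto simp: mult_ac)
  moreover have "insert k J - {k} = J" using insert.hyps by auto
  moreover have "(\<Prod>j\<in>J. f j) $ 0 = (\<Prod>j\<in>J. f j $ 0)"
    by (rule rhom_prod) (simp add: rhom_def)
  ultimately show ?case using insert by (simp add: fps_mult_nth)
qed simp

lemma fps_nth_1_power3:
  fixes a :: "'a::comm_ring_1 fps"
  shows "(a ^ 3) $ 1 = 3 * (a $ 0)\<^sup>2 * a $ 1" "(a ^ 3) $ 0 = (a $ 0) ^ 3"
  by (simp_all add: power3_eq_cube power2_eq_square fps_mult_nth algebra_simps)

lemma rhom_pcompose: "rhom (\<lambda>p :: complex poly. pcompose p r)"
  by (simp add: rhom_def pcompose_add pcompose_mult pcompose_1)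

section \<open>Variables, constants and supports of polynomials\<close>

definition pvar :: "'v \<Rightarrow> 'v monom \<Rightarrow>\<^sub>0 'c::comm_ring_1" where
  "pvar v = Poly_Mapping.single (Poly_Mapping.single v 1) 1"

definition pconst :: "'c \<Rightarrow> 'v monom \<Rightarrow>\<^sub>0 'c::comm_ring_1" where
  "pconst c = Poly_Mapping.single 0 c"

lemma evalp_pvar: "rhom h \<Longrightarrow> evalp h (pvar v) X = X v"
  by (simp add: pvar_def evalp_single rhom_1)

lemma evalp_pconst: "rhom h \<Longrightarrow> evalp h (pconst c) X = h c"
  by (simp add: pconst_def evalp_single)

lemma homogeneous_pvar: "homogeneous 1 (pvar v)"
  by (simp add: pvar_def homogeneous_single)

lemma homogeneous_pconst: "homogeneous 0 (pconst c)"
  by (simp add: pconst_def homogeneous_single)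

lemma homogeneous_uminus: "homogeneous d P \<Longrightarrow> homogeneous d (- P)"
  by (auto simp: homogeneous_def in_keys_iff)

lemma homogeneous_diff: "homogeneous d P \<Longrightarrow> homogeneous d Q \<Longrightarrow> homogeneous d (P - Q)"
  using homogeneous_add[of d P "- Q"] homogeneous_uminus[of d Q] by simp

definition vars_in :: "'v set \<Rightarrow> ('v monom \<Rightarrow>\<^sub>0 'c::comm_ring_1) \<Rightarrow> bool" where
  "vars_in V P \<longleftrightarrow> (\<forall>m\<in>Poly_Mapping.keys P. Poly_Mapping.keys m \<subseteq> V)"

lemma vars_in_one: "vars_in V 1"
  by (simp add: vars_in_def)

lemma vars_in_add: "vars_in V P \<Longrightarrow> vars_in V Q \<Longrightarrow> vars_in V (P + Q)"
  using keys_add[of P Q] by (auto simp: vars_in_def)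

lemma vars_in_uminus: "vars_in V P \<Longrightarrow> vars_in V (- P)"
  by (auto simp: vars_in_def in_keys_iff)

lemma vars_in_diff: "vars_in V P \<Longrightarrow> vars_in V Q \<Longrightarrow> vars_in V (P - Q)"
  using vars_in_add[of V P "- Q"] vars_in_uminus[of V Q] by simp

lemma vars_in_mult: assumes "vars_in V P" "vars_in V Q" shows "vars_in V (P * Q)"
  unfolding vars_in_def
proof
  fix m assume "m \<in> Poly_Mapping.keys (P * Q)"
  then obtain a b where "a \<in> Poly_Mapping.keys P" "b \<in> Poly_Mapping.keys Q" "m = a + b"
    using keys_mult[of P Q] by blast
  then show "Poly_Mapping.keys m \<subseteq> V" using assms keys_add[of a b] by (fastforce simp: vars_in_def)
qed

lemma vars_in_power: "vars_in V P \<Longrightarrow> vars_in V (P ^ k)"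
  by (induction k) (auto intro: vars_in_one vars_in_mult)

lemma vars_in_prod: "(\<And>i. i \<in> A \<Longrightarrow> vars_in V (f i)) \<Longrightarrow> vars_in V (\<Prod>i\<in>A. f i)"
  by (induction A rule: infinite_finite_induct) (auto intro: vars_in_one vars_in_mult)

lemma vars_in_pvar: "v \<in> V \<Longrightarrow> vars_in V (pvar v)"
  by (auto simp: vars_in_def pvar_def)

lemma vars_in_pconst: "vars_in V (pconst c)"
  by (auto simp: vars_in_def pconst_def)

text \<open>At a unit vector every monomial of degree d except the pure power of that variable
  vanishes.\<close>

lemma lookup_pure_power:
  fixes P :: "'v cpoly"
  assumes "homogeneous d P"
  shows "Poly_Mapping.lookup P (Poly_Mapping.single v d) = evalp (\<lambda>c. c) P (\<lambda>u. if u = v then 1 else 0)"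
proof -
  let ?X = "\<lambda>u. if u = v then 1 else (0::complex)" and ?m = "Poly_Mapping.single v d"
  have "mon m ?X = (if m = ?m then 1 else 0)" if "m \<in> Poly_Mapping.keys P" for m
  proof (cases "Poly_Mapping.keys m \<subseteq> {v}")
    case True
    have "m = Poly_Mapping.single v (Poly_Mapping.lookup m v)"
      using True by (intro poly_mapping_eqI) (auto simp: lookup_single when_def in_keys_iff)
    moreover then have "monom_degree m = Poly_Mapping.lookup m v" by (metis monom_degree_single)
    moreover have "monom_degree m = d" using assms that by (auto simp: homogeneous_def)
    ultimately show ?thesis by (metis (mono_tags, lifting) mon_single power_one)
  next
    case False
    then obtain u where u: "u \<in> Poly_Mapping.keys m" "u \<noteq> v" by auto
    then have "mon m ?X = 0" unfolding mon_def
      by (intro prod_zero bexI[of _ u]) (auto simp: in_keys_iff)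
    moreover have "m \<noteq> ?m" using False by (auto split: if_splits)
    ultimately show ?thesis by simp
  qed
  then have "evalp (\<lambda>c. c) P ?X = (\<Sum>m\<in>Poly_Mapping.keys P. if m = ?m then Poly_Mapping.lookup P m else 0)"
    unfolding evalp_def by (intro sum.cong) auto
  then show ?thesis by (simp add: in_keys_iff)
qed

text \<open>The coordinates x, y, z of the overview are those with index \<open>i0\<close>,
  \<open>i1\<close>, \<open>i2\<close>, and the w_j are those with index in J.\<close>

locale special_pencil =
  fixes i0 i1 i2 :: "'n::finite" and J :: "'n set" and c :: "'n \<Rightarrow> complex"
  assumes dist: "i0 \<noteq> i1" "i0 \<noteq> i2" "i1 \<noteq> i2" and J: "J = UNIV - {i0, i1, i2}"
begin

lemma in_J: "j \<in> J \<longleftrightarrow> j \<noteq> i0 \<and> j \<noteq> i1 \<and> j \<noteq> i2"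
  using J by auto

lemma finite_J: "finite J" by simp

lemma card_UNIV_J: "CARD('n) = card J + 3"
proof -
  have "(UNIV :: 'n set) = insert i0 (insert i1 (insert i2 J))" using J by auto
  then have "CARD('n) = card (insert i0 (insert i1 (insert i2 J)))" by simp
  also have "\<dots> = card J + 3" using dist by (simp add: in_J)
  finally show ?thesis .
qed

definition F1 :: "'n cpoly" where
  "F1 = (pvar i0 ^ 3 - pvar i2 ^ 3) * (\<Prod>j\<in>J. pvar i0 - pconst (c j) * pvar i1)"

definition F2 :: "'n cpoly" where
  "F2 = (pvar i1 ^ 3 - pvar i2 ^ 3) * (\<Prod>j\<in>J. pvar j)"

lemma evalp_F1: "rhom h \<Longrightarrow> evalp h F1 X = (X i0 ^ 3 - X i2 ^ 3) * (\<Prod>j\<in>J. X i0 - h (c j) * X i1)"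
  by (simp add: F1_def evalp_mult rhom_diff[OF rhom_evalp] rhom_power[OF rhom_evalp] rhom_prod[OF rhom_evalp]
      evalp_pvar evalp_pconst)

lemma evalp_F2: "rhom h \<Longrightarrow> evalp h F2 X = (X i1 ^ 3 - X i2 ^ 3) * (\<Prod>j\<in>J. X j)"
  by (simp add: F2_def evalp_mult rhom_diff[OF rhom_evalp] rhom_power[OF rhom_evalp] rhom_prod[OF rhom_evalp]
      evalp_pvar)

lemma homogeneous_F: "homogeneous CARD('n) F1" "homogeneous CARD('n) F2"
proof -
  have 3: "homogeneous 3 (pvar v ^ 3 :: 'n cpoly)" for v
    using homogeneous_power[OF homogeneous_pvar, of 3 v] by simp
  have l: "homogeneous 1 (pvar i0 - pconst (c j) * pvar i1)" for j
    using homogeneous_mult[OF homogeneous_pconst homogeneous_pvar] by (intro homogeneous_diff homogeneous_pvar) auto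
  have "homogeneous (3 + (\<Sum>j\<in>J. 1)) F1" "homogeneous (3 + (\<Sum>j\<in>J. 1)) F2"
    unfolding F1_def F2_def by (intro homogeneous_mult homogeneous_prod homogeneous_diff[of 3] 3 l homogeneous_pvar; simp)+
  then show "homogeneous CARD('n) F1" "homogeneous CARD('n) F2" by (simp_all add: card_UNIV_J add.commute)
qed

definition m1 :: "'n monom" where "m1 = Poly_Mapping.single i0 CARD('n)"
definition m2 :: "'n monom" where
  "m2 = Poly_Mapping.single i1 3 + (\<Sum>j\<in>J. Poly_Mapping.single j 1)"

lemma monom_degree_m: "monom_degree m1 = CARD('n)" "monom_degree m2 = CARD('n)"
proof -
  have "monom_degree (\<Sum>j\<in>A. Poly_Mapping.single j (1::nat)) = card A" if "finite A" for A :: "'n set"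
    using that by (induction A rule: finite_induct) (auto simp: monom_degree_add)
  then show "monom_degree m1 = CARD('n)" "monom_degree m2 = CARD('n)"
    by (simp_all add: m1_def m2_def monom_degree_add card_UNIV_J)
qed

lemma lookup_m2: "Poly_Mapping.lookup m2 i0 = 0" "j \<in> J \<Longrightarrow> Poly_Mapping.lookup m2 j = 1"
  using dist by (auto simp: m2_def lookup_add lookup_sum lookup_single when_def in_J sum.delta cong: if_cong)

lemma m1_neq_m2: "m1 \<noteq> m2"
proof -
  have "Poly_Mapping.lookup m1 i0 = CARD('n)" by (simp add: m1_def)
  then show ?thesis using lookup_m2(1) by (metis zero_less_card_finite less_irrefl)
qed

lemma lookup_F_m1: "Poly_Mapping.lookup F1 m1 = 1" "Poly_Mapping.lookup F2 m1 = 0"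
  unfolding m1_def lookup_pure_power[OF homogeneous_F(1)] lookup_pure_power[OF homogeneous_F(2)]
  using dist by (simp_all add: evalp_F1[OF rhom_id] evalp_F2[OF rhom_id])

text \<open>F1 involves only the three coordinates outside J, whereas m2 contains a variable from J;
  F2 is a difference of two distinct monomials.\<close>

lemma lookup_F_m2: assumes "J \<noteq> {}" shows "Poly_Mapping.lookup F1 m2 = 0" "Poly_Mapping.lookup F2 m2 = 1"
proof -
  have "vars_in {i0, i1, i2} F1"
    unfolding F1_def by (intro vars_in_mult vars_in_diff vars_in_power vars_in_prod vars_in_pvar vars_in_pconst) auto
  moreover obtain j where "j \<in> J" using assms by auto
  moreover then have "j \<in> Poly_Mapping.keys m2" "j \<notin> {i0, i1, i2}" using lookup_m2 by (auto simp: in_keys_iff in_J)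
  ultimately have "m2 \<notin> Poly_Mapping.keys F1" by (auto simp: vars_in_def)
  then show "Poly_Mapping.lookup F1 m2 = 0" by (simp add: in_keys_iff)
  define m3 where "m3 = Poly_Mapping.single i2 3 + (\<Sum>j\<in>J. Poly_Mapping.single j (1::nat))"
  have p: "(\<Prod>j\<in>A. pvar j) = Poly_Mapping.single (\<Sum>j\<in>A. Poly_Mapping.single j (1::nat)) (1::complex)" if "finite A" for A :: "'n set"
    using that by (induction A rule: finite_induct) (auto simp: pvar_def mult_single)
  have p3: "pvar v ^ 3 = Poly_Mapping.single (Poly_Mapping.single v (3::nat)) (1::complex)" for v :: 'n
    by (simp add: pvar_def power3_eq_cube mult_single single_add[symmetric] numeral_3_eq_3)
  have "F2 = Poly_Mapping.single m2 1 - Poly_Mapping.single m3 1"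
    unfolding F2_def p[OF finite_J] p3 by (simp add: left_diff_distrib mult_single m2_def m3_def)
  moreover have "Poly_Mapping.lookup m3 i1 \<noteq> Poly_Mapping.lookup m2 i1"
    using dist by (auto simp: m2_def m3_def lookup_add lookup_sum lookup_single when_def in_J sum.delta cong: if_cong)
  ultimately show "Poly_Mapping.lookup F2 m2 = 1" by (auto simp: lookup_minus lookup_single when_def)
qed

text \<open>With Z the product of the \<zeta> j, the pencil restricted to the plane has the cubic of
  parameter Z t over t. Hence the section of the cubics is composed with multiplication by
  Z.\<close>

definition base_sec :: "complex poly \<Rightarrow> complex poly \<Rightarrow> complex poly \<Rightarrow> ('n \<Rightarrow> complex) \<Rightarrow> 'n \<Rightarrow> complex poly" where
  "base_sec x y z \<zeta> v = (let r = [:0, \<Prod>j\<in>J. \<zeta> j:] in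
     if v = i0 then pcompose x r else if v = i1 then pcompose y r else if v = i2 then pcompose z r
     else smult (\<zeta> v) (pcompose (x - smult (c v) y) r))"

lemma base_sec_simps:
  "base_sec x y z \<zeta> i0 = pcompose x [:0, \<Prod>j\<in>J. \<zeta> j:]"
  "base_sec x y z \<zeta> i1 = pcompose y [:0, \<Prod>j\<in>J. \<zeta> j:]"
  "base_sec x y z \<zeta> i2 = pcompose z [:0, \<Prod>j\<in>J. \<zeta> j:]"
  "j \<in> J \<Longrightarrow> base_sec x y z \<zeta> j = smult (\<zeta> j) (pcompose (x - smult (c j) y) [:0, \<Prod>j\<in>J. \<zeta> j:])"
  using dist by (auto simp: base_sec_def in_J)

lemma degree_base_sec:
  assumes "degree x \<le> e" "degree y \<le> e" "degree z \<le> e"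
  shows "degree (base_sec x y z \<zeta> v) \<le> e"
proof -
  have "degree (pcompose p [:0, a:]) \<le> e" if "degree p \<le> e" for p and a :: complex
    using degree_pcompose_le[of p "[:0, a:]"] that by (cases "a = 0") auto
  moreover have "degree (x - smult (c v) y) \<le> e" using assms
    by (intro degree_diff_le) (auto intro: order_trans[OF degree_smult_le])
  ultimately show ?thesis using assms unfolding base_sec_def Let_def
    by (auto intro: order_trans[OF degree_smult_le])
qed

text \<open>Along the plane both terms acquire the product of the x - c_j y as a factor, and the
  remaining factors add up to the cubic equation.\<close>

lemma base_sec_solution:
  assumes sec: "smooth_section e x y z"
  shows "evalp (\<lambda>a. [:a:]) F1 (base_sec x y z \<zeta>) + T * evalp (\<lambda>a. [:a:]) F2 (base_sec x y z \<zeta>) = 0"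
proof -
  define Z where "Z = (\<Prod>j\<in>J. \<zeta> j)"
  define b where "b j = x - smult (c j) y" for j
  let ?k = "\<lambda>p. pcompose p [:0, Z:]"
  note k = rhom_pcompose[of "[:0, Z:]"]
  have rc: "rhom (\<lambda>a::complex. [:a:])" by (simp add: rhom_def one_pCons)
  have 1: "evalp (\<lambda>a. [:a:]) F1 (base_sec x y z \<zeta>) = ?k ((x^3 - z^3) * (\<Prod>j\<in>J. b j))"
    unfolding evalp_F1[OF rc] base_sec_simps
    by (simp add: rhom_mult[OF k] rhom_diff[OF k] rhom_power[OF k] rhom_prod[OF k] b_def Z_def[symmetric] pcompose_smult)
  have "(\<Prod>j\<in>J. base_sec x y z \<zeta> j) = (\<Prod>j\<in>J. smult (\<zeta> j) (?k (b j)))"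
    by (intro prod.cong) (auto simp: base_sec_simps b_def Z_def)
  also have "\<dots> = smult Z (?k (\<Prod>j\<in>J. b j))"
    by (simp add: prod_smult rhom_prod[OF k] Z_def[symmetric])
  finally have 2: "T * evalp (\<lambda>a. [:a:]) F2 (base_sec x y z \<zeta>) = ?k (T * (y^3 - z^3) * (\<Prod>j\<in>J. b j))"
    unfolding evalp_F2[OF rc] base_sec_simps
    by (simp add: rhom_mult[OF k] rhom_diff[OF k] rhom_power[OF k] Z_def[symmetric] pcompose_pCons)
  have "x^3 - z^3 + T * (y^3 - z^3) = 0"
  proof -
    have "x^3 - z^3 + t * (y^3 - z^3) = (x^3 + t * y^3) - (1 + t) * z^3" for t by (simp add: algebra_simps)
    moreover have "1 + T = T1" by (simp add: one_pCons)
    ultimately show ?thesis using sec_eq[OF sec] by (metis diff_self)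
  qed
  then have "(x^3 - z^3) * (\<Prod>j\<in>J. b j) + T * (y^3 - z^3) * (\<Prod>j\<in>J. b j) = 0"
    by (metis distrib_right mult_zero_left)
  then show ?thesis unfolding 1 2 by (metis rhom_add[OF k] rhom_0[OF k])
qed

end

definition fdeg :: "nat \<Rightarrow> complex poly fps \<Rightarrow> bool" where
  "fdeg d a \<longleftrightarrow> (\<forall>i. degree (a $ i) \<le> d)"

lemma fdeg_mult: "fdeg d a \<Longrightarrow> fdeg d' b \<Longrightarrow> fdeg (d + d') (a * b)"
  by (auto simp: fdeg_def fps_mult_nth intro!: degree_sum_le degree_mult_le_add)

lemma fdeg_sum: "(\<And>i. i \<in> A \<Longrightarrow> fdeg d (f i)) \<Longrightarrow> fdeg d (\<Sum>i\<in>A. f i)"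
  by (cases "finite A") (auto simp: fdeg_def fps_sum_nth intro!: degree_sum_le)

lemma fdeg_power: "fdeg d a \<Longrightarrow> fdeg (k * d) (a ^ k)"
proof (induction k)
  case 0
  then show ?case by (auto simp: fdeg_def)
next
  case (Suc k)
  then show ?case using fdeg_mult[of d a "k * d" "a ^ k"] by simp
qed

lemma fdeg_prod: "finite A \<Longrightarrow> (\<And>i. i \<in> A \<Longrightarrow> fdeg (d i) (f i)) \<Longrightarrow> fdeg (\<Sum>i\<in>A. d i) (\<Prod>i\<in>A. f i)"
proof (induction A rule: finite_induct)
  case empty
  then show ?case by (auto simp: fdeg_def)
next
  case (insert a A)
  then have "fdeg (d a + (\<Sum>i\<in>A. d i)) (f a * (\<Prod>i\<in>A. f i))" by (intro fdeg_mult) auto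
  then show ?case using insert by simp
qed

lemma fdeg_mon:
  assumes "\<And>v. fdeg e (X v)" shows "fdeg (monom_degree m * e) (mon m X)"
  unfolding mon_def monom_degree_def sum_distrib_right
  by (intro fdeg_prod fdeg_power assms) auto

lemma fps_const_emb: "rhom (\<lambda>a. fps_const [:a:])"
  by (simp add: rhom_def one_pCons)

context special_pencil
begin

text \<open>The first order term of the equation is computed with the product rule. Apart from
  multiples of the cubic equation it is exactly the expression of \<open>unobstructed\<close>, after
  the parameter has been rescaled by Z.\<close>

lemma base_sec_unobstructed:
  assumes sec: "smooth_section e x y z" and e: "e \<ge> 1" and cJ: "inj_on c J"
    and top: "\<And>j. j \<in> J \<Longrightarrow> coeff (x - smult (c j) y) e \<noteq> 0"
    and nc: "\<And>j s. j \<in> J \<Longrightarrow> \<not> (poly (x - smult (c j) y) s = 0 \<and> poly (T * (y^3 - z^3)) s = 0)"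
    and \<zeta>: "\<And>j. j \<in> J \<Longrightarrow> \<zeta> j \<noteq> 0"
    and P: "degree P \<le> CARD('n) * e + 1"
  shows "\<exists>Y. (\<forall>v. degree (Y v) \<le> e) \<and>
     (let A = \<lambda>v. fps_const (base_sec x y z \<zeta> v) + fps_X * fps_const (Y v) in
       (evalp (\<lambda>a. fps_const [:a:]) F1 A + fps_const T * evalp (\<lambda>a. fps_const [:a:]) F2 A) $ 1 = P)"
proof -
  define Z where "Z = (\<Prod>j\<in>J. \<zeta> j)"
  have Z0: "Z \<noteq> 0" using \<zeta> by (simp add: Z_def)
  define b where "b j = x - smult (c j) y" for j
  let ?k = "\<lambda>p. pcompose p [:0, Z:]"
  note k = rhom_pcompose[of "[:0, Z:]"]
  have "degree (pcompose P [:0, 1/Z:]) \<le> (card J + 3) * e + 1"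
    using degree_pcompose_le[of P "[:0, 1/Z:]"] P Z0 by (simp add: card_UNIV_J)
  from unobstructed[OF sec e finite_J cJ top nc this]
  obtain u v w q where d: "degree u \<le> e" "degree v \<le> e" "degree w \<le> e" "\<forall>j. degree (q j) \<le> e"
    and eq: "pcompose P [:0, 1/Z:] = (\<Prod>j\<in>J. b j) * (x^2 * u + T * y^2 * v - T1 * z^2 * w) +
       (\<Sum>j\<in>J. (\<Prod>i\<in>J-{j}. b i) * (T * (y^3 - z^3)) * q j)" unfolding b_def by blast
  \<comment> \<open>The factor 1/3 compensates the 3 from differentiating cubes.\<close>
  define u' v' w' where "u' = smult (1/3) u" and "v' = smult (1/3) v" and "w' = smult (1/3) w"
  \<comment> \<open>The variation of x - c_j y. Taking it for w_j, up to \<zeta> j, keeps the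
    section in its plane; q j is added to leave the plane.\<close>
  define l where "l j = u' - smult (c j) v'" for j
  define Y where "Y i = (if i = i0 then ?k u' else if i = i1 then ?k v' else if i = i2 then ?k w'
      else smult (\<zeta> i) (?k (l i + q i)))" for i
  define A where "A = (\<lambda>v. fps_const (base_sec x y z \<zeta> v) + fps_X * fps_const (Y v))"
  have Y: "Y i0 = ?k u'" "Y i1 = ?k v'" "Y i2 = ?k w'" "\<And>j. j \<in> J \<Longrightarrow> Y j = smult (\<zeta> j) (?k (l j + q j))"
    using dist by (auto simp: Y_def in_J)
  have kd: "degree (?k p) \<le> e" if "degree p \<le> e" for p
    using degree_pcompose_le[of p "[:0, Z:]"] that by (cases "Z = 0") auto
  have d': "degree u' \<le> e" "degree v' \<le> e" "degree w' \<le> e" using d by (auto simp: u'_def v'_def w'_def)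
  then have "degree (l j + q j) \<le> e" for j unfolding l_def using d
    by (intro degree_add_le degree_diff_le) (auto intro: order_trans[OF degree_smult_le])
  then have dY: "degree (Y i) \<le> e" for i unfolding Y_def
    using d' by (auto intro!: kd order_trans[OF degree_smult_le])
  have A0: "A i0 $ 0 = ?k x" "A i1 $ 0 = ?k y" "A i2 $ 0 = ?k z" "\<And>j. j \<in> J \<Longrightarrow> A j $ 0 = smult (\<zeta> j) (?k (b j))"
    by (auto simp: A_def base_sec_simps Z_def[symmetric] b_def)
  have A1: "A i $ 1 = Y i" for i
    by (simp add: A_def)
  have f0: "rhom (\<lambda>a :: complex poly fps. a $ 0)" by (simp add: rhom_def)
  define S1 S2 where "S1 = (\<Sum>j\<in>J. l j * (\<Prod>i\<in>J-{j}. b i))" and "S2 = (\<Sum>j\<in>J. q j * (\<Prod>i\<in>J-{j}. b i))"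
  define B where "B = (\<Prod>j\<in>J. b j)"
  have L0: "(A i0 - fps_const [:c j:] * A i1) $ 0 = ?k (b j)" for j
    using A0 by (simp add: b_def pcompose_diff pcompose_smult)
  have L1: "(A i0 - fps_const [:c j:] * A i1) $ 1 = ?k (l j)" for j
    unfolding fps_sub_nth fps_mult_left_const_nth A1 by (simp add: Y l_def pcompose_diff pcompose_smult)
  have prodL0: "(\<Prod>j\<in>J. A i0 - fps_const [:c j:] * A i1) $ 0 = ?k B"
    by (simp add: rhom_prod[OF f0] L0 B_def rhom_prod[OF k] del: fps_sub_nth)
  have prodL1: "(\<Prod>j\<in>J. A i0 - fps_const [:c j:] * A i1) $ 1 = ?k S1"
    unfolding fps_nth_1_prod[OF finite_J] L0 L1 S1_def
    by (simp add: rhom_sum[OF k] rhom_mult[OF k] rhom_prod[OF k])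
  have prodA0: "(\<Prod>j\<in>J. A j) $ 0 = smult Z (?k B)"
  proof -
    have "(\<Prod>j\<in>J. A j) $ 0 = (\<Prod>j\<in>J. smult (\<zeta> j) (?k (b j)))"
      unfolding rhom_prod[OF f0] using A0 by (intro prod.cong) auto
    then show ?thesis by (simp add: prod_smult Z_def[symmetric] B_def rhom_prod[OF k])
  qed
  have prodA1: "(\<Prod>j\<in>J. A j) $ 1 = smult Z (?k (S1 + S2))"
  proof -
    have "Y j * (\<Prod>i\<in>J-{j}. A i $ 0) = smult Z (?k ((l j + q j) * (\<Prod>i\<in>J-{j}. b i)))" if j: "j \<in> J" for j
    proof -
      have "(\<Prod>i\<in>J-{j}. A i $ 0) = (\<Prod>i\<in>J-{j}. smult (\<zeta> i) (?k (b i)))"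
        using A0 by (intro prod.cong) auto
      also have "\<dots> = smult (\<Prod>i\<in>J-{j}. \<zeta> i) (?k (\<Prod>i\<in>J-{j}. b i))"
        by (simp add: prod_smult rhom_prod[OF k])
      moreover have "\<zeta> j * (\<Prod>i\<in>J-{j}. \<zeta> i) = Z" unfolding Z_def using j by (simp add: prod.remove)
      ultimately show ?thesis using Y(4)[OF j] by (simp add: rhom_mult[OF k] mult_ac)
    qed
    then have "(\<Prod>j\<in>J. A j) $ 1 = (\<Sum>j\<in>J. smult Z (?k ((l j + q j) * (\<Prod>i\<in>J-{j}. b i))))"
      unfolding fps_nth_1_prod[OF finite_J] A1 by (intro sum.cong) auto
    also have "\<dots> = smult Z (?k (\<Sum>j\<in>J. (l j + q j) * (\<Prod>i\<in>J-{j}. b i)))"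
      unfolding rhom_sum[OF k] by (rule poly_eqI) (simp add: coeff_sum sum_distrib_left)
    finally show ?thesis by (simp add: S1_def S2_def distrib_right sum.distrib)
  qed
  define E where "E = 3 * x^2 * u' * B - 3 * z^2 * w' * B + (x^3 - z^3) * S1
      + T * ((3 * y^2 * v' - 3 * z^2 * w') * B + (y^3 - z^3) * (S1 + S2))"
  have "(evalp (\<lambda>a. fps_const [:a:]) F1 A + fps_const T * evalp (\<lambda>a. fps_const [:a:]) F2 A) $ 1 =
     (3 * (?k x)^2 * ?k u' - 3 * (?k z)^2 * ?k w') * ?k B + (?k x^3 - ?k z^3) * ?k S1
      + T * ((3 * (?k y)^2 * ?k v' - 3 * (?k z)^2 * ?k w') * smult Z (?k B) + (?k y^3 - ?k z^3) * smult Z (?k (S1 + S2)))"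
  proof -
    have calc: "((a^3 - b^3) * p + fps_const t * ((a'^3 - b^3) * p')) $ 1 =
        (3 * (a$0)^2 * a$1 - 3 * (b$0)^2 * b$1) * p$0 + ((a$0)^3 - (b$0)^3) * p$1
        + t * ((3 * (a'$0)^2 * a'$1 - 3 * (b$0)^2 * b$1) * p'$0 + ((a'$0)^3 - (b$0)^3) * p'$1)"
      for a b a' p p' :: "complex poly fps" and t
    proof -
      have m: "(f * g) $ 1 = f $ 1 * g $ 0 + f $ 0 * g $ 1" "(f * g) $ 0 = f $ 0 * g $ 0" for f g :: "complex poly fps"
        by (simp_all add: fps_mult_nth)
      show ?thesis by (simp only: fps_add_nth fps_mult_left_const_nth m fps_sub_nth fps_nth_1_power3) simp
    qed
    show ?thesis unfolding evalp_F1[OF fps_const_emb] evalp_F2[OF fps_const_emb] calc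
      unfolding prodL0 prodL1 prodA0 prodA1 A0 A1 Y ..
  qed
  also have "\<dots> = ?k E"
  proof -
    define t Zc where "t = T" and "Zc = [:Z:]"
    have kT: "?k t = Zc * t" by (simp add: pcompose_pCons t_def Zc_def)
    have sm: "smult Z p = Zc * p" for p by (simp add: Zc_def)
    have k3: "?k 3 = 3" by (metis numeral_poly pcompose_const)
    show ?thesis unfolding E_def t_def[symmetric] sm
      by (simp only: rhom_add[OF k] rhom_diff[OF k] rhom_mult[OF k] rhom_power[OF k] kT k3)
         (simp add: algebra_simps)
  qed
  also have "E = pcompose P [:0, 1/Z:]"
  proof -
    define t where "t = T"
    have T1: "T1 = 1 + t" by (simp add: one_pCons t_def)
    have sq: "x^3 + t * y^3 = (1 + t) * z^3" using sec_eq[OF sec] T1 t_def by simp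
    have u3: "3 * u' = u" "3 * v' = v" "3 * w' = w"
      unfolding u'_def v'_def w'_def by (simp_all add: numeral_poly)
    have "pcompose P [:0, 1/Z:] = B * (x^2 * (3 * u') + t * y^2 * (3 * v') - (1 + t) * z^2 * (3 * w')) + t * (y^3 - z^3) * S2"
      unfolding eq B_def S2_def u3 T1 t_def[symmetric] by (simp add: sum_distrib_left mult_ac)
    \<comment> \<open>The in-plane variation of the common linear factors contributes S1 times the
      cubic equation, that is, nothing.\<close>
    moreover have "E = B * (x^2 * (3 * u') + t * y^2 * (3 * v') - (1 + t) * z^2 * (3 * w')) + t * (y^3 - z^3) * S2
       + (x^3 + t * y^3 - (1 + t) * z^3) * S1"
      unfolding E_def t_def[symmetric] by (simp add: algebra_simps)
    ultimately show ?thesis using sq by simp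
  qed
  also have "?k (pcompose P [:0, 1/Z:]) = P"
    using Z0 by (simp add: pcompose_assoc[symmetric] pcompose_pCons)
  finally show ?thesis using dY unfolding A_def Let_def by blast
qed

lemma lifted_section:
  fixes g1 g2 :: "'n monom \<Rightarrow> complex"
  assumes sec: "smooth_section e x y z" and e: "e \<ge> 1" and cJ: "inj_on c J"
    and top: "\<And>j. j \<in> J \<Longrightarrow> coeff (x - smult (c j) y) e \<noteq> 0"
    and nc: "\<And>j s. j \<in> J \<Longrightarrow> \<not> (poly (x - smult (c j) y) s = 0 \<and> poly (T * (y^3 - z^3)) s = 0)"
    and \<zeta>: "\<And>j. j \<in> J \<Longrightarrow> \<zeta> j \<noteq> 0"
  shows "\<exists>X. (\<Sum>m | monom_degree m = CARD('n). (fps_const [:Poly_Mapping.lookup F1 m, Poly_Mapping.lookup F2 m:] +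
       fps_X * fps_const [:g1 m, g2 m:]) * mon m X) = 0 \<and>
     (\<forall>v. X v $ 0 = base_sec x y z \<zeta> v) \<and> (\<forall>v i. degree (X v $ i) \<le> e)"
\<comment> \<open>Forms of degree \<open>CARD('n)\<close> in polynomials of degree e, with
  coefficients linear in t, have degree at most \<open>CARD('n) * e + 1\<close>, the range covered
  by the surjectivity above.\<close>
proof (rule hensel_bounded_degree[where N = "CARD('n) * e + 1"])
  let ?S = "{m :: 'n monom. monom_degree m = CARD('n)}"
  have ev: "(\<Sum>m\<in>?S. h [:Poly_Mapping.lookup F1 m, Poly_Mapping.lookup F2 m:] * mon m Y)
     = evalp (\<lambda>a. h [:a:]) F1 Y + h T * evalp (\<lambda>a. h [:a:]) F2 Y"
    if h: "rhom h" for Y :: "'n \<Rightarrow> 'b::comm_ring_1" and h :: "complex poly \<Rightarrow> 'b"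
  proof -
    have "rhom (\<lambda>a::complex. [:a:])" by (simp add: rhom_def one_pCons)
    from rhom_comp[OF h this] have rc: "rhom (\<lambda>a. h [:a:])" .
    have "(\<Sum>m\<in>?S. h [:Poly_Mapping.lookup F1 m, Poly_Mapping.lookup F2 m:] * mon m Y)
       = (\<Sum>m\<in>?S. h [:Poly_Mapping.lookup F1 m:] * mon m Y) + h T * (\<Sum>m\<in>?S. h [:Poly_Mapping.lookup F2 m:] * mon m Y)"
    proof -
      have "h [:Poly_Mapping.lookup F1 m, Poly_Mapping.lookup F2 m:] = h [:Poly_Mapping.lookup F1 m:] + h T * h [:Poly_Mapping.lookup F2 m:]" for m
        unfolding rhom_mult[OF h, symmetric] rhom_add[OF h, symmetric] by simp
      then show ?thesis by (simp add: distrib_right sum.distrib sum_distrib_left mult.assoc)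
    qed
    also have "\<dots> = evalp (\<lambda>a. h [:a:]) F1 Y + h T * evalp (\<lambda>a. h [:a:]) F2 Y"
      using homogeneous_F by (subst (1 2) evalp_superset[OF rc, where S = ?S]) (auto simp: homogeneous_def finite_monom_degree)
    finally show ?thesis .
  qed
  show "(\<Sum>m\<in>?S. [:Poly_Mapping.lookup F1 m, Poly_Mapping.lookup F2 m:] * mon m (base_sec x y z \<zeta>)) = 0"
    using ev[OF rhom_id] base_sec_solution[OF sec] by simp
  show "degree (base_sec x y z \<zeta> v) \<le> e" for v by (intro degree_base_sec sec_degree[OF sec])
  show "degree ((\<Sum>m\<in>?S. (fps_const [:Poly_Mapping.lookup F1 m, Poly_Mapping.lookup F2 m:] +
       fps_X * fps_const [:g1 m, g2 m:]) * mon m X) $ k) \<le> CARD('n) * e + 1"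
    if X: "\<And>v i. degree (X v $ i) \<le> e" for X k
  proof -
    have "fdeg (1 + CARD('n) * e) (\<Sum>m\<in>?S. (fps_const [:Poly_Mapping.lookup F1 m, Poly_Mapping.lookup F2 m:] +
       fps_X * fps_const [:g1 m, g2 m:]) * mon m X)"
    proof (rule fdeg_sum)
      fix m assume m: "m \<in> ?S"
      have "fdeg (monom_degree m * e) (mon m X)" using X by (intro fdeg_mon) (simp add: fdeg_def)
      moreover have "fdeg 1 (fps_const [:Poly_Mapping.lookup F1 m, Poly_Mapping.lookup F2 m:] +
       fps_X * fps_const [:g1 m, g2 m:])"
        by (auto simp: fdeg_def fps_X_mult_nth intro!: degree_add_le)
      ultimately show "fdeg (1 + CARD('n) * e) ((fps_const [:Poly_Mapping.lookup F1 m, Poly_Mapping.lookup F2 m:] +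
       fps_X * fps_const [:g1 m, g2 m:]) * mon m X)" using m fdeg_mult by fastforce
    qed
    then show ?thesis by (simp add: fdeg_def)
  qed
  fix P :: "complex poly" assume "degree P \<le> CARD('n) * e + 1"
  from base_sec_unobstructed[where \<zeta> = \<zeta>, OF sec e cJ top nc \<zeta> this]
  obtain Y where Y: "\<forall>v. degree (Y v) \<le> e"
    "(evalp (\<lambda>a. fps_const [:a:]) F1 (\<lambda>v. fps_const (base_sec x y z \<zeta> v) + fps_X * fps_const (Y v)) +
      fps_const T * evalp (\<lambda>a. fps_const [:a:]) F2 (\<lambda>v. fps_const (base_sec x y z \<zeta> v) + fps_X * fps_const (Y v))) $ 1 = P"
    unfolding Let_def by blast
  have rf: "rhom (fps_const :: complex poly \<Rightarrow> _)" by (simp add: rhom_def)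
  show "\<exists>y'. (\<forall>v. degree (y' v) \<le> e) \<and>
    (\<Sum>m\<in>?S. fps_const [:Poly_Mapping.lookup F1 m, Poly_Mapping.lookup F2 m:] *
        mon m (\<lambda>v. fps_const (base_sec x y z \<zeta> v) + fps_X * fps_const (y' v))) $ 1 = P"
    unfolding ev[OF rf] using Y by blast
qed

end

section \<open>Bihomogeneous forms and deformation\<close>

definition slice :: "nat \<Rightarrow> complex fps poly \<Rightarrow> complex poly" where
  "slice k P = map_poly (\<lambda>a. a $ k) P"

lemma coeff_slice [simp]: "coeff (slice k P) i = coeff P i $ k"
  by (simp add: slice_def coeff_map_poly)

text \<open>Embeds C[[eps]][t] into C[t][[eps]]; the image consists of the series whose coefficients
  have bounded degree. Lifting works in the second ring, linear algebra over the Laurent series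
  needs the first.\<close>

definition rho :: "complex fps poly \<Rightarrow> complex poly fps" where
  "rho P = Abs_fps (\<lambda>k. slice k P)"

lemma rho_nth [simp]: "rho P $ k = slice k P"
  by (simp add: rho_def)

lemma rhom_rho: "rhom rho"
  unfolding rhom_def
proof (intro conjI allI)
  show "rho 1 = 1"
    by (rule fps_ext, rule poly_eqI) (auto simp: one_pCons coeff_pCons split: nat.splits)
  show "rho (x + y) = rho x + rho y" for x y
    by (rule fps_ext, rule poly_eqI) auto
  show "rho (x * y) = rho x * rho y" for x y
  proof (rule fps_ext, rule poly_eqI)
    fix k n
    have "coeff (rho (x * y) $ k) n = (\<Sum>i\<le>n. \<Sum>j=0..k. coeff x i $ j * coeff y (n - i) $ (k - j))"
      by (simp add: coeff_mult fps_sum_nth fps_mult_nth)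
    also have "\<dots> = (\<Sum>j=0..k. \<Sum>i\<le>n. coeff x i $ j * coeff y (n - i) $ (k - j))"
      by (rule sum.swap)
    also have "\<dots> = coeff ((rho x * rho y) $ k) n"
      by (simp add: fps_mult_nth coeff_sum coeff_mult)
    finally show "coeff (rho (x * y) $ k) n = coeff ((rho x * rho y) $ k) n" .
  qed
qed

lemma rho_eq_0: "rho P = 0 \<Longrightarrow> P = 0"
  by (rule poly_eqI, rule fps_ext) (metis coeff_0 coeff_slice fps_zero_nth rho_nth)

lemma rho_surj:
  assumes "\<And>i. degree (X $ i) \<le> e"
  shows "\<exists>P. degree P \<le> e \<and> rho P = X"
proof -
  define P where "P = (\<Sum>j\<le>e. monom (Abs_fps (\<lambda>k. coeff (X $ k) j)) j)"
  have "degree P \<le> e" unfolding P_def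
    by (intro degree_sum_le) (auto intro: order_trans[OF degree_monom_le])
  moreover have "coeff P j = Abs_fps (\<lambda>k. coeff (X $ k) j)" for j
  proof (cases "j \<le> e")
    case False
    then have "coeff (X $ k) j = 0" for k using assms[of k] by (intro coeff_eq_0) auto
    moreover have "coeff P j = 0" using False \<open>degree P \<le> e\<close> by (intro coeff_eq_0) auto
    ultimately show ?thesis by (simp add: fps_eq_iff)
  qed (simp add: P_def coeff_sum)
  then have "rho P = X" by (intro fps_ext poly_eqI) simp
  ultimately show ?thesis by blast
qed

lemma rhom_slice0: "rhom (slice 0)"
proof -
  have "slice 0 x = rho x $ 0" for x by simp
  moreover have "rhom (\<lambda>x. rho x $ 0)" by (rule rhom_comp[OF _ rhom_rho]) (simp add: rhom_def)
  ultimately show ?thesis by (simp add: rhom_def)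
qed

text \<open>Bihomogeneous forms of bidegree (d, k), dehomogenised with respect to the coordinates of
  the projective line, have coefficients indexed by bimons d k.\<close>

definition mons :: "nat \<Rightarrow> 'v monom set" where "mons d = {m. monom_degree m = d}"

lemma finite_mons [simp]: "finite (mons d :: 'v::finite monom set)"
  unfolding mons_def by (rule finite_monom_degree)

definition bimons :: "nat \<Rightarrow> nat \<Rightarrow> ('v monom \<times> nat) set" where "bimons d k = mons d \<times> {..k}"

definition bmon :: "'v monom \<times> nat \<Rightarrow> ('v \<Rightarrow> 'a::comm_ring_1) \<Rightarrow> 'a \<Rightarrow> 'a" where
  "bmon b X t = mon (fst b) X * t ^ snd b"

definition beval :: "('v monom \<times> nat) set \<Rightarrow> ('c::comm_ring_1 \<Rightarrow> 'a::comm_ring_1) \<Rightarrow> ('v monom \<times> nat \<Rightarrow> 'c) \<Rightarrow> ('v \<Rightarrow> 'a) \<Rightarrow> 'a \<Rightarrow> 'a" where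
  "beval S h f X t = (\<Sum>b\<in>S. h (f b) * bmon b X t)"

text \<open>The index set of the cofactors of a pencil of degree N in forms of bidegree (d, k).\<close>

definition cobimons :: "nat \<Rightarrow> nat \<Rightarrow> nat \<Rightarrow> ('v monom \<times> nat) set" where
  "cobimons N d k = (if N \<le> d then mons (d - N) \<times> {..<k} else {})"

text \<open>Multiplication by the pencil on coefficient vectors. The cofactor has bidegree (d - N, k
  - 1), so there is none if d < N or k = 0. The double sum makes linearity in f and compatibility
  with homomorphisms immediate.\<close>

definition pmul :: "nat \<Rightarrow> nat \<Rightarrow> nat \<Rightarrow> ('v monom \<times> nat \<Rightarrow> 'c::comm_ring_1) \<Rightarrow> ('v monom \<times> nat \<Rightarrow> 'c) \<Rightarrow> 'v monom \<times> nat \<Rightarrow> 'c" where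
  "pmul N d k p f b = (\<Sum>a\<in>bimons N 1. \<Sum>c\<in>cobimons N d k. if (fst a + fst c, snd a + snd c) = b then p a * f c else 0)"

lemma finite_bimons [simp]: "finite (bimons d k :: ('v::finite monom \<times> nat) set)"
  by (simp add: bimons_def)

lemma finite_cobimons [simp]: "finite (cobimons N d k :: ('v::finite monom \<times> nat) set)"
  by (simp add: cobimons_def)

lemma bimons_add: "a \<in> bimons N 1 \<Longrightarrow> c \<in> cobimons N d k \<Longrightarrow> (fst a + fst c, snd a + snd c) \<in> bimons d k"
  by (auto simp: bimons_def cobimons_def mons_def monom_degree_add split: if_splits)

lemma bmon_add: "bmon (fst a + fst c, snd a + snd c) X t = bmon a X t * bmon c X t"
  by (simp add: bmon_def mon_add power_add mult_ac)

lemma beval_pmul: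
  fixes p :: "'v::finite monom \<times> nat \<Rightarrow> 'c::comm_ring_1"
  assumes h: "rhom h"
  shows "beval (bimons d k) h (pmul N d k p f) X t = beval (bimons N 1) h p X t * beval (cobimons N d k) h f X t"
proof -
  have "beval (bimons d k) h (pmul N d k p f) X t =
    (\<Sum>b\<in>bimons d k. \<Sum>a\<in>bimons N 1. \<Sum>c\<in>cobimons N d k.
       if (fst a + fst c, snd a + snd c) = b then h (p a) * h (f c) * (bmon a X t * bmon c X t) else 0)"
    unfolding beval_def pmul_def rhom_sum[OF h] sum_distrib_right
    by (intro sum.cong refl) (auto simp: rhom_mult[OF h] rhom_0[OF h] bmon_add[symmetric])
  also have "\<dots> = (\<Sum>a\<in>bimons N 1. \<Sum>c\<in>cobimons N d k. \<Sum>b\<in>bimons d k.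
       if (fst a + fst c, snd a + snd c) = b then h (p a) * h (f c) * (bmon a X t * bmon c X t) else 0)"
    by (subst sum.swap) (intro sum.cong refl sum.swap)
  also have "\<dots> = (\<Sum>a\<in>bimons N 1. \<Sum>c\<in>cobimons N d k. h (p a) * h (f c) * (bmon a X t * bmon c X t))"
    by (intro sum.cong refl) (simp add: bimons_add)
  also have "\<dots> = beval (bimons N 1) h p X t * beval (cobimons N d k) h f X t"
    unfolding beval_def sum_product by (intro sum.cong refl) (simp add: mult_ac)
  finally show ?thesis .
qed

lemma rhom_bmon: "rhom h \<Longrightarrow> h (bmon b X t) = bmon b (\<lambda>v. h (X v)) (h t)"
  by (simp add: bmon_def rhom_mult rhom_mon rhom_power)

lemma beval_rhom:
  assumes "rhom g" shows "g (beval S h f X t) = beval S (\<lambda>c. g (h c)) f (\<lambda>v. g (X v)) (g t)"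
  using assms by (simp add: beval_def rhom_sum rhom_mult rhom_bmon)

lemma rhom_pmul: "rhom h \<Longrightarrow> h (pmul N d k p f b) = pmul N d k (\<lambda>a. h (p a)) (\<lambda>c. h (f c)) b"
  unfolding pmul_def rhom_sum by (intro sum.cong refl) (auto simp: rhom_mult rhom_0)

lemma pmul_add_shift:
  "pmul N d k p (\<lambda>c. f c + r * g c) b = pmul N d k p f b + r * pmul N d k p g b"
  unfolding pmul_def sum_distrib_left sum.distrib[symmetric]
  by (intro sum.cong refl) (auto simp: algebra_simps)

lemma rhom_pC: "rhom (\<lambda>a::'a::comm_ring_1. [:a:])"
  by (simp add: rhom_def one_pCons)

lemma fps_X_factor:
  fixes a :: "'a::comm_ring_1 fps"
  shows "a $ 0 = 0 \<Longrightarrow> \<exists>b. a = fps_X * b"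
  by (intro exI[of _ "Abs_fps (\<lambda>n. a $ Suc n)"]) (auto simp: fps_eq_iff fps_X_mult_nth)

text \<open>If forms vanishing on the reductions of the sections are multiples of the reduction of the
  pencil, then the same holds over power series: subtract multiples of the pencil and divide by
  eps repeatedly.\<close>

lemma multiple_of_pencil_fps:
  fixes p0 g :: "'v::finite monom \<times> nat \<Rightarrow> complex"
  defines "p \<equiv> \<lambda>a. fps_const (p0 a) + fps_X * fps_const (g a)"
  assumes sec: "\<And>X. X \<in> \<Xi> \<Longrightarrow> beval (bimons N 1) (\<lambda>a. [:a:]) p X [:0, 1:] = 0"
    and red: "\<And>f0. (\<And>X. X \<in> \<Xi> \<Longrightarrow> beval (bimons d k) (\<lambda>a. [:a:]) f0 (\<lambda>v. slice 0 (X v)) [:0, 1:] = 0)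
       \<Longrightarrow> \<exists>q0. \<forall>b\<in>bimons d k. f0 b = pmul N d k p0 q0 b"
    and van: "\<And>X. X \<in> \<Xi> \<Longrightarrow> beval (bimons d k) (\<lambda>a. [:a:]) f X [:0, 1:] = 0"
  shows "\<exists>q. \<forall>b\<in>bimons d k. f b = pmul N d k p q b"
proof -
  let ?S = "bimons d k :: ('v monom \<times> nat) set"
  define good where "good f \<longleftrightarrow> (\<forall>X\<in>\<Xi>. beval ?S (\<lambda>a. [:a:]) f X [:0, 1:] = 0)" for f :: "'v monom \<times> nat \<Rightarrow> complex fps"
  have f0: "rhom (\<lambda>a::complex fps. a $ 0)" by (simp add: rhom_def)
  have s0T: "slice 0 [:0, 1:] = [:0, 1:]" "slice 0 [:a:] = [:a $ 0:]" for a
    by (rule poly_eqI, auto simp: coeff_pCons split: nat.splits)+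
  \<comment> \<open>The constant term of f is a multiple of p0. Subtracting the same multiple of p
    leaves something divisible by eps; the quotient vanishes on the sections again because they lie
    on p and eps is not a zero divisor.\<close>
  have step: "\<exists>f' q0. good f' \<and> (\<forall>b\<in>?S. f b = pmul N d k p (\<lambda>c. fps_const (q0 c)) b + fps_X * f' b)" if f: "good f" for f
  proof -
    have "beval ?S (\<lambda>a. [:a:]) (\<lambda>b. f b $ 0) (\<lambda>v. slice 0 (X v)) [:0, 1:] = 0" if X: "X \<in> \<Xi>" for X
    proof -
      have "slice 0 (beval ?S (\<lambda>a. [:a:]) f X [:0, 1:]) = 0"
        using f X by (simp add: good_def rhom_0[OF rhom_slice0])
      then show ?thesis unfolding beval_rhom[OF rhom_slice0] s0T by (simp add: beval_def)
    qed
    from red[OF this] obtain q0 where q0: "\<forall>b\<in>?S. f b $ 0 = pmul N d k p0 q0 b" by blast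
    let ?q = "\<lambda>c. fps_const (q0 c)"
    have "(f b - pmul N d k p ?q b) $ 0 = 0" if "b \<in> ?S" for b
      using q0 that rhom_pmul[OF f0, of N d k p ?q b] by (simp add: p_def)
    then have "\<forall>b\<in>?S. \<exists>u. f b - pmul N d k p ?q b = fps_X * u"
      using fps_X_factor by blast
    then obtain f' where "\<forall>b\<in>?S. f b - pmul N d k p ?q b = fps_X * f' b"
      using bchoice[of ?S "\<lambda>b u. f b - pmul N d k p ?q b = fps_X * u"] by blast
    then have f': "\<And>b. b \<in> ?S \<Longrightarrow> f b = pmul N d k p ?q b + fps_X * f' b"
      by (simp add: algebra_simps)
    have "beval ?S (\<lambda>a. [:a:]) f' X [:0, 1:] = 0" if X: "X \<in> \<Xi>" for X
    proof -
      have "beval ?S (\<lambda>a. [:a:]) f X [:0, 1:] = beval ?S (\<lambda>a. [:a:]) (pmul N d k p ?q) X [:0, 1:]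
         + [:fps_X:] * beval ?S (\<lambda>a. [:a:]) f' X [:0, 1:]"
        unfolding beval_def sum_distrib_left sum.distrib[symmetric]
      proof (intro sum.cong refl)
        fix b assume "b \<in> ?S"
        show "[:f b:] * bmon b X [:0, 1:] = [:pmul N d k p ?q b:] * bmon b X [:0, 1:] + [:fps_X:] * ([:f' b:] * bmon b X [:0, 1:])"
          unfolding f'[OF \<open>b \<in> ?S\<close>] rhom_add[OF rhom_pC] rhom_mult[OF rhom_pC] by (simp only: distrib_right mult.assoc)
      qed
      moreover have "beval ?S (\<lambda>a. [:a:]) (pmul N d k p ?q) X [:0, 1:] = 0"
        unfolding beval_pmul[OF rhom_pC] using sec[OF X] by simp
      moreover have "beval ?S (\<lambda>a. [:a:]) f X [:0, 1:] = 0" using f X by (simp add: good_def)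
      ultimately have "[:fps_X:] * beval ?S (\<lambda>a. [:a:]) f' X [:0, 1:] = 0" by (metis add_0)
      then show ?thesis by (simp only: mult_eq_0_iff) simp
    qed
    then have "good f'" by (simp add: good_def)
    then show ?thesis using f' by blast
  qed
  have "\<exists>\<Phi>. \<forall>n. (good (\<Phi> n) \<and> (n = 0 \<longrightarrow> \<Phi> n = f)) \<and>
     (\<exists>q0. \<forall>b\<in>?S. \<Phi> n b = pmul N d k p (\<lambda>c. fps_const (q0 c)) b + fps_X * \<Phi> (Suc n) b)"
  proof (rule dependent_nat_choice)
    show "\<exists>x. good x \<and> (0 = (0::nat) \<longrightarrow> x = f)" using van by (auto simp: good_def)
    fix x and n :: nat assume "good x \<and> (n = 0 \<longrightarrow> x = f)"
    then show "\<exists>y. (good y \<and> (Suc n = 0 \<longrightarrow> y = f)) \<and>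
        (\<exists>q0. \<forall>b\<in>?S. x b = pmul N d k p (\<lambda>c. fps_const (q0 c)) b + fps_X * y b)"
      using step[of x] by blast
  qed
  then obtain \<Phi> where \<Phi>: "\<Phi> 0 = f"
     "\<And>n. \<exists>q0. \<forall>b\<in>?S. \<Phi> n b = pmul N d k p (\<lambda>c. fps_const (q0 c)) b + fps_X * \<Phi> (Suc n) b" by blast
  then obtain Q where Q: "\<And>n b. b \<in> ?S \<Longrightarrow> \<Phi> n b = pmul N d k p (\<lambda>c. fps_const (Q n c)) b + fps_X * \<Phi> (Suc n) b"
    by metis
  \<comment> \<open>Cofactor after n divisions; it determines f up to a multiple of eps^n.\<close>
  define R where "R n c = (\<Sum>i<n. fps_X ^ i * fps_const (Q i c))" for n c
  have claim: "f b = pmul N d k p (R n) b + fps_X ^ n * \<Phi> n b" if b: "b \<in> ?S" for n b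
  proof (induction n)
    case 0
    have "pmul N d k p (R 0) b = 0" by (simp add: R_def pmul_def cong: if_cong)
    then show ?case using \<Phi>(1) by simp
  next
    case (Suc n)
    have "R (Suc n) = (\<lambda>c. R n c + fps_X ^ n * fps_const (Q n c))" by (simp add: R_def fun_eq_iff)
    then have "pmul N d k p (R (Suc n)) b = pmul N d k p (R n) b + fps_X ^ n * pmul N d k p (\<lambda>c. fps_const (Q n c)) b"
      by (simp only: pmul_add_shift)
    then show ?case using Suc Q[OF b, of n] by (simp add: algebra_simps)
  qed
  define q where "q c = Abs_fps (\<lambda>i. Q i c)" for c
  have Rn: "R n c $ i = (if i < n then Q i c else 0)" for n c i
  proof -
    have "R n c $ i = (\<Sum>j<n. if j = i then Q j c else 0)"
      unfolding R_def fps_sum_nth by (intro sum.cong) (auto simp: fps_X_power_mult_nth)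
    then show ?thesis by (simp add: sum.delta)
  qed
  have "f b = pmul N d k p q b" if b: "b \<in> ?S" for b
  proof (rule fps_ext)
    fix i
    have "fagree i (pmul N d k p (R (Suc i)) b) (pmul N d k p q b)"
      unfolding pmul_def
    proof (intro fagree_sum)
      fix a c
      have "fagree i (p a * R (Suc i) c) (p a * q c)"
        by (intro fagree_mult fagree_refl) (simp add: fagree_def Rn q_def)
      then show "fagree i (if (fst a + fst c, snd a + snd c) = b then p a * R (Suc i) c else 0)
          (if (fst a + fst c, snd a + snd c) = b then p a * q c else 0)" by simp
    qed
    then show "f b $ i = pmul N d k p q b $ i"
      using claim[OF b, of "Suc i"] by (simp add: fagree_def fps_X_power_mult_nth del: power_Suc)
  qed
  then show ?thesis by blast
qed

section \<open>Forms vanishing on the sections of the special pencil\<close>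

lemma card_simple_roots:
  fixes p :: "complex poly"
  assumes "p \<noteq> 0" "\<And>s. poly p s = 0 \<Longrightarrow> poly (pderiv p) s \<noteq> 0"
  shows "card {s. poly p s = 0} = degree p"
proof -
  have "rsquarefree p" using assms(2) by (auto simp: rsquarefree_roots)
  then have "p = smult (lead_coeff p) (\<Prod>z|poly p z = 0. [:-z, 1:])"
    using complex_poly_decompose_rsquarefree by metis
  then have "degree p = degree (\<Prod>z|poly p z = 0. [:-z, 1:])"
    using assms(1) by (metis degree_smult_eq leading_coeff_0_iff)
  also have "\<dots> = card {s. poly p s = 0}"
    using poly_roots_finite[OF assms(1)] by (subst degree_prod_eq_sum_degree) auto
  finally show ?thesis by simp
qed

lemma poly_eq_0_of_many_roots:
  fixes p :: "complex poly"
  assumes "finite A" "\<And>a. a \<in> A \<Longrightarrow> poly p a = 0" "degree p < card A"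
  shows "p = 0"
proof (rule ccontr)
  assume "p \<noteq> 0"
  then have "card A \<le> card {s. poly p s = 0}"
    using assms poly_roots_finite by (intro card_mono) auto
  also have "\<dots> \<le> degree p" using \<open>p \<noteq> 0\<close> by (rule card_poly_roots_bound)
  finally show False using assms by simp
qed

text \<open>Forms are treated as functions: over C they carry the same information, and restriction
  to a hyperplane and divisibility become pointwise statements.\<close>

definition hform :: "nat \<Rightarrow> (('v \<Rightarrow> complex) \<Rightarrow> complex) \<Rightarrow> bool" where
  "hform d F \<longleftrightarrow> (\<exists>P. homogeneous d P \<and> (\<forall>x. F x = evalp (\<lambda>c. c) P x))"

lemma hform_evalp: "homogeneous d P \<Longrightarrow> hform d (\<lambda>x. evalp (\<lambda>c. c) P x)"
  by (auto simp: hform_def)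

lemma hform_zero: "hform d (\<lambda>x. 0)"
  unfolding hform_def by (intro exI[of _ 0]) (simp add: homogeneous_zero)

lemma hform_add: "hform d F \<Longrightarrow> hform d G \<Longrightarrow> hform d (\<lambda>x. F x + G x)"
  unfolding hform_def by (elim exE, rule_tac x = "P + Pa" in exI) (simp add: homogeneous_add evalp_add[OF rhom_id])

lemma hform_diff: "hform d F \<Longrightarrow> hform d G \<Longrightarrow> hform d (\<lambda>x. F x - G x)"
  unfolding hform_def by (elim exE, rule_tac x = "P - Pa" in exI) (simp add: homogeneous_diff rhom_diff[OF rhom_evalp[OF rhom_id]])

lemma hform_mult: "hform d F \<Longrightarrow> hform e G \<Longrightarrow> hform (d + e) (\<lambda>x. F x * G x)"
  unfolding hform_def by (elim exE, rule_tac x = "P * Pa" in exI) (simp add: homogeneous_mult evalp_mult[OF rhom_id])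

lemma hform_sum: "(\<And>i. i \<in> A \<Longrightarrow> hform d (F i)) \<Longrightarrow> hform d (\<lambda>x. \<Sum>i\<in>A. F i x)"
  by (induction A rule: infinite_finite_induct) (auto intro: hform_add hform_zero)

lemma hform_mon: "hform (monom_degree m) (\<lambda>x. c * mon m x)"
  unfolding hform_def
  by (intro exI[of _ "Poly_Mapping.single m c"]) (simp add: homogeneous_single evalp_single[OF rhom_id])

lemma hform_var_power: "hform k (\<lambda>x. c * x v ^ k)"
  using hform_mon[of "Poly_Mapping.single v k" c] by simp

lemma hform_const: "hform 0 (\<lambda>x. c)"
  using hform_mon[of 0 c] by simp

lemma hform_coeffs:
  assumes "hform d F" shows "\<exists>a. \<forall>x. F x = (\<Sum>m\<in>mons d. a m * mon (m :: 'v::finite monom) x)"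
proof -
  obtain P where P: "homogeneous d P" "\<forall>x. F x = evalp (\<lambda>c. c) P x" using assms by (auto simp: hform_def)
  have "evalp (\<lambda>c. c) P x = (\<Sum>m\<in>mons d. Poly_Mapping.lookup P m * mon m x)" for x
    by (rule evalp_superset[OF rhom_id]) (use P in \<open>auto simp: homogeneous_def mons_def finite_monom_degree\<close>)
  then show ?thesis using P by auto
qed

lemma hform_of_coeffs: "hform d (\<lambda>x. \<Sum>m\<in>mons d. a m * mon m x)"
  by (rule hform_sum) (use hform_mon in \<open>auto simp: mons_def\<close>)

text \<open>These functions behave like elements of a domain.\<close>

definition line_poly :: "(('v \<Rightarrow> complex) \<Rightarrow> complex) \<Rightarrow> bool" where
  "line_poly F \<longleftrightarrow> (\<forall>p q. \<exists>r. \<forall>s. F (\<lambda>v. p v + s * (q v - p v)) = poly r s)"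

lemma line_poly_const: "line_poly (\<lambda>x. c)"
  unfolding line_poly_def by (intro allI exI[of _ "[:c:]"]) auto

lemma line_poly_var: "line_poly (\<lambda>x. x v)"
  unfolding line_poly_def by (intro allI, rule_tac x = "[:p v, q v - p v:]" in exI) auto

lemma line_poly_add: "line_poly F \<Longrightarrow> line_poly G \<Longrightarrow> line_poly (\<lambda>x. F x + G x)"
  unfolding line_poly_def by (metis poly_add)

lemma line_poly_mult: "line_poly F \<Longrightarrow> line_poly G \<Longrightarrow> line_poly (\<lambda>x. F x * G x)"
  unfolding line_poly_def by (metis poly_mult)

lemma line_poly_uminus: "line_poly F \<Longrightarrow> line_poly (\<lambda>x. - F x)"
  unfolding line_poly_def by (metis poly_minus)

lemma line_poly_diff: "line_poly F \<Longrightarrow> line_poly G \<Longrightarrow> line_poly (\<lambda>x. F x - G x)"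
  unfolding line_poly_def by (metis poly_diff)

lemma line_poly_power: "line_poly F \<Longrightarrow> line_poly (\<lambda>x. F x ^ k)"
  by (induction k) (auto intro: line_poly_mult line_poly_const)

lemma line_poly_sum: "(\<And>i. i \<in> A \<Longrightarrow> line_poly (F i)) \<Longrightarrow> line_poly (\<lambda>x. \<Sum>i\<in>A. F i x)"
  by (induction A rule: infinite_finite_induct) (auto intro: line_poly_add line_poly_const)

lemma line_poly_prod: "(\<And>i. i \<in> A \<Longrightarrow> line_poly (F i)) \<Longrightarrow> line_poly (\<lambda>x. \<Prod>i\<in>A. F i x)"
  by (induction A rule: infinite_finite_induct) (auto intro: line_poly_mult line_poly_const)

lemma line_poly_hform: assumes "hform d F" shows "line_poly F"
proof -
  obtain P where P: "\<forall>x. F x = evalp (\<lambda>c. c) P x" using assms by (auto simp: hform_def)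
  have "line_poly (\<lambda>x. evalp (\<lambda>c. c) P x)"
    unfolding evalp_def mon_def
    by (intro line_poly_sum line_poly_mult line_poly_const line_poly_prod line_poly_power line_poly_var)
  then show ?thesis using P by (simp add: line_poly_def)
qed

text \<open>Along the line from p, where H is nonzero, to q the product of two polynomials in one
  variable vanishes identically; the one from H is nonzero, so the one from F is zero. The set S
  only has to contain the lines through p.\<close>

lemma line_poly_cancel:
  assumes F: "line_poly F" and H: "line_poly H" and p: "p \<in> S" "H p \<noteq> 0"
    and S: "\<And>q s. q \<in> S \<Longrightarrow> (\<lambda>v. p v + s * (q v - p v)) \<in> S"
    and FH: "\<And>x. x \<in> S \<Longrightarrow> F x * H x = 0" and q: "q \<in> S"
  shows "F q = 0"
proof -
  obtain r where r: "\<And>s. F (\<lambda>v. p v + s * (q v - p v)) = poly r s" using F unfolding line_poly_def by blast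
  obtain h where h: "\<And>s. H (\<lambda>v. p v + s * (q v - p v)) = poly h s" using H unfolding line_poly_def by blast
  have "poly (r * h) s = 0" for s using FH[OF S[OF q]] r h by simp
  then have "r * h = 0" using poly_all_0_iff_0 by blast
  moreover have "poly h 0 \<noteq> 0" using h[of 0] p by simp
  ultimately have "r = 0" by auto
  then show ?thesis using r[of 1] by simp
qed

lemma line_poly_cancel_UNIV:
  assumes "line_poly F" "line_poly H" "H p \<noteq> 0" "\<And>x. F x * H x = 0"
  shows "F q = 0"
  by (rule line_poly_cancel[where S = UNIV, OF assms(1,2)]) (use assms in auto)

lemma line_poly_cancel_hyperplane:
  assumes "line_poly F" "line_poly H" "p a = c * p b" "H p \<noteq> 0"
    "\<And>x. x a = c * x b \<Longrightarrow> F x * H x = 0" "q a = c * q b"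
  shows "F q = 0"
  by (rule line_poly_cancel[where S = "{x. x a = c * x b}", OF assms(1,2)])
     (use assms in \<open>auto simp: algebra_simps\<close>)

text \<open>Forms of degree d - k, where a negative degree leaves only the zero function; truncated
  subtraction would admit constants instead.\<close>

definition hform_sub :: "nat \<Rightarrow> nat \<Rightarrow> (('v \<Rightarrow> complex) \<Rightarrow> complex) \<Rightarrow> bool" where
  "hform_sub d k G \<longleftrightarrow> (if k \<le> d then hform (d - k) G else (\<forall>x. G x = 0))"

lemma hform_sub_line_poly: "hform_sub d k G \<Longrightarrow> line_poly G"
proof -
  assume A: "hform_sub d k G"
  show ?thesis
  proof (cases "k \<le> d")
    case True
    then show ?thesis using A line_poly_hform unfolding hform_sub_def by auto
  next
    case False
    then have "G = (\<lambda>x. 0)" using A by (auto simp: hform_sub_def)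
    then show ?thesis using line_poly_const by simp
  qed
qed

text \<open>Monomial by monomial, this is the factorisation of x_a^k - (c x_b)^k, which lowers the
  degree by one.\<close>

lemma hform_remainder:
  assumes ab: "a \<noteq> b" and F: "hform d F"
  shows "\<exists>G. hform_sub d 1 G \<and> (\<forall>x. F x - F (x(a := c * x b)) = (x a - c * x b) * G x)"
proof -
  obtain P where P: "homogeneous d P" "\<And>x. F x = evalp (\<lambda>c. c) P x" using F by (auto simp: hform_def)
  have "\<exists>G. hform_sub d 1 G \<and> (\<forall>x. u * mon m x - u * mon m (x(a := c * x b)) = (x a - c * x b) * G x)"
    if m: "monom_degree m = d" for u m
  proof -
    define k where "k = Poly_Mapping.lookup m a"
    define m' where "m' = m - Poly_Mapping.single a k"
    have mm: "m = m' + Poly_Mapping.single a k"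
      by (rule poly_mapping_eqI) (auto simp: m'_def k_def lookup_add lookup_minus lookup_single when_def)
    have am': "a \<notin> Poly_Mapping.keys m'" by (simp add: in_keys_iff m'_def lookup_minus k_def)
    have mon': "mon m' (x(a := y)) = mon m' x" for x :: "'a \<Rightarrow> complex" and y
      unfolding mon_def using am' by (intro prod.cong) auto
    have md: "monom_degree m' + k = d" using m mm by (metis monom_degree_add monom_degree_single)
    show ?thesis
    proof (cases k)
      case 0
      then have "hform_sub d 1 (\<lambda>x. 0) \<and> (\<forall>x. u * mon m x - u * mon m (x(a := c * x b)) = (x a - c * x b) * 0)"
        using mm mon' by (auto simp: hform_sub_def hform_zero)
      then show ?thesis by blast
    next
      case (Suc n)
      define G where "G x = (\<Sum>i<Suc n. (u * mon m' x) * ((1 * x a ^ i) * (c ^ (n - i) * x b ^ (n - i))))" for x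
      have "hform (monom_degree m' + n) G"
        unfolding G_def
      proof (rule hform_sum)
        fix i assume "i \<in> {..<Suc n}"
        then have n: "n = i + (n - i)" by simp
        have "hform (monom_degree m' + (i + (n - i))) (\<lambda>x. (u * mon m' x) * ((1 * x a ^ i) * (c ^ (n - i) * x b ^ (n - i))))"
          by (intro hform_mult hform_mon hform_var_power)
        then show "hform (monom_degree m' + n) (\<lambda>x. (u * mon m' x) * ((1 * x a ^ i) * (c ^ (n - i) * x b ^ (n - i))))"
          using n by simp
      qed
      then have "hform_sub d 1 G" using md Suc by (auto simp: hform_sub_def)
      moreover have "u * mon m x - u * mon m (x(a := c * x b)) = (x a - c * x b) * G x" for x
      proof -
        have "u * mon m x - u * mon m (x(a := c * x b)) = u * mon m' x * (x a ^ Suc n - (c * x b) ^ Suc n)"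
          unfolding mm mon_add mon_single mon' Suc using ab by (simp add: algebra_simps)
        also have "\<dots> = (x a - c * x b) * G x"
          unfolding diff_power_eq_sum G_def by (simp add: sum_distrib_left power_mult_distrib mult_ac del: sum.lessThan_Suc)
        finally show ?thesis .
      qed
      ultimately show ?thesis by blast
    qed
  qed
  then have "\<forall>m\<in>Poly_Mapping.keys P. \<exists>G. hform_sub d 1 G \<and> (\<forall>x. Poly_Mapping.lookup P m * mon m x -
      Poly_Mapping.lookup P m * mon m (x(a := c * x b)) = (x a - c * x b) * G x)"
    using P(1) by (auto simp: homogeneous_def)
  from bchoice[OF this] obtain G where G: "\<And>m. m \<in> Poly_Mapping.keys P \<Longrightarrow> hform_sub d 1 (G m)"
    "\<And>m x. m \<in> Poly_Mapping.keys P \<Longrightarrow> Poly_Mapping.lookup P m * mon m x -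
      Poly_Mapping.lookup P m * mon m (x(a := c * x b)) = (x a - c * x b) * G m x" by blast
  have "hform_sub d 1 (\<lambda>x. \<Sum>m\<in>Poly_Mapping.keys P. G m x)"
    using G(1) by (cases "1 \<le> d") (auto simp: hform_sub_def intro: hform_sum)
  moreover have "F x - F (x(a := c * x b)) = (x a - c * x b) * (\<Sum>m\<in>Poly_Mapping.keys P. G m x)" for x
    unfolding P(2) evalp_def sum_subtractf[symmetric] sum_distrib_left by (intro sum.cong refl G(2))
  ultimately show ?thesis by blast
qed

lemma hform_sub_divide:
  assumes ab: "a \<noteq> b" and F: "hform_sub d k F" and van: "\<And>x. x a = c * x b \<Longrightarrow> F x = 0"
  shows "\<exists>G. hform_sub d (Suc k) G \<and> (\<forall>x. F x = (x a - c * x b) * G x)"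
proof (cases "k \<le> d")
  case True
  then obtain G where G: "hform_sub (d - k) 1 G" "\<And>x. F x - F (x(a := c * x b)) = (x a - c * x b) * G x"
    using hform_remainder[OF ab, of "d - k" F c] F by (auto simp: hform_sub_def)
  have "F (x(a := c * x b)) = 0" for x using ab by (intro van) auto
  then have "F x = (x a - c * x b) * G x" for x using G(2)[of x] by simp
  moreover have "hform_sub d (Suc k) G" using G(1) True
    by (auto simp: hform_sub_def Suc_le_eq split: if_splits)
  ultimately show ?thesis by blast
next
  case False
  then show ?thesis using F by (intro exI[of _ "\<lambda>x. 0"]) (auto simp: hform_sub_def)
qed

text \<open>The linear factors are divided out one after another. The quotient still vanishes on the
  next hyperplane because the factors already removed do not vanish identically there, as the points
  in the last hypothesis show.\<close>

lemma hform_divide_hyperplanes: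
  assumes "finite L" "\<And>a c b. (a, c, b) \<in> L \<Longrightarrow> a \<noteq> b" and F: "hform d F"
    and van: "\<And>a c b x. (a, c, b) \<in> L \<Longrightarrow> x a = c * x b \<Longrightarrow> F x = 0"
    and pts: "\<And>a c b. (a, c, b) \<in> L \<Longrightarrow> \<exists>p. p a = c * p b \<and> (\<forall>(a', c', b')\<in>L - {(a, c, b)}. p a' - c' * p b' \<noteq> 0)"
  shows "\<exists>G. hform_sub d (card L) G \<and> (\<forall>x. F x = (\<Prod>(a, c, b)\<in>L. x a - c * x b) * G x)"
proof -
  have "\<exists>G. hform_sub d (card L') G \<and> (\<forall>x. F x = (\<Prod>(a, c, b)\<in>L'. x a - c * x b) * G x)" if "L' \<subseteq> L" for L'
    using finite_subset[OF that assms(1)] that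
  proof (induction L' rule: finite_induct)
    case empty
    then show ?case using F by (intro exI[of _ F]) (simp add: hform_sub_def)
  next
    case (insert l L')
    obtain a c b where l: "l = (a, c, b)" by (cases l)
    obtain G where G: "hform_sub d (card L') G" "\<And>x. F x = (\<Prod>(a, c, b)\<in>L'. x a - c * x b) * G x"
      using insert by auto
    have lL: "(a, c, b) \<in> L" using insert l by auto
    obtain p where p: "p a = c * p b" "\<forall>(a', c', b')\<in>L - {(a, c, b)}. p a' - c' * p b' \<noteq> 0"
      using pts[OF lL] by blast
    have "G x = 0" if "x a = c * x b" for x
    proof (rule line_poly_cancel_hyperplane[where F = G and q = x and H = "\<lambda>x. \<Prod>(a, c, b)\<in>L'. x a - c * x b" and p = p and a = a and b = b and c = c])
      show "line_poly G" using G(1) by (rule hform_sub_line_poly)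
      show "line_poly (\<lambda>x. \<Prod>(a, c, b)\<in>L'. x a - c * x b)"
        unfolding case_prod_unfold
        by (intro line_poly_prod line_poly_diff line_poly_mult line_poly_const line_poly_var)
      show "(\<Prod>(a, c, b)\<in>L'. p a - c * p b) \<noteq> 0"
      proof -
        have "L' \<subseteq> L - {(a, c, b)}" using insert l by auto
        then have "\<forall>(a', c', b')\<in>L'. p a' - c' * p b' \<noteq> 0" using p(2) by fastforce
        then show ?thesis using insert.hyps(1) by (auto simp: prod_zero_iff)
      qed
      show "G x * (\<Prod>(a, c, b)\<in>L'. x a - c * x b) = 0" if "x a = c * x b" for x
        using van[OF lL that] G(2)[of x] by (simp add: mult.commute)
    qed (use p that in auto)
    from hform_sub_divide[OF assms(2)[OF lL] G(1) this]
    obtain G' where "hform_sub d (Suc (card L')) G'" "\<forall>x. G x = (x a - c * x b) * G' x" by blast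
    then show ?case using insert l G(2) by (intro exI[of _ G']) (auto simp: mult_ac)
  qed
  then show ?thesis by blast
qed

text \<open>Division by f1 + t f2: the last hypothesis says, with denominators cleared, that t = -f1/f2 is
  a root.\<close>

lemma divide_by_linear_pencil:
  assumes f1: "hform N f1" and f2: "hform N f2" and p2: "f2 p2 \<noteq> 0"
    and div: "\<And>F l. hform d F \<Longrightarrow> (\<And>x. f2 x = 0 \<Longrightarrow> F x * f1 x ^ l = 0) \<Longrightarrow> \<exists>G. hform_sub d N G \<and> (\<forall>x. F x = f2 x * G x)"
    and "\<And>j. j \<le> k \<Longrightarrow> hform d (F j)"
    and "\<And>x. (\<Sum>j\<le>k. F j x * (- f1 x) ^ j * f2 x ^ (k - j)) = 0"
  shows "\<exists>G. (\<forall>j. hform_sub d N (G j)) \<and> (\<forall>j\<le>k. \<forall>x. F j x = (if j < k then f1 x * G j x else 0) + (if j > 0 then f2 x * G (j - 1) x else 0))"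
  using assms(5,6)
proof (induction k arbitrary: F)
  case 0
  have "hform_sub d N (\<lambda>x. 0)" by (auto simp: hform_sub_def hform_zero)
  then show ?case using 0 by (intro exI[of _ "\<lambda>j x. 0"]) auto
next
  case (Suc k)
  have lp: "line_poly f1" "line_poly f2" using f1 f2 by (auto intro: line_poly_hform)
  \<comment> \<open>Where f2 vanishes only the term of highest degree in t survives, so the top
    coefficient is divisible by f2.\<close>
  have top: "F (Suc k) x * (- f1 x) ^ Suc k = - (f2 x * (\<Sum>j\<le>k. F j x * (- f1 x) ^ j * f2 x ^ (k - j)))" for x
  proof -
    have "(\<Sum>j\<le>k. F j x * (- f1 x) ^ j * f2 x ^ (Suc k - j)) = f2 x * (\<Sum>j\<le>k. F j x * (- f1 x) ^ j * f2 x ^ (k - j))"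
      unfolding sum_distrib_left by (intro sum.cong refl) (simp add: Suc_diff_le mult_ac)
    then show ?thesis using Suc.prems(2)[of x] by (simp add: eq_neg_iff_add_eq_0 add.commute)
  qed
  have "F (Suc k) x * f1 x ^ Suc k = 0" if "f2 x = 0" for x
    using top[of x] that by (simp add: power_minus[of "f1 x"])
  from div[OF Suc.prems(1)[OF order_refl] this] obtain g where g: "hform_sub d N g" "\<And>x. F (Suc k) x = f2 x * g x"
    by blast
  \<comment> \<open>Subtracting t^k (f1 + t f2) g removes the top coefficient and changes only the
    next one.\<close>
  define F' where "F' j x = (if j = k then F k x - f1 x * g x else F j x)" for j x
  have hf': "hform d (F' j)" if "j \<le> k" for j
  proof (cases "j = k")
    case True
    have "hform d (\<lambda>x. f1 x * g x)"
    proof (cases "N \<le> d")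
      case True
      then have "hform (N + (d - N)) (\<lambda>x. f1 x * g x)" using g(1) by (intro hform_mult f1) (simp add: hform_sub_def)
      then show ?thesis using True by simp
    next
      case False
      then have "(\<lambda>x. f1 x * g x) = (\<lambda>x. 0)" using g(1) by (auto simp: hform_sub_def)
      then show ?thesis by (simp add: hform_zero)
    qed
    then have "hform d (\<lambda>x. F k x - f1 x * g x)" using Suc.prems(1)[of k] by (intro hform_diff) auto
    then show ?thesis using True by (simp add: F'_def[abs_def])
  next
    case False
    then show ?thesis using Suc.prems(1)[of j] that by (simp add: F'_def[abs_def])
  qed
  \<comment> \<open>This sum times f2 is the sum given for F; f2 is cancelled because it is not
    identically zero.\<close>
  have S': "(\<Sum>j\<le>k. F' j x * (- f1 x) ^ j * f2 x ^ (k - j)) = 0" for x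
  proof (rule line_poly_cancel_UNIV[where F = "\<lambda>x. \<Sum>j\<le>k. F' j x * (- f1 x) ^ j * f2 x ^ (k - j)" and q = x and H = f2 and p = p2])
    show "line_poly (\<lambda>x. \<Sum>j\<le>k. F' j x * (- f1 x) ^ j * f2 x ^ (k - j))"
      using hf' by (intro line_poly_sum line_poly_mult line_poly_power line_poly_uminus lp) (auto intro: line_poly_hform)
    fix x
    have "(\<Sum>j\<le>k. F' j x * (- f1 x) ^ j * f2 x ^ (k - j)) = (\<Sum>j\<le>k. F j x * (- f1 x) ^ j * f2 x ^ (k - j)
       + (if j = k then - (f1 x * g x) * (- f1 x) ^ k else 0))"
      by (intro sum.cong refl) (auto simp: F'_def algebra_simps)
    also have "\<dots> = (\<Sum>j\<le>k. F j x * (- f1 x) ^ j * f2 x ^ (k - j)) + g x * (- f1 x) ^ Suc k"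
      by (simp add: sum.distrib)
    finally have S': "(\<Sum>j\<le>k. F' j x * (- f1 x) ^ j * f2 x ^ (k - j)) =
       (\<Sum>j\<le>k. F j x * (- f1 x) ^ j * f2 x ^ (k - j)) + g x * (- f1 x) ^ Suc k" .
    have "(\<Sum>j\<le>k. F' j x * (- f1 x) ^ j * f2 x ^ (k - j)) * f2 x =
       f2 x * (\<Sum>j\<le>k. F j x * (- f1 x) ^ j * f2 x ^ (k - j)) + f2 x * g x * (- f1 x) ^ Suc k"
      unfolding S' by (simp only: distrib_right distrib_left mult_ac)
    also have "\<dots> = 0" using top[of x] g(2)[of x] by (simp only: add.right_inverse)
    finally show "(\<Sum>j\<le>k. F' j x * (- f1 x) ^ j * f2 x ^ (k - j)) * f2 x = 0" .
  qed (use p2 lp in auto)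
  from Suc.IH[OF hf' S'] obtain G where G: "\<And>j. hform_sub d N (G j)"
    "\<And>j x. j \<le> k \<Longrightarrow> F' j x = (if j < k then f1 x * G j x else 0) + (if j > 0 then f2 x * G (j - 1) x else 0)"
    by blast
  define G' where "G' j = (if j = k then g else G j)" for j
  have "F j x = (if j < Suc k then f1 x * G' j x else 0) + (if j > 0 then f2 x * G' (j - 1) x else 0)" if "j \<le> Suc k" for j x
  proof -
    consider "j = Suc k" | "j = k" | "j < k" using \<open>j \<le> Suc k\<close> by linarith
    then show ?thesis
    proof cases
      case 1
      then show ?thesis using g(2) by (simp add: G'_def)
    next
      case 2
      then show ?thesis using G(2)[of k x] by (auto simp: G'_def F'_def diff_eq_eq add.commute)
    next
      case 3
      then show ?thesis using G(2)[of j x] by (auto simp: G'_def F'_def)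
    qed
  qed
  moreover have "hform_sub d N (G' j)" for j using G(1) g(1) by (simp add: G'_def)
  ultimately show ?case by blast
qed

text \<open>Weighted sums read exponents as digits: the weight B of a new variable exceeds every sum
  over the previous ones, so division with remainder by B recovers both parts.\<close>

lemma separating_weights:
  fixes F :: "('v \<Rightarrow> nat) set"
  assumes "finite S" "finite F"
  shows "\<exists>w. \<forall>a\<in>F. \<forall>b\<in>F. (\<Sum>v\<in>S. a v * w v) = (\<Sum>v\<in>S. b v * w v) \<longrightarrow> (\<forall>v\<in>S. a v = (b v :: nat))"
  using assms(1)
proof (induction S rule: finite_induct)
  case (insert u S)
  then obtain w where w: "\<forall>a\<in>F. \<forall>b\<in>F. (\<Sum>v\<in>S. a v * w v) = (\<Sum>v\<in>S. b v * w v) \<longrightarrow> (\<forall>v\<in>S. a v = b v)" by blast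
  define B where "B = Suc (Max (insert 0 ((\<lambda>a. \<Sum>v\<in>S. a v * w v) ` F)))"
  have B: "(\<Sum>v\<in>S. a v * w v) < B" if "a \<in> F" for a
    using that assms(2) by (auto simp: B_def less_Suc_eq_le intro: Max_ge)
  define w' where "w' = w(u := B)"
  have s: "(\<Sum>v\<in>insert u S. a v * w' v) = a u * B + (\<Sum>v\<in>S. a v * w v)" for a
  proof -
    have "(\<Sum>v\<in>S. a v * w' v) = (\<Sum>v\<in>S. a v * w v)"
      using insert.hyps by (intro sum.cong) (auto simp: w'_def)
    then show ?thesis using insert.hyps by (simp add: w'_def)
  qed
  have "\<forall>v\<in>insert u S. a v = b v" if ab: "a \<in> F" "b \<in> F" "(\<Sum>v\<in>insert u S. a v * w' v) = (\<Sum>v\<in>insert u S. b v * w' v)" for a b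
  proof -
    have e: "a u * B + (\<Sum>v\<in>S. a v * w v) = b u * B + (\<Sum>v\<in>S. b v * w v)" using ab(3) unfolding s .
    have "(a u * B + (\<Sum>v\<in>S. a v * w v)) mod B = (\<Sum>v\<in>S. a v * w v)"
      "(b u * B + (\<Sum>v\<in>S. b v * w v)) mod B = (\<Sum>v\<in>S. b v * w v)" using B ab by auto
    then have eq: "(\<Sum>v\<in>S. a v * w v) = (\<Sum>v\<in>S. b v * w v)" using e by metis
    then have "a u * B = b u * B" using e by simp
    moreover have "B > 0" by (simp add: B_def)
    ultimately show ?thesis using w ab eq by auto
  qed
  then show ?case by blast
qed auto

text \<open>Kronecker substitution.\<close>

lemma nonzero_polynomial_nonvanishing:
  fixes a :: "'v monom \<Rightarrow> complex"
  assumes "finite M" "m0 \<in> M" "a m0 \<noteq> 0"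
  shows "\<exists>x. (\<Sum>m\<in>M. a m * mon m x) \<noteq> 0"
proof (rule ccontr)
  assume H: "\<not> ?thesis"
  define S where "S = (\<Union>m\<in>M. Poly_Mapping.keys m)"
  have S: "finite S" "\<And>m. m \<in> M \<Longrightarrow> Poly_Mapping.keys m \<subseteq> S" using assms by (auto simp: S_def)
  obtain w where w: "\<And>m m'. m \<in> M \<Longrightarrow> m' \<in> M \<Longrightarrow> (\<Sum>v\<in>S. Poly_Mapping.lookup m v * w v) = (\<Sum>v\<in>S. Poly_Mapping.lookup m' v * w v) \<Longrightarrow>
     (\<forall>v\<in>S. Poly_Mapping.lookup m v = Poly_Mapping.lookup m' v)"
    using separating_weights[OF S(1), of "Poly_Mapping.lookup ` M"] assms by auto
  define k where "k m = (\<Sum>v\<in>S. Poly_Mapping.lookup m v * w v)" for m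
  have inj: "m = m'" if "m \<in> M" "m' \<in> M" "k m = k m'" for m m'
  proof (rule poly_mapping_eqI)
    fix v
    show "Poly_Mapping.lookup m v = Poly_Mapping.lookup m' v"
    proof (cases "v \<in> S")
      case True
      then show ?thesis using w[OF that(1,2)] that(3) unfolding k_def by blast
    next
      case False
      then have "v \<notin> Poly_Mapping.keys m" "v \<notin> Poly_Mapping.keys m'" using S(2) that by auto
      then show ?thesis by (simp add: in_keys_iff)
    qed
  qed
  define P where "P = (\<Sum>m\<in>M. monom (a m) (k m))"
  have "poly P s = 0" for s
  proof -
    have "mon m (\<lambda>v. s ^ w v) = s ^ k m" if "m \<in> M" for m
      using mon_superset[OF S(1) S(2)[OF that], of "\<lambda>v. s ^ w v"]
      by (simp add: k_def power_sum power_mult[symmetric] mult.commute)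
    then have "poly P s = (\<Sum>m\<in>M. a m * mon m (\<lambda>v. s ^ w v))"
      by (simp add: P_def poly_sum poly_monom)
    then show ?thesis using H by auto
  qed
  then have "P = 0" using poly_all_0_iff_0 by blast
  moreover have "coeff P (k m0) = a m0"
  proof -
    have "coeff P (k m0) = (\<Sum>m\<in>M. if m = m0 then a m0 else 0)"
      unfolding P_def coeff_sum by (intro sum.cong refl) (use inj assms in auto)
    then show ?thesis using assms by simp
  qed
  ultimately show False using assms by simp
qed

lemma beval_eq_0:
  fixes f :: "'v::finite monom \<times> nat \<Rightarrow> complex"
  assumes "\<And>x t. beval (bimons d k) (\<lambda>c. c) f x t = 0" and b: "b \<in> bimons d k"
  shows "f b = 0"
proof (rule ccontr)
  assume nz: "f b \<noteq> 0"
  obtain m j where mj: "b = (m, j)" "m \<in> mons d" "j \<le> k" using b by (auto simp: bimons_def)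
  obtain x where x: "(\<Sum>m\<in>mons d. f (m, j) * mon m x) \<noteq> 0"
    using nonzero_polynomial_nonvanishing[of "mons d" m "\<lambda>m. f (m, j)"] mj nz by auto
  define P where "P = (\<Sum>i\<le>k. monom (\<Sum>m\<in>mons d. f (m, i) * mon m x) i)"
  have "poly P t = 0" for t
  proof -
    have "poly P t = (\<Sum>i\<le>k. \<Sum>m\<in>mons d. f (m, i) * mon m x * t ^ i)"
      by (simp add: P_def poly_sum poly_monom sum_distrib_right)
    also have "\<dots> = beval (bimons d k) (\<lambda>c. c) f x t"
      unfolding beval_def bimons_def by (subst sum.swap) (simp add: sum.cartesian_product bmon_def mult.assoc case_prod_unfold)
    finally show ?thesis using assms by simp
  qed
  then have "P = 0" using poly_all_0_iff_0 by blast
  moreover have "coeff P j = (\<Sum>m\<in>mons d. f (m, j) * mon m x)"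
    using mj by (simp add: P_def coeff_sum)
  ultimately show False using x by simp
qed

text \<open>One coordinate at a time: as a function of it, F is a polynomial of degree at most D
  with more than D roots.\<close>

lemma vanishing_on_grid:
  fixes F :: "('v \<Rightarrow> complex) \<Rightarrow> complex"
  assumes "finite J" and poly: "\<And>x j. j \<in> J \<Longrightarrow> \<exists>q. degree q \<le> D \<and> (\<forall>s. F (x(j := s)) = poly q s)"
    and G: "\<And>j. j \<in> J \<Longrightarrow> finite (G j) \<and> card (G j) > D"
    and van: "\<And>y. (\<And>v. v \<notin> J \<Longrightarrow> y v = x v) \<Longrightarrow> (\<And>j. j \<in> J \<Longrightarrow> y j \<in> G j) \<Longrightarrow> F y = 0"
  shows "F x = 0"
  using assms
proof (induction J arbitrary: x rule: finite_induct)
  case (insert k J)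
  have 1: "F (x(k := s)) = 0" if s: "s \<in> G k" for s
  proof (rule insert.IH)
    fix y assume y: "\<And>v. v \<notin> J \<Longrightarrow> y v = (x(k := s)) v" "\<And>j. j \<in> J \<Longrightarrow> y j \<in> G j"
    show "F y = 0"
    proof (rule insert.prems(3))
      show "y v = x v" if "v \<notin> insert k J" for v using y(1)[of v] that by auto
      show "y j \<in> G j" if "j \<in> insert k J" for j using y that s insert.hyps by auto
    qed
  qed (use insert.prems in auto)
  obtain q where q: "degree q \<le> D" "\<And>s. F (x(k := s)) = poly q s" using insert.prems(1)[of k x] by blast
  have "q = 0"
    by (rule poly_eq_0_of_many_roots[of "G k"]) (use insert.prems(2)[of k] q 1 in auto)
  then show ?case using q(2)[of "x k"] by simp
qed auto

text \<open>If the Wronskian were zero, coprimality of x and y would make y divide its own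
  derivative, which is nonzero of smaller degree.\<close>

lemma wronskian_nonzero:
  fixes x y :: "complex poly"
  assumes nc: "\<And>s. \<not> (poly x s = 0 \<and> poly y s = 0)" and dy: "degree y \<ge> 1"
  shows "pderiv x * y - x * pderiv y \<noteq> 0"
proof
  assume 0: "pderiv x * y - x * pderiv y = 0"
  obtain a b c where "a * x + b * y + c * 0 = 1" using bezout_no_common_root[of x y 0] nc by auto
  then have ab: "a * x + b * y = 1" by simp
  have "pderiv y = pderiv y * (a * x + b * y)" using ab by simp
  also have "\<dots> = y * (a * pderiv x + b * pderiv y)" using 0 by (simp add: algebra_simps)
  finally have dv: "pderiv y = y * (a * pderiv x + b * pderiv y)" .
  have "pderiv y \<noteq> 0" using dy by (simp add: pderiv_eq_0_iff)
  then have "a * pderiv x + b * pderiv y \<noteq> 0" "y \<noteq> 0" using dv by auto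
  then have "degree (pderiv y) \<ge> degree y" using dv by (metis degree_mult_eq le_add1)
  then show False using dy by (simp add: degree_pderiv)
qed

text \<open>x / y is a map of degree e from the projective line to itself. Apart from its value at
  infinity and its critical values, found among the zeros of the Wronskian, every finite value has e
  distinct finite preimages.\<close>

lemma many_preimages:
  fixes x y :: "complex poly"
  assumes nc: "\<And>s. \<not> (poly x s = 0 \<and> poly y s = 0)" and dx: "degree x \<le> e" and dy: "degree y = e" "e \<ge> 1"
  shows "\<exists>B. finite B \<and> (\<forall>v. v \<notin> B \<longrightarrow> finite {s. poly x s = v * poly y s} \<and> card {s. poly x s = v * poly y s} = e)"
proof -
  define W where "W = pderiv x * y - x * pderiv y"
  have "W \<noteq> 0" unfolding W_def using wronskian_nonzero nc dy by auto
  define B where "B = insert (coeff x e / coeff y e) ((\<lambda>s. poly x s / poly y s) ` {s. poly W s = 0})"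
  have "finite B" unfolding B_def using poly_roots_finite[OF \<open>W \<noteq> 0\<close>] by simp
  have "finite {s. poly x s = v * poly y s} \<and> card {s. poly x s = v * poly y s} = e" if v: "v \<notin> B" for v
  proof -
    define p where "p = x - smult v y"
    have ye: "coeff y e \<noteq> 0" using dy by auto
    have pe: "coeff p e \<noteq> 0"
    proof
      assume "coeff p e = 0"
      then have "v = coeff x e / coeff y e" using ye by (simp add: p_def field_simps)
      then show False using v by (simp add: B_def)
    qed
    have "degree p \<le> e" unfolding p_def using dx dy by (intro degree_diff_le) (auto intro: order_trans[OF degree_smult_le])
    then have dp: "degree p = e" "p \<noteq> 0" using pe le_degree by (auto intro: antisym)
    have "poly (pderiv p) s \<noteq> 0" if s: "poly p s = 0" for s
    proof
      assume A: "poly (pderiv p) s = 0"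
      have xs: "poly x s = v * poly y s" using s by (simp add: p_def)
      then have "poly y s \<noteq> 0" using nc[of s] by auto
      moreover have "poly W s = 0" using A xs by (simp add: W_def p_def pderiv_diff pderiv_smult algebra_simps)
      ultimately have "v \<in> B" unfolding B_def using xs by (intro insertI2 image_eqI[of _ _ s]) auto
      then show False using v by simp
    qed
    from card_simple_roots[OF dp(2) this] have "card {s. poly p s = 0} = e" using dp by simp
    moreover have "{s. poly p s = 0} = {s. poly x s = v * poly y s}" by (auto simp: p_def)
    moreover have "finite {s. poly p s = 0}" using poly_roots_finite[OF dp(2)] .
    ultimately show ?thesis by simp
  qed
  then show ?thesis using \<open>finite B\<close> by blast
qed

context special_pencil
begin

definition p0 :: "'n monom \<times> nat \<Rightarrow> complex" where
  "p0 a = Poly_Mapping.lookup (if snd a = 0 then F1 else F2) (fst a)"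

text \<open>D + 1 values for each \<zeta> j, enough for degree D in each w_j; 0 is left out because
  unobstructedness needs nonzero \<zeta> j.\<close>

definition grid :: "nat \<Rightarrow> ('n \<Rightarrow> complex) set" where
  "grid D = PiE J (\<lambda>_. of_nat ` {1..Suc D})"

lemma finite_grid: "finite (grid D)"
  unfolding grid_def by (intro finite_PiE) auto

lemma grid_nonzero: "\<zeta> \<in> grid D \<Longrightarrow> j \<in> J \<Longrightarrow> \<zeta> j \<noteq> 0"
  by (auto simp: grid_def PiE_def Pi_def)

text \<open>Parametrises the plane w_j = \<zeta>_j (x - c_j y) by x = u, y = v, z = w.\<close>

definition cone_point :: "('n \<Rightarrow> complex) \<Rightarrow> complex \<Rightarrow> complex \<Rightarrow> complex \<Rightarrow> 'n \<Rightarrow> complex" where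
  "cone_point \<zeta> u v w i = (if i = i0 then u else if i = i1 then v else if i = i2 then w else \<zeta> i * (u - c i * v))"

definition coeff_form :: "nat \<Rightarrow> ('n monom \<times> nat \<Rightarrow> complex) \<Rightarrow> nat \<Rightarrow> ('n \<Rightarrow> complex) \<Rightarrow> complex" where
  "coeff_form d f j x = (\<Sum>m\<in>mons d. f (m, j) * mon m x)"

lemma beval_coeff_form: "beval (bimons d k) (\<lambda>c. c) f x t = (\<Sum>j\<le>k. coeff_form d f j x * t ^ j)"
  unfolding beval_def bimons_def coeff_form_def sum_distrib_right
  by (subst sum.swap) (simp add: sum.cartesian_product bmon_def mult.assoc case_prod_unfold)

lemma coeff_form_scale: "coeff_form d f j (\<lambda>v. s * x v) = s ^ d * coeff_form d f j x"
  by (simp add: coeff_form_def mon_scale sum_distrib_left mult_ac mons_def)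

lemma cone_point_scale: "cone_point \<zeta> (s * u) (s * v) (s * w) = (\<lambda>i. s * cone_point \<zeta> u v w i)"
  by (auto simp: cone_point_def algebra_simps)

text \<open>The form restricted to the plane with parameter zeta, with the value of t for which the
  cubic passes through the given point inserted and denominators cleared.\<close>

definition plane_form :: "nat \<Rightarrow> nat \<Rightarrow> ('n monom \<times> nat \<Rightarrow> complex) \<Rightarrow> ('n \<Rightarrow> complex) \<Rightarrow> complex \<Rightarrow> complex \<Rightarrow> complex \<Rightarrow> complex" where
  "plane_form d k f \<zeta> u v w = (\<Sum>j\<le>k. coeff_form d f j (cone_point \<zeta> u v w) *
      (- (u^3 - w^3)) ^ j * ((\<Prod>j\<in>J. \<zeta> j) * (v^3 - w^3)) ^ (k - j))"

lemma plane_form_scale: "plane_form d k f \<zeta> (s * u) (s * v) (s * w) = s ^ (d + 3 * k) * plane_form d k f \<zeta> u v w"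
  unfolding plane_form_def sum_distrib_left
proof (intro sum.cong refl)
  fix j assume "j \<in> {..k}"
  then have k: "3 * k = 3 * j + 3 * (k - j)" by auto
  let ?Z = "\<Prod>j\<in>J. \<zeta> j"
  have 1: "- ((s * u)^3 - (s * w)^3) = s^3 * (- (u^3 - w^3))" "?Z * ((s * v)^3 - (s * w)^3) = s^3 * (?Z * (v^3 - w^3))"
    by (simp_all add: power_mult_distrib algebra_simps)
  show "coeff_form d f j (cone_point \<zeta> (s * u) (s * v) (s * w)) * (- ((s * u)^3 - (s * w)^3)) ^ j * (?Z * ((s * v)^3 - (s * w)^3)) ^ (k - j)
    = s ^ (d + 3 * k) * (coeff_form d f j (cone_point \<zeta> u v w) * (- (u^3 - w^3)) ^ j * (?Z * (v^3 - w^3)) ^ (k - j))"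
    unfolding 1 cone_point_scale coeff_form_scale k power_mult_distrib[of "s^3"] power_add power_mult by (simp only: mult_ac)
qed

text \<open>On the section the cubic equation reads -(x^3 - z^3) = t (y^3 - z^3), so the inserted
  quotient is t / Z, the parameter of the fibre through the point. Up to a power of the denominator
  the value is that of the form on the section.\<close>

lemma plane_form_on_section:
  assumes sec: "smooth_section e x y z" and \<zeta>: "\<And>j. j \<in> J \<Longrightarrow> \<zeta> j \<noteq> 0"
    and van: "beval (bimons d k) (\<lambda>a. [:a:]) f (base_sec x y z \<zeta>) T = 0"
  shows "plane_form d k f \<zeta> (poly x t) (poly y t) (poly z t) = 0"
proof -
  define Z where "Z = (\<Prod>j\<in>J. \<zeta> j)"
  have Z: "Z \<noteq> 0" using \<zeta> by (simp add: Z_def)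
  let ?P = "cone_point \<zeta> (poly x t) (poly y t) (poly z t)"
  have ev: "rhom (\<lambda>p. poly p (t / Z))" by (simp add: rhom_def)
  have pt: "poly (base_sec x y z \<zeta> v) (t / Z) = ?P v" for v
    using Z by (auto simp: base_sec_def Let_def cone_point_def poly_pcompose Z_def[symmetric])
  have "poly (beval (bimons d k) (\<lambda>a. [:a:]) f (base_sec x y z \<zeta>) T) (t / Z) = 0" using van by simp
  then have "beval (bimons d k) (\<lambda>c. c) f ?P (t / Z) = 0"
    unfolding beval_rhom[OF ev] pt by simp
  then have 0: "(\<Sum>j\<le>k. coeff_form d f j ?P * (t / Z) ^ j) = 0" unfolding beval_coeff_form .
  define b where "b = poly y t ^ 3 - poly z t ^ 3"
  have a: "- (poly x t ^ 3 - poly z t ^ 3) = t * b"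
    using sec_poly_eq[OF sec, of t] by (simp add: b_def algebra_simps)
  have "plane_form d k f \<zeta> (poly x t) (poly y t) (poly z t) = (\<Sum>j\<le>k. coeff_form d f j ?P * (t * b) ^ j * (Z * b) ^ (k - j))"
    unfolding plane_form_def a b_def[symmetric] Z_def[symmetric] ..
  also have "\<dots> = (\<Sum>j\<le>k. (Z * b) ^ k * (coeff_form d f j ?P * (t / Z) ^ j))"
  proof (intro sum.cong refl)
    fix j assume "j \<in> {..k}"
    then have "(Z * b) ^ k = (Z * b) ^ j * (Z * b) ^ (k - j)" by (simp add: power_add[symmetric])
    moreover have "t * b = (Z * b) * (t / Z)" using Z by simp
    then have "(t * b) ^ j = (Z * b) ^ j * (t / Z) ^ j" by (simp only: power_mult_distrib)
    ultimately show "coeff_form d f j ?P * (t * b) ^ j * (Z * b) ^ (k - j) = (Z * b) ^ k * (coeff_form d f j ?P * (t / Z) ^ j)"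
      by simp
  qed
  also have "\<dots> = 0" using 0 by (simp add: sum_distrib_left[symmetric])
  finally show ?thesis .
qed

lemma coeff_form_poly:
  assumes "\<And>v. degree (X v) \<le> 1"
  shows "\<exists>q. degree q \<le> d \<and> (\<forall>s. coeff_form d f j (\<lambda>v. poly (X v) s) = poly q s)"
proof -
  define q where "q = (\<Sum>m\<in>mons d. [:f (m, j):] * mon m X)"
  have "degree (mon m X) \<le> monom_degree m" for m
  proof -
    have "degree (X v ^ n) \<le> n" for v n
      using degree_power_le[of "X v" n] assms[of v] by (metis le_trans mult_le_mono1 nat_mult_1)
    then have "degree (mon m X) \<le> (\<Sum>v\<in>Poly_Mapping.keys m. Poly_Mapping.lookup m v)"
      unfolding mon_def by (intro order_trans[OF degree_prod_sum_le] sum_mono) auto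
    then show ?thesis by (simp add: monom_degree_def)
  qed
  then have "degree q \<le> d" unfolding q_def
    by (intro degree_sum_le finite_mons) (auto simp: mons_def intro: order_trans[OF degree_smult_le])
  moreover have "coeff_form d f j (\<lambda>v. poly (X v) s) = poly q s" for s
  proof -
    have "rhom (\<lambda>p. poly p s)" by (simp add: rhom_def)
    then show ?thesis by (simp add: coeff_form_def q_def poly_sum rhom_mon[where h = "\<lambda>p. poly p s"])
  qed
  ultimately show ?thesis by blast
qed

lemma plane_form_poly:
  "\<exists>q. degree q \<le> d + 3 * k \<and> (\<forall>w. plane_form d k f \<zeta> v 1 w = poly q w)"
proof -
  define X where "X i = (if i = i0 then [:v:] else if i = i1 then 1 else if i = i2 then T else [:\<zeta> i * (v - c i):])" for i
  have X: "degree (X i) \<le> 1" "cone_point \<zeta> v 1 w = (\<lambda>i. poly (X i) w)" for i w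
    by (auto simp: X_def cone_point_def)
  have "\<forall>j. \<exists>q. degree q \<le> d \<and> (\<forall>s. coeff_form d f j (\<lambda>v. poly (X v) s) = poly q s)"
    using coeff_form_poly[of X d f] X(1) by blast
  then obtain Q where Q: "\<And>j. degree (Q j) \<le> d" "\<And>j s. coeff_form d f j (\<lambda>v. poly (X v) s) = poly (Q j) s" by metis
  let ?Z = "\<Prod>j\<in>J. \<zeta> j"
  define q where "q = (\<Sum>j\<le>k. Q j * (- ([:v^3:] - T^3)) ^ j * ([:?Z:] * (1 - T^3)) ^ (k - j))"
  have d3: "degree (- ([:v^3:] - T^3)) \<le> 3" "degree ([:?Z:] * (1 - T^3)) \<le> 3"
    by (auto intro!: degree_diff_le order_trans[OF degree_smult_le] simp: degree_power_eq)
  have dp: "degree (p ^ n) \<le> 3 * n" if "degree p \<le> 3" for p :: "complex poly" and n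
    using degree_power_le[of p n] mult_le_mono1[OF that, of n] by linarith
  have "degree q \<le> d + 3 * k"
    unfolding q_def
  proof (rule degree_sum_le)
    fix j assume "j \<in> {..k}"
    then have "d + 3 * k = d + 3 * j + 3 * (k - j)" by simp
    then show "degree (Q j * (- ([:v^3:] - T^3)) ^ j * ([:?Z:] * (1 - T^3)) ^ (k - j)) \<le> d + 3 * k"
      using degree_mult_le_add[OF degree_mult_le_add[OF Q(1) dp[OF d3(1)]] dp[OF d3(2)]] by metis
  qed auto
  moreover have "plane_form d k f \<zeta> v 1 w = poly q w" for w
    by (simp add: plane_form_def X(2) Q(2) q_def poly_sum)
  ultimately show ?thesis by blast
qed

text \<open>The line x = v y of the plane meets the section in e points. Normalised to y = 1 they
  have distinct third coordinates, and a polynomial of degree at most d + 3 k in this coordinate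
  vanishes at all of them.\<close>

lemma plane_form_vanishes:
  assumes sec: "smooth_section e x y z" and e: "e > d + 3 * k" and \<zeta>: "\<And>j. j \<in> J \<Longrightarrow> \<zeta> j \<noteq> 0"
    and van: "beval (bimons d k) (\<lambda>a. [:a:]) f (base_sec x y z \<zeta>) T = 0"
    and v: "v ^ 3 \<noteq> 1" "finite {s. poly x s = v * poly y s}" "card {s. poly x s = v * poly y s} = e"
  shows "plane_form d k f \<zeta> v 1 w = 0"
proof -
  let ?R = "{s. poly x s = v * poly y s}"
  let ?w = "\<lambda>s. poly z s / poly y s"
  have y0: "poly y s \<noteq> 0" if "s \<in> ?R" for s
    using sec_xy[OF sec, of s] that by auto
  have eq: "v^3 - ?w s ^ 3 + s * (1 - ?w s ^ 3) = 0" if s: "s \<in> ?R" for s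
  proof -
    have "poly y s ^ 3 * (v^3 - ?w s ^ 3 + s * (1 - ?w s ^ 3)) = (v * poly y s)^3 + s * poly y s ^ 3 - (1 + s) * poly z s ^ 3"
      using y0[OF s] by (simp add: power_mult_distrib power_divide field_simps)
    also have "\<dots> = 0" using sec_poly_eq[OF sec, of s] s by simp
    finally show ?thesis using y0[OF s] by simp
  qed
  \<comment> \<open>A point (v, 1, w) lies on only one cubic of the pencil unless it is a base
    point, which v^3 \<noteq> 1 excludes; so w determines s.\<close>
  have "inj_on ?w ?R"
  proof (rule inj_onI)
    fix s s' assume s: "s \<in> ?R" "s' \<in> ?R" and w: "?w s = ?w s'"
    have e2: "v^3 - ?w s ^ 3 + s' * (1 - ?w s ^ 3) = 0" using eq[OF s(2)] unfolding w .
    have "(s - s') * (1 - ?w s ^ 3) = (v^3 - ?w s ^ 3 + s * (1 - ?w s ^ 3)) - (v^3 - ?w s ^ 3 + s' * (1 - ?w s ^ 3))"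
      by (simp only: left_diff_distrib) simp
    then have "(s - s') * (1 - ?w s ^ 3) = 0" unfolding e2 eq[OF s(1)] by simp
    moreover have "1 - ?w s ^ 3 \<noteq> 0"
    proof
      assume "1 - ?w s ^ 3 = 0"
      then show False using eq[OF s(1)] v(1) by (metis add.right_neutral eq_iff_diff_eq_0 mult_zero_right)
    qed
    ultimately show "s = s'" by simp
  qed
  then have card: "card (?w ` ?R) = e" using v(3) by (simp add: card_image)
  obtain q where q: "degree q \<le> d + 3 * k" "\<And>w. plane_form d k f \<zeta> v 1 w = poly q w"
    using plane_form_poly by blast
  have "q = 0"
  proof (rule poly_eq_0_of_many_roots[of "?w ` ?R"])
    show "finite (?w ` ?R)" using v(2) by simp
    show "degree q < card (?w ` ?R)" using card e q(1) by simp
    fix r assume "r \<in> ?w ` ?R"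
    then obtain s where s: "s \<in> ?R" "r = ?w s" by blast
    have "plane_form d k f \<zeta> (poly y s * v) (poly y s * 1) (poly y s * ?w s) = 0"
      using plane_form_on_section[OF sec \<zeta> van, of s] s y0[OF s(1)] by (simp add: mult.commute)
    then have "poly y s ^ (d + 3 * k) * plane_form d k f \<zeta> v 1 (?w s) = 0"
      unfolding plane_form_scale .
    then show "poly q r = 0" using y0[OF s(1)] s(2) q(2) by simp
  qed
  then show ?thesis using q(2) by simp
qed

section \<open>Elimination of the pencil parameter on the whole space\<close>

definition F1v :: "('n \<Rightarrow> complex) \<Rightarrow> complex" where
  "F1v x = (x i0 ^ 3 - x i2 ^ 3) * (\<Prod>j\<in>J. x i0 - c j * x i1)"

definition F2v :: "('n \<Rightarrow> complex) \<Rightarrow> complex" where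
  "F2v x = (x i1 ^ 3 - x i2 ^ 3) * (\<Prod>j\<in>J. x j)"

text \<open>The form at t = -F1 / F2 with denominators cleared; equivalently, up to sign, the
  resultant in t with F1 + t F2.\<close>

definition root_form :: "nat \<Rightarrow> nat \<Rightarrow> ('n monom \<times> nat \<Rightarrow> complex) \<Rightarrow> ('n \<Rightarrow> complex) \<Rightarrow> complex" where
  "root_form d k f x = (\<Sum>j\<le>k. coeff_form d f j x * (- F1v x) ^ j * F2v x ^ (k - j))"

lemma hform_Fv: "hform CARD('n) F1v" "hform CARD('n) F2v"
  using hform_evalp[OF homogeneous_F(1)] hform_evalp[OF homogeneous_F(2)]
  unfolding evalp_F1[OF rhom_id] evalp_F2[OF rhom_id] by (simp_all add: F1v_def[abs_def] F2v_def[abs_def])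

lemma hform_coeff_form: "hform d (coeff_form d f j)"
  unfolding coeff_form_def[abs_def] by (rule hform_of_coeffs)

lemma line_poly_root_form: "line_poly (root_form d k f)"
  unfolding root_form_def[abs_def]
  by (intro line_poly_sum line_poly_mult line_poly_power line_poly_uminus line_poly_hform[OF hform_coeff_form]
      line_poly_hform[OF hform_Fv(1)] line_poly_hform[OF hform_Fv(2)])

text \<open>F1 does not involve the coordinate j and F2 is linear in it, so the degree in it is at
  most d + k.\<close>

lemma root_form_poly:
  assumes j: "j \<in> J"
  shows "\<exists>q. degree q \<le> d + k \<and> (\<forall>s. root_form d k f (x(j := s)) = poly q s)"
proof -
  define X where "X v = (if v = j then T else [:x v:])" for v
  have X: "degree (X v) \<le> 1" "x(j := s) = (\<lambda>v. poly (X v) s)" for v s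
    by (auto simp: X_def)
  have "\<forall>i. \<exists>q. degree q \<le> d \<and> (\<forall>s. coeff_form d f i (\<lambda>v. poly (X v) s) = poly q s)"
    using coeff_form_poly[of X d f] X(1) by blast
  then obtain Q where Q: "\<And>i. degree (Q i) \<le> d" "\<And>i s. coeff_form d f i (\<lambda>v. poly (X v) s) = poly (Q i) s" by metis
  define L where "L = smult ((x i1 ^ 3 - x i2 ^ 3) * (\<Prod>i\<in>J - {j}. x i)) T"
  have jn: "j \<noteq> i0" "j \<noteq> i1" "j \<noteq> i2" using j by (auto simp: in_J)
  have F1: "F1v (x(j := s)) = F1v x" for s using jn by (simp add: F1v_def)
  have F2: "F2v (x(j := s)) = poly L s" for s
  proof -
    have "(\<Prod>i\<in>J. (x(j := s)) i) = s * (\<Prod>i\<in>J - {j}. x i)"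
      using j by (subst prod.remove[of J j]) auto
    then show ?thesis unfolding F2v_def using jn by (simp add: L_def)
  qed
  have dL: "degree (L ^ n) \<le> n" for n
  proof -
    have "degree L \<le> 1" unfolding L_def by (rule order_trans[OF degree_smult_le]) simp
    then show ?thesis using degree_power_le[of L n] mult_le_mono1[of "degree L" 1 n] by linarith
  qed
  define q where "q = (\<Sum>i\<le>k. Q i * [:(- F1v x) ^ i:] * L ^ (k - i))"
  have "degree q \<le> d + k" unfolding q_def
  proof (rule degree_sum_le)
    fix i assume "i \<in> {..k}"
    have "degree (Q i * [:(- F1v x) ^ i:] * L ^ (k - i)) \<le> (d + 0) + (k - i)"
      by (intro degree_mult_le_add Q dL) auto
    then show "degree (Q i * [:(- F1v x) ^ i:] * L ^ (k - i)) \<le> d + k" by simp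
  qed auto
  moreover have "root_form d k f (x(j := s)) = poly q s" for s
    unfolding root_form_def F1 F2 unfolding X(2) Q(2) by (simp add: q_def poly_sum mult_ac)
  ultimately show ?thesis by blast
qed

text \<open>For fixed x, y, z with all x - c_j y nonzero, the point lies on the plane with \<zeta>_j
  = w_j / (x - c_j y). The values \<zeta>_j in the grid give d + k + 1 values of each w_j where the
  form vanishes, hence it vanishes for all w. The excluded ratios x / y are recovered by cancelling
  a product of linear forms.\<close>

lemma root_form_vanishes:
  assumes sec: "smooth_section e x y z" and e: "e > d + 3 * k"
    and van: "\<And>\<zeta>. \<zeta> \<in> grid (d + k) \<Longrightarrow> beval (bimons d k) (\<lambda>a. [:a:]) f (base_sec x y z \<zeta>) T = 0"
  shows "root_form d k f p = 0"
proof -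
  have e1: "e \<ge> 1" using e by simp
  obtain B where B: "finite B" "\<And>v. v \<notin> B \<Longrightarrow> finite {s. poly x s = v * poly y s} \<and> card {s. poly x s = v * poly y s} = e"
    using many_preimages[of x y e] sec_xy[OF sec] sec_degree(1)[OF sec] sec_y_nz[OF sec] e1 by auto
  define bad where "bad = B \<union> {v. v ^ 3 = 1} \<union> c ` J"
  have fbad: "finite bad" using B(1) finite_roots_unity[of 3] by (simp add: bad_def)
  have main: "root_form d k f p = 0" if p: "p i1 \<noteq> 0" "p i0 / p i1 \<notin> bad" for p
  proof -
    define v where "v = p i0 / p i1"
    define \<beta> where "\<beta> j = p i0 - c j * p i1" for j
    have \<beta>: "\<beta> j \<noteq> 0" if "j \<in> J" for j
    proof
      assume "\<beta> j = 0"
      then have "v = c j" using p by (simp add: v_def \<beta>_def field_simps)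
      then show False using p that by (auto simp: v_def bad_def)
    qed
    define G where "G j = (\<lambda>s. s * \<beta> j) ` (of_nat ` {1..Suc (d + k)})" for j
    show ?thesis
    proof (rule vanishing_on_grid[OF finite_J root_form_poly])
      fix j assume j: "j \<in> J"
      have "inj_on (\<lambda>s. s * \<beta> j) (of_nat ` {1..Suc (d + k)})" using \<beta>[OF j] by (auto simp: inj_on_def)
      moreover have "card (of_nat ` {1..Suc (d + k)} :: complex set) = Suc (d + k)"
        by (subst card_image) (auto simp: inj_on_def)
      ultimately show "finite (G j) \<and> card (G j) > d + k" by (simp add: G_def card_image)
    next
      fix q assume q: "\<And>v. v \<notin> J \<Longrightarrow> q v = p v" "\<And>j. j \<in> J \<Longrightarrow> q j \<in> G j"
      have qi: "q i0 = p i0" "q i1 = p i1" "q i2 = p i2" using q(1) by (auto simp: in_J)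
      define \<zeta> where "\<zeta> = restrict (\<lambda>j. q j / \<beta> j) J"
      have \<zeta>q: "q j = \<zeta> j * \<beta> j" if "j \<in> J" for j using \<beta> that by (simp add: \<zeta>_def)
      have \<zeta>: "\<zeta> \<in> grid (d + k)"
        unfolding grid_def \<zeta>_def
      proof (rule restrict_PiE_iff[THEN iffD2], rule ballI)
        fix j assume "j \<in> J"
        then show "q j / \<beta> j \<in> of_nat ` {1..Suc (d + k)}" using q(2)[of j] \<beta>[of j] by (auto simp: G_def)
      qed
      have qc: "q = cone_point \<zeta> (p i0) (p i1) (p i2)"
      proof
        fix i show "q i = cone_point \<zeta> (p i0) (p i1) (p i2) i"
          using qi \<zeta>q[of i] by (cases "i \<in> J") (auto simp: cone_point_def in_J \<beta>_def)
      qed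
      define bp where "bp = (\<Prod>j\<in>J. \<beta> j)"
      have F1: "- F1v q = bp * (- (p i0 ^ 3 - p i2 ^ 3))"
        by (simp add: F1v_def qi bp_def \<beta>_def algebra_simps)
      have "(\<Prod>j\<in>J. q j) = (\<Prod>j\<in>J. \<zeta> j) * bp"
        unfolding bp_def prod.distrib[symmetric] by (intro prod.cong refl \<zeta>q)
      then have F2: "F2v q = bp * ((\<Prod>j\<in>J. \<zeta> j) * (p i1 ^ 3 - p i2 ^ 3))"
        by (simp add: F2v_def qi algebra_simps)
      have "root_form d k f q = bp ^ k * plane_form d k f \<zeta> (p i0) (p i1) (p i2)"
        unfolding root_form_def plane_form_def sum_distrib_left
      proof (intro sum.cong refl)
        fix j assume "j \<in> {..k}"
        then have k: "bp ^ k = bp ^ j * bp ^ (k - j)" by (simp add: power_add[symmetric])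
        show "coeff_form d f j q * (- F1v q) ^ j * F2v q ^ (k - j) = bp ^ k *
          (coeff_form d f j (cone_point \<zeta> (p i0) (p i1) (p i2)) * (- (p i0 ^ 3 - p i2 ^ 3)) ^ j * ((\<Prod>j\<in>J. \<zeta> j) * (p i1 ^ 3 - p i2 ^ 3)) ^ (k - j))"
          unfolding F1 F2 k power_mult_distrib[of bp] qc[symmetric] by (simp only: mult_ac)
      qed
      also have "plane_form d k f \<zeta> (p i0) (p i1) (p i2) = plane_form d k f \<zeta> (p i1 * v) (p i1 * 1) (p i1 * (p i2 / p i1))"
        using p(1) by (simp add: v_def)
      also have "plane_form d k f \<zeta> (p i1 * v) (p i1 * 1) (p i1 * (p i2 / p i1)) = 0"
      proof -
        have "v \<notin> B" "v ^ 3 \<noteq> 1" using p(2) by (auto simp: bad_def v_def)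
        then have "plane_form d k f \<zeta> v 1 (p i2 / p i1) = 0"
          using plane_form_vanishes[OF sec e grid_nonzero[OF \<zeta>] van[OF \<zeta>]] B(2) by blast
        then show ?thesis unfolding plane_form_scale by simp
      qed
      finally show "root_form d k f q = 0" by simp
    qed
  qed
  \<comment> \<open>Vanishes exactly where the preceding argument does not apply; it is not
    identically zero because the excluded ratios form a finite set.\<close>
  define H where "H p = p i1 * (\<Prod>v\<in>bad. p i0 - v * p i1)" for p :: "'n \<Rightarrow> complex"
  obtain v where v: "v \<notin> bad" using fbad infinite_UNIV_char_0 ex_new_if_finite by metis
  show ?thesis
  proof (rule line_poly_cancel_UNIV[where F = "root_form d k f" and H = H and q = p and p = "\<lambda>i. if i = i0 then v else 1"])
    show "line_poly H" unfolding H_def[abs_def]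
      by (intro line_poly_mult line_poly_prod line_poly_diff line_poly_const line_poly_var)
    show "H (\<lambda>i. if i = i0 then v else 1) \<noteq> 0" using dist v fbad by (auto simp: H_def)
    show "root_form d k f p * H p = 0" for p
    proof (cases "p i1 \<noteq> 0 \<and> p i0 / p i1 \<notin> bad")
      case False
      then have "H p = 0"
      proof (cases "p i1 = 0")
        case False
        then have "p i0 / p i1 \<in> bad" using \<open>\<not> (p i1 \<noteq> 0 \<and> p i0 / p i1 \<notin> bad)\<close> by simp
        then have "(\<Prod>v\<in>bad. p i0 - v * p i1) = 0" using fbad False
          by (intro prod_zero bexI[of _ "p i0 / p i1"]) auto
        then show ?thesis by (simp add: H_def)
      qed (simp add: H_def)
      then show ?thesis by simp
    qed (use main in simp)
  qed (rule line_poly_root_form)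
qed

text \<open>The components of F2 = 0; the triple (a, c, b) stands for x_a = c x_b. For x_j = 0 the
  third entry is a placeholder, taken different from j.\<close>

definition hyperplanes :: "('n \<times> complex \<times> 'n) set" where
  "hyperplanes = (\<lambda>w. (i1, w, i2)) ` {w. w ^ 3 = 1} \<union> (\<lambda>j. (j, 0, i1)) ` J"

lemma prod_hyperplanes: "(\<Prod>(a, w, b)\<in>hyperplanes. x a - w * x b) = F2v x"
  and card_hyperplanes: "card hyperplanes = CARD('n)"
  and finite_hyperplanes: "finite hyperplanes"
proof -
  let ?R = "{w::complex. w ^ 3 = 1}"
  have R: "finite ?R" "card ?R = 3" using finite_roots_unity[of 3] card_roots_unity_eq[of 3] by auto
  have disj: "(\<lambda>w. (i1, w, i2)) ` ?R \<inter> (\<lambda>j. (j, 0::complex, i1)) ` J = {}" by (auto simp: in_J)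
  have inj: "inj_on (\<lambda>w. (i1, w, i2)) ?R" "inj_on (\<lambda>j. (j, 0::complex, i1)) J" by (auto simp: inj_on_def)
  show "finite hyperplanes" using R by (simp add: hyperplanes_def)
  show "card hyperplanes = CARD('n)"
    unfolding hyperplanes_def using R disj inj by (subst card_Un_disjoint) (auto simp: card_image card_UNIV_J)
  have cub: "(\<Prod>w\<in>?R. u - w * v) = u ^ 3 - v ^ 3" for u v :: complex
  proof -
    define p where "p = [:-1, 0, 0, 1 :: complex:]"
    have root: "poly p w = w ^ 3 - 1" for w by (simp add: p_def power3_eq_cube)
    have "rsquarefree p"
      unfolding rsquarefree_roots
    proof (intro allI notI)
      fix w assume A: "poly p w = 0 \<and> poly (pderiv p) w = 0"
      then have "w = 0" by (simp add: p_def pderiv_pCons)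
      then show False using A root[of w] by simp
    qed
    moreover have lc: "lead_coeff p = 1" by (simp add: p_def)
    ultimately have P: "(\<Prod>w\<in>?R. [:- w, 1:]) = p"
      using complex_poly_decompose_rsquarefree[of p] unfolding root right_minus_eq lc by simp
    show ?thesis
    proof (cases "v = 0")
      case True
      then show ?thesis using R by simp
    next
      case False
      have "(\<Prod>w\<in>?R. u / v - w) = (u / v) ^ 3 - 1"
        using arg_cong[OF P, of "\<lambda>p. poly p (u / v)"] unfolding root by (simp add: poly_prod)
      moreover have "(\<Prod>w\<in>?R. u - w * v) = (\<Prod>w\<in>?R. v * (u / v - w))"
        using False by (intro prod.cong) (auto simp: field_simps)
      moreover have "\<dots> = v ^ 3 * (\<Prod>w\<in>?R. u / v - w)" using R by (simp add: prod.distrib)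
      moreover have "v ^ 3 * ((u / v) ^ 3 - 1) = u ^ 3 - v ^ 3" using False by (simp add: power_divide field_simps)
      ultimately show ?thesis by simp
    qed
  qed
  show "(\<Prod>(a, w, b)\<in>hyperplanes. x a - w * x b) = F2v x"
    unfolding hyperplanes_def using R disj inj
    by (subst prod.union_disjoint) (auto simp: prod.reindex cub F2v_def)
qed

text \<open>Each component of F2 = 0 has a point that lies on no other component and not on F1 = 0.
  So the components are distinct and F1 and F2 share none.\<close>

lemma hyperplane_points:
  assumes "(a, w, b) \<in> hyperplanes"
  shows "\<exists>p. p a = w * p b \<and> F1v p \<noteq> 0 \<and> (\<forall>(a', w', b')\<in>hyperplanes - {(a, w, b)}. p a' - w' * p b' \<noteq> 0)"
proof -
  \<comment> \<open>Values of x for which F1 vanishes when y = v: the cube roots of 1 are for z = 1,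
    the value 0 for z = 0, the remaining ones for the linear factors.\<close>
  define bad where "bad v = {u::complex. u ^ 3 = 1} \<union> (\<lambda>j. c j * v) ` J \<union> {0}" for v
  have "finite (bad v)" for v unfolding bad_def using finite_roots_unity[of 3] by simp
  then have "\<exists>u. u \<notin> bad v" for v using infinite_UNIV_char_0 ex_new_if_finite by metis
  then obtain U where U: "\<And>v. U v \<notin> bad v" by metis
  have F1: "F1v p \<noteq> 0" if "p i0 = U (p i1)" "p i2 = 0 \<or> p i2 = 1" for p
    using U[of "p i1"] that by (auto simp: F1v_def bad_def)
  consider "a = i1" "b = i2" "w ^ 3 = 1" | j where "j \<in> J" "a = j" "b = i1" "w = 0"
    using assms by (auto simp: hyperplanes_def)
  then show ?thesis
  proof cases
    case 1
    define p where "p i = (if i = i0 then U w else if i = i1 then w else 1)" for i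
    have "p a = w * p b" "p i0 = U (p i1)" "p i2 = 1" using 1 dist by (auto simp: p_def)
    moreover have "\<forall>(a', w', b')\<in>hyperplanes - {(a, w, b)}. p a' - w' * p b' \<noteq> 0"
      using 1 dist by (auto simp: hyperplanes_def p_def in_J)
    ultimately show ?thesis using F1 by blast
  next
    case 2
    define p where "p i = (if i = i0 then U 1 else if i = i2 \<or> i = j then 0 else 1)" for i
    have "p a = w * p b" "p i0 = U (p i1)" "p i2 = 0" using 2 dist by (auto simp: p_def in_J)
    moreover have "\<forall>(a', w', b')\<in>hyperplanes - {(a, w, b)}. p a' - w' * p b' \<noteq> 0"
      using 2 dist by (auto simp: hyperplanes_def p_def in_J)
    ultimately show ?thesis using F1 by blast
  qed
qed

text \<open>On each component of F2 = 0 the power of F1 is not identically zero and can be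
  cancelled; so F vanishes on all components and is divisible by their product.\<close>

lemma divide_by_F2:
  assumes F: "hform d F" and van: "\<And>x. F2v x = 0 \<Longrightarrow> F x * F1v x ^ l = 0"
  shows "\<exists>G. hform_sub d CARD('n) G \<and> (\<forall>x. F x = F2v x * G x)"
proof -
  have lp: "line_poly F" "line_poly (\<lambda>x. F1v x ^ l)"
    by (intro line_poly_power line_poly_hform[OF F] line_poly_hform[OF hform_Fv(1)])+
  have "\<exists>G. hform_sub d (card hyperplanes) G \<and> (\<forall>x. F x = (\<Prod>(a, c, b)\<in>hyperplanes. x a - c * x b) * G x)"
  proof (rule hform_divide_hyperplanes[OF finite_hyperplanes _ F])
    fix a w b assume h: "(a, w, b) \<in> hyperplanes"
    show "a \<noteq> b" using h dist by (auto simp: hyperplanes_def in_J)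
    obtain p where p: "p a = w * p b" "F1v p \<noteq> 0"
      "\<forall>(a', w', b')\<in>hyperplanes - {(a, w, b)}. p a' - w' * p b' \<noteq> 0"
      using hyperplane_points[OF h] by blast
    then show "\<exists>p. p a = w * p b \<and> (\<forall>(a', w', b')\<in>hyperplanes - {(a, w, b)}. p a' - w' * p b' \<noteq> 0)" by blast
    fix x assume x: "x a = w * x b"
    show "F x = 0"
    proof (rule line_poly_cancel_hyperplane[where F = F and H = "\<lambda>x. F1v x ^ l" and q = x and p = p and a = a and b = b and c = w])
      fix y assume "y a = w * y b"
      then have "(\<Prod>(a, w, b)\<in>hyperplanes. y a - w * y b) = 0"
        using h finite_hyperplanes by (intro prod_zero bexI[of _ "(a, w, b)"]) auto
      then show "F y * F1v y ^ l = 0" using van prod_hyperplanes by simp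
    qed (use lp p x in auto)
  qed
  then show ?thesis by (simp add: card_hyperplanes prod_hyperplanes)
qed

lemma beval_p0: "beval (bimons CARD('n) 1) (\<lambda>c. c) p0 x t = F1v x + t * F2v x"
proof -
  have ev: "(\<Sum>m\<in>mons CARD('n). Poly_Mapping.lookup P m * mon m x) = evalp (\<lambda>c. c) P x" if "homogeneous CARD('n) P" for P :: "'n cpoly"
    by (rule evalp_superset[OF rhom_id, symmetric]) (use that in \<open>auto simp: homogeneous_def mons_def finite_monom_degree\<close>)
  have "beval (bimons CARD('n) 1) (\<lambda>c. c) p0 x t = (\<Sum>j\<le>1. coeff_form CARD('n) p0 j x * t ^ j)"
    by (rule beval_coeff_form)
  also have "\<dots> = evalp (\<lambda>c. c) F1 x + t * evalp (\<lambda>c. c) F2 x"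
    by (simp add: coeff_form_def p0_def ev[OF homogeneous_F(1)] ev[OF homogeneous_F(2)])
  finally show ?thesis by (simp add: evalp_F1[OF rhom_id] evalp_F2[OF rhom_id] F1v_def F2v_def)
qed

text \<open>The vanishing of \<open>root_form\<close> is the hypothesis of division by F1 + t F2.
  The resulting quotient functions are forms, whose coefficients are collected in q; equality of
  functions gives equality of coefficients.\<close>

lemma multiple_of_special_pencil:
  assumes sec: "smooth_section e x y z" and e: "e > d + 3 * k"
    and van: "\<And>\<zeta>. \<zeta> \<in> grid (d + k) \<Longrightarrow> beval (bimons d k) (\<lambda>a. [:a:]) f (base_sec x y z \<zeta>) T = 0"
  shows "\<exists>q. \<forall>b\<in>bimons d k. f b = pmul CARD('n) d k p0 q b"
proof -
  let ?N = "CARD('n)"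
  have "\<exists>p. F2v p \<noteq> 0"
    by (intro exI[of _ "\<lambda>i. if i = i2 then 0 else 1"]) (use dist in \<open>auto simp: F2v_def in_J\<close>)
  then obtain p2 where p2: "F2v p2 \<noteq> 0" by blast
  have rf: "(\<Sum>j\<le>k. coeff_form d f j x * (- F1v x) ^ j * F2v x ^ (k - j)) = 0" for x
    using root_form_vanishes[OF sec e van] by (simp add: root_form_def)
  have "\<exists>G. (\<forall>j. hform_sub d ?N (G j)) \<and> (\<forall>j\<le>k. \<forall>x. coeff_form d f j x =
      (if j < k then F1v x * G j x else 0) + (if j > 0 then F2v x * G (j - 1) x else 0))"
  proof (rule divide_by_linear_pencil[OF hform_Fv p2])
    show "\<exists>G. hform_sub d ?N G \<and> (\<forall>x. F x = F2v x * G x)"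
      if "hform d F" "\<And>x. F2v x = 0 \<Longrightarrow> F x * F1v x ^ l = 0" for F l
      using that by (rule divide_by_F2)
  qed (simp_all add: hform_coeff_form rf)
  then obtain G where G: "\<And>j. hform_sub d ?N (G j)" "\<And>j x. j \<le> k \<Longrightarrow> coeff_form d f j x =
      (if j < k then F1v x * G j x else 0) + (if j > 0 then F2v x * G (j - 1) x else 0)"
    by blast
  have "\<exists>a. \<forall>x. G j x = (if ?N \<le> d then \<Sum>m\<in>mons (d - ?N). a m * mon m x else 0)" for j
    using G(1)[of j] hform_coeffs[of "d - ?N" "G j"] by (auto simp: hform_sub_def)
  then obtain a where a: "\<And>j x. G j x = (if ?N \<le> d then \<Sum>m\<in>mons (d - ?N). a j m * mon m x else 0)" by metis
  define q where "q c = a (snd c) (fst c)" for c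
  have q: "beval (cobimons ?N d k) (\<lambda>c. c) q x t = (\<Sum>j<k. G j x * t ^ j)" for x t
  proof (cases "?N \<le> d")
    case True
    then have "(\<Sum>j<k. G j x * t ^ j) = (\<Sum>j<k. \<Sum>m\<in>mons (d - ?N). a j m * mon m x * t ^ j)"
      by (simp add: a sum_distrib_right)
    also have "\<dots> = (\<Sum>m\<in>mons (d - ?N). \<Sum>j<k. a j m * mon m x * t ^ j)" by (rule sum.swap)
    also have "\<dots> = beval (cobimons ?N d k) (\<lambda>c. c) q x t"
      using True by (simp add: beval_def cobimons_def q_def bmon_def sum.cartesian_product case_prod_unfold mult.assoc)
    finally show ?thesis by simp
  next
    case False
    then show ?thesis by (simp add: beval_def cobimons_def a)
  qed
  have eq: "beval (bimons d k) (\<lambda>c. c) f x t = beval (bimons d k) (\<lambda>c. c) (pmul ?N d k p0 q) x t" for x t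
  proof -
    have "beval (bimons d k) (\<lambda>c. c) f x t = (\<Sum>j\<le>k. (if j < k then F1v x * G j x else 0) * t ^ j) +
        (\<Sum>j\<le>k. (if j > 0 then F2v x * G (j - 1) x else 0) * t ^ j)"
      unfolding beval_coeff_form sum.distrib[symmetric] by (intro sum.cong refl) (simp add: G(2) algebra_simps)
    also have "(\<Sum>j\<le>k. (if j < k then F1v x * G j x else 0) * t ^ j) = F1v x * (\<Sum>j<k. G j x * t ^ j)"
      unfolding sum_distrib_left by (rule sum.mono_neutral_cong_right) auto
    also have "(\<Sum>j\<le>k. (if j > 0 then F2v x * G (j - 1) x else 0) * t ^ j) = t * F2v x * (\<Sum>j<k. G j x * t ^ j)"
    proof (cases k)
      case (Suc n)
      have "(\<Sum>j\<le>Suc n. (if j > 0 then F2v x * G (j - 1) x else 0) * t ^ j) = (\<Sum>j\<le>n. F2v x * G j x * t ^ Suc j)"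
        by (simp add: sum.atMost_Suc_shift del: sum.atMost_Suc)
      then show ?thesis unfolding Suc by (simp add: sum_distrib_left lessThan_Suc_atMost mult_ac del: sum.lessThan_Suc sum.atMost_Suc)
    qed simp
    finally have "beval (bimons d k) (\<lambda>c. c) f x t = (F1v x + t * F2v x) * (\<Sum>j<k. G j x * t ^ j)"
      by (simp add: algebra_simps)
    then show ?thesis unfolding beval_pmul[OF rhom_id] beval_p0 q .
  qed
  have "f b - pmul ?N d k p0 q b = 0" if "b \<in> bimons d k" for b
  proof (rule beval_eq_0[OF _ that, of "\<lambda>b. f b - pmul ?N d k p0 q b"])
    show "beval (bimons d k) (\<lambda>c. c) (\<lambda>b. f b - pmul ?N d k p0 q b) x t = 0" for x t
      using eq[of x t] by (simp add: beval_def left_diff_distrib sum_subtractf)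
  qed
  then show ?thesis by auto
qed

definition deformation :: "('n monom \<times> nat \<Rightarrow> complex) \<Rightarrow> 'n monom \<times> nat \<Rightarrow> complex fps" where
  "deformation g a = fps_const (p0 a) + fps_X * fps_const (g a)"

lemma beval_bimons_1:
  "beval (bimons N 1) h p X t = (\<Sum>m\<in>mons N. (h (p (m, 0)) + h (p (m, 1)) * t) * mon m X)"
proof -
  have "beval (bimons N 1) h p X t = (\<Sum>m\<in>mons N. \<Sum>j\<le>1. h (p (m, j)) * bmon (m, j) X t)"
    unfolding beval_def bimons_def sum.cartesian_product by (simp add: case_prod_unfold)
  also have "\<dots> = (\<Sum>m\<in>mons N. (h (p (m, 0)) + h (p (m, 1)) * t) * mon m X)"
    by (intro sum.cong refl) (simp add: bmon_def algebra_simps)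
  finally show ?thesis .
qed

text \<open>One lifted section is taken for each \<zeta> in the grid. Their reductions at eps = 0
  are the sections of the special pencil, to which the division result applies.\<close>

lemma deformed_sections:
  assumes sec: "smooth_section e x y z" and e: "e > d + 3 * k" and cJ: "inj_on c J"
    and top: "\<And>j. j \<in> J \<Longrightarrow> coeff (x - smult (c j) y) e \<noteq> 0"
    and nc: "\<And>j s. j \<in> J \<Longrightarrow> \<not> (poly (x - smult (c j) y) s = 0 \<and> poly (T * (y^3 - z^3)) s = 0)"
  shows "\<exists>\<Xi>. finite \<Xi> \<and> (\<forall>X\<in>\<Xi>. (\<exists>v. X v \<noteq> 0) \<and> beval (bimons CARD('n) 1) (\<lambda>a. [:a:]) (deformation g) X [:0, 1:] = 0) \<and>
    (\<forall>f. (\<forall>X\<in>\<Xi>. beval (bimons d k) (\<lambda>a. [:a:]) f X [:0, 1:] = 0) \<longrightarrow>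
       (\<exists>q. \<forall>b\<in>bimons d k. f b = pmul CARD('n) d k (deformation g) q b))"
proof -
  let ?N = "CARD('n)"
  have e1: "e \<ge> 1" using e by simp
  have "\<exists>X. (\<forall>v. slice 0 (X v) = base_sec x y z \<zeta> v) \<and> beval (bimons ?N 1) (\<lambda>a. [:a:]) (deformation g) X [:0, 1:] = 0"
    if \<zeta>: "\<zeta> \<in> grid (d + k)" for \<zeta>
  proof -
    obtain Y where Y: "(\<Sum>m | monom_degree m = CARD('n). (fps_const [:Poly_Mapping.lookup F1 m, Poly_Mapping.lookup F2 m:] +
       fps_X * fps_const [:g (m, 0), g (m, 1):]) * mon m Y) = 0"
     "\<And>v. Y v $ 0 = base_sec x y z \<zeta> v" "\<And>v i. degree (Y v $ i) \<le> e"
      using lifted_section[where \<zeta> = \<zeta> and ?g1.0 = "\<lambda>m. g (m, 0)" and ?g2.0 = "\<lambda>m. g (m, 1)", OF sec e1 cJ top nc grid_nonzero[OF \<zeta>]] by blast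
    have "\<forall>v. \<exists>P. rho P = Y v" using rho_surj[OF Y(3)] by blast
    then obtain X where X: "\<And>v. rho (X v) = Y v" by metis
    have rC: "rho [:a:] = Abs_fps (\<lambda>k. [:a $ k:])" for a
      by (rule fps_ext, rule poly_eqI) (auto simp: coeff_pCons split: nat.splits)
    have rp: "rho [:deformation g a:] = fps_const [:p0 a:] + fps_X * fps_const [:g a:]" for a
      unfolding rC deformation_def by (rule fps_ext) (auto simp: fps_X_mult_nth)
    have rT: "rho [:0, 1:] = fps_const [:0, 1:]"
      by (rule fps_ext, rule poly_eqI) (auto simp: coeff_pCons split: nat.splits)
    have co: "rho [:deformation g (m, 0):] + rho [:deformation g (m, 1):] * fps_const [:0, 1:] =
       fps_const [:Poly_Mapping.lookup F1 m, Poly_Mapping.lookup F2 m:] + fps_X * fps_const [:g (m, 0), g (m, 1):]" for m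
      unfolding rp by (rule fps_ext) (auto simp: fps_X_mult_nth p0_def distrib_right mult.assoc)
    have "rho (beval (bimons ?N 1) (\<lambda>a. [:a:]) (deformation g) X [:0, 1:]) = beval (bimons ?N 1) (\<lambda>a. rho [:a:]) (deformation g) Y (fps_const [:0, 1:])"
      unfolding beval_rhom[OF rhom_rho] rT X ..
    also have "\<dots> = 0"
      unfolding beval_bimons_1 co mons_def by (rule Y(1))
    finally have "rho (beval (bimons ?N 1) (\<lambda>a. [:a:]) (deformation g) X [:0, 1:]) = 0" .
    then have "beval (bimons ?N 1) (\<lambda>a. [:a:]) (deformation g) X [:0, 1:] = 0" by (rule rho_eq_0)
    moreover have "slice 0 (X v) = base_sec x y z \<zeta> v" for v using X Y(2) by (metis rho_nth)
    ultimately show ?thesis by blast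
  qed
  then have "\<forall>\<zeta>\<in>grid (d + k). \<exists>X. (\<forall>v. slice 0 (X v) = base_sec x y z \<zeta> v) \<and> beval (bimons ?N 1) (\<lambda>a. [:a:]) (deformation g) X [:0, 1:] = 0"
    by blast
  from bchoice[OF this] obtain X where X: "\<And>\<zeta> v. \<zeta> \<in> grid (d + k) \<Longrightarrow> slice 0 (X \<zeta> v) = base_sec x y z \<zeta> v"
    "\<And>\<zeta>. \<zeta> \<in> grid (d + k) \<Longrightarrow> beval (bimons ?N 1) (\<lambda>a. [:a:]) (deformation g) (X \<zeta>) [:0, 1:] = 0" by blast
  show ?thesis
  proof (intro exI[of _ "X ` grid (d + k)"] conjI ballI allI impI)
    show "finite (X ` grid (d + k))" using finite_grid by simp
  next
    fix Y assume "Y \<in> X ` grid (d + k)"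
    then obtain \<zeta> where \<zeta>: "\<zeta> \<in> grid (d + k)" "Y = X \<zeta>" by blast
    show "beval (bimons ?N 1) (\<lambda>a. [:a:]) (deformation g) Y [:0, 1:] = 0" using X(2) \<zeta> by simp
    define Z where "Z = (\<Prod>j\<in>J. \<zeta> j)"
    have Z: "Z \<noteq> 0" using grid_nonzero[OF \<zeta>(1)] by (simp add: Z_def)
    \<comment> \<open>The lifted section is nonzero because its reduction has the coordinate y(Z t),
      and Z is nonzero.\<close>
    have "pcompose y [:0, Z:] \<noteq> 0"
      using sec_y_nz[OF sec] Z by (subst pcompose_eq_0_iff) auto
    then have "slice 0 (X \<zeta> i1) \<noteq> 0" using X(1)[OF \<zeta>(1)] by (simp add: base_sec_simps Z_def)
    then show "\<exists>v. Y v \<noteq> 0" using \<zeta> rhom_0[OF rhom_slice0] by metis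
  next
    fix f :: "'n monom \<times> nat \<Rightarrow> complex fps"
    assume van: "\<forall>Y\<in>X ` grid (d + k). beval (bimons d k) (\<lambda>a. [:a:]) f Y [:0, 1:] = 0"
    show "\<exists>q. \<forall>b\<in>bimons d k. f b = pmul ?N d k (deformation g) q b"
      unfolding deformation_def[abs_def]
    proof (rule multiple_of_pencil_fps)
      fix Y assume Y: "Y \<in> X ` grid (d + k)"
      show "beval (bimons ?N 1) (\<lambda>a. [:a:]) (\<lambda>a. fps_const (p0 a) + fps_X * fps_const (g a)) Y [:0, 1:] = 0"
        using X(2) Y by (auto simp: deformation_def[abs_def])
      show "beval (bimons d k) (\<lambda>a. [:a:]) f Y [:0, 1:] = 0" using van Y by blast
    next
      fix f0 assume A: "\<And>Y. Y \<in> X ` grid (d + k) \<Longrightarrow> beval (bimons d k) (\<lambda>a. [:a:]) f0 (\<lambda>v. slice 0 (Y v)) [:0, 1:] = 0"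
      show "\<exists>q0. \<forall>b\<in>bimons d k. f0 b = pmul ?N d k p0 q0 b"
      proof (rule multiple_of_special_pencil[OF sec e])
        fix \<zeta> assume \<zeta>: "\<zeta> \<in> grid (d + k)"
        then show "beval (bimons d k) (\<lambda>a. [:a:]) f0 (base_sec x y z \<zeta>) [:0, 1:] = 0"
          using A[of "X \<zeta>"] X(1)[OF \<zeta>] by simp
      qed
    qed
  qed
qed

end

section \<open>Transfer to generic coefficients\<close>

lemma rhom_fps_to_fls: "rhom (fps_to_fls :: complex fps \<Rightarrow> _)"
  by (simp add: rhom_def fls_times_fps_to_fls)

lemma rhom_map_poly: assumes "rhom h" shows "rhom (map_poly h)"
  unfolding rhom_def
proof (intro conjI allI)
  show "map_poly h 1 = 1" using assms by (simp add: rhom_1)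
  show "map_poly h (x + y) = map_poly h x + map_poly h y" for x y
    by (rule poly_eqI) (simp add: coeff_map_poly rhom_0[OF assms] rhom_add[OF assms])
  show "map_poly h (x * y) = map_poly h x * map_poly h y" for x y
    by (rule poly_eqI) (simp add: coeff_map_poly rhom_0[OF assms] coeff_mult rhom_sum[OF assms] rhom_mult[OF assms])
qed

lemma fls_clear_denominator:
  fixes a :: "complex fls"
  shows "\<exists>n f. fls_X ^ n * a = fps_to_fls f"
proof -
  define n where "n = nat (- fls_subdegree a)"
  have "fls_X ^ n * a = fls_shift (- int n) a"
    by (simp add: fls_X_power_times_conv_shift)
  moreover have "fls_shift (- int n) a = fps_to_fls (fls_regpart (fls_shift (- int n) a))"
    by (rule fls_eqI) (auto simp: n_def)
  ultimately show ?thesis by metis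
qed

text \<open>From power series to Laurent series by clearing denominators.\<close>

lemma multiple_of_pencil_fls:
  fixes p :: "'v::finite monom \<times> nat \<Rightarrow> complex fps"
  assumes fps: "\<And>f. (\<And>X. X \<in> \<Xi> \<Longrightarrow> beval (bimons d k) (\<lambda>a. [:a:]) f X [:0, 1:] = 0) \<Longrightarrow>
       (\<exists>q. \<forall>b\<in>bimons d k. f b = pmul N d k p q b)"
    and van: "\<And>X. X \<in> \<Xi> \<Longrightarrow> beval (bimons d k) (\<lambda>a. [:a:]) f (\<lambda>v. map_poly fps_to_fls (X v)) [:0, 1:] = 0"
  shows "\<exists>q. \<forall>b\<in>bimons d k. f b = pmul N d k (\<lambda>a. fps_to_fls (p a)) q b"
proof -
  let ?S = "bimons d k :: ('v monom \<times> nat) set"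
  note m = rhom_map_poly[OF rhom_fps_to_fls]
  have "\<exists>n f'. \<forall>b\<in>S. fls_X ^ n * f b = fps_to_fls (f' b)" if "finite S" for S
    using that
  proof (induction S rule: finite_induct)
    case (insert b S)
    then obtain n f' where 1: "\<forall>b\<in>S. fls_X ^ n * f b = fps_to_fls (f' b)" by blast
    obtain n' a where 2: "fls_X ^ n' * f b = fps_to_fls a" using fls_clear_denominator by blast
    have X: "fls_X ^ i = fps_to_fls (fps_X ^ i)" for i by (simp add: fps_to_fls_power)
    have "fls_X ^ (n + n') * f b' = fps_to_fls (if b' = b then fps_X ^ n * a else fps_X ^ n' * f' b')" if "b' \<in> insert b S" for b'
    proof (cases "b' = b")
      case True
      have "fls_X ^ (n + n') * f b = fls_X ^ n * (fls_X ^ n' * f b)" by (simp add: power_add mult.assoc)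
      also have "\<dots> = fps_to_fls (fps_X ^ n) * fps_to_fls a" by (simp only: 2) (simp only: X)
      also have "\<dots> = fps_to_fls (fps_X ^ n * a)" by (rule fls_times_fps_to_fls[symmetric])
      finally show ?thesis using True by simp
    next
      case False
      have "fls_X ^ (n + n') * f b' = fls_X ^ n' * (fls_X ^ n * f b')" by (simp add: power_add mult_ac)
      also have "fls_X ^ n * f b' = fps_to_fls (f' b')" using 1 False that by simp
      also have "fls_X ^ n' * fps_to_fls (f' b') = fps_to_fls (fps_X ^ n' * f' b')"
        unfolding X by (rule fls_times_fps_to_fls[symmetric])
      finally show ?thesis using False by simp
    qed
    then show ?case by (intro exI[of _ "n + n'"] exI[of _ "\<lambda>b'. if b' = b then fps_X ^ n * a else fps_X ^ n' * f' b'"]) blast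
  qed simp
  then obtain n f' where f': "\<And>b. b \<in> ?S \<Longrightarrow> fls_X ^ n * f b = fps_to_fls (f' b)" by (metis finite_bimons)
  have "beval ?S (\<lambda>a. [:a:]) f' X [:0, 1:] = 0" if X: "X \<in> \<Xi>" for X
  proof -
    have mT: "map_poly fps_to_fls [:0, 1 :: complex fps:] = [:0, 1:]" "map_poly fps_to_fls [:a :: complex fps:] = [:fps_to_fls a:]" for a
      by (simp_all add: map_poly_pCons)
    have "map_poly fps_to_fls (beval ?S (\<lambda>a. [:a:]) f' X [:0, 1:]) =
        (\<Sum>b\<in>?S. [:fps_to_fls (f' b):] * bmon b (\<lambda>v. map_poly fps_to_fls (X v)) [:0, 1:])"
      unfolding beval_rhom[OF m] mT by (simp add: beval_def)
    also have "\<dots> = (\<Sum>b\<in>?S. [:fls_X ^ n:] * ([:f b:] * bmon b (\<lambda>v. map_poly fps_to_fls (X v)) [:0, 1:]))"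
      by (intro sum.cong refl) (simp add: f'[symmetric] mult.commute)
    also have "\<dots> = [:fls_X ^ n:] * beval ?S (\<lambda>a. [:a:]) f (\<lambda>v. map_poly fps_to_fls (X v)) [:0, 1:]"
      by (simp only: beval_def sum_distrib_left)
    finally have 0: "map_poly fps_to_fls (beval ?S (\<lambda>a. [:a:]) f' X [:0, 1:]) = 0" using van[OF X] by simp
    then show ?thesis
      by (intro poly_eqI) (metis coeff_0 coeff_map_poly fps_to_fls_eq_0_iff fps_zero_to_fls)
  qed
  from fps[OF this] obtain q where q: "\<forall>b\<in>?S. f' b = pmul N d k p q b" by blast
  define u :: "complex fls" where "u = fls_X ^ n"
  have u: "u \<noteq> 0" by (simp add: u_def)
  have "f b = pmul N d k (\<lambda>a. fps_to_fls (p a)) (\<lambda>c. inverse u * fps_to_fls (q c)) b" if b: "b \<in> ?S" for b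
  proof -
    have "u * f b = pmul N d k (\<lambda>a. fps_to_fls (p a)) (\<lambda>c. fps_to_fls (q c)) b"
      using f'[OF b] q b by (simp add: rhom_pmul[OF rhom_fps_to_fls] u_def)
    then have "f b = inverse u * pmul N d k (\<lambda>a. fps_to_fls (p a)) (\<lambda>c. fps_to_fls (q c)) b"
      using u by (metis (no_types, lifting) left_inverse mult.assoc mult_1)
    also have "\<dots> = pmul N d k (\<lambda>a. fps_to_fls (p a)) (\<lambda>c. inverse u * fps_to_fls (q c)) b"
      unfolding pmul_def sum_distrib_left by (intro sum.cong refl) auto
    finally show ?thesis .
  qed
  then show ?thesis by blast
qed

text \<open>A linear choice of preimages inside V. Linearity turns the bare existence of cofactors
  into formulas determined by finitely many values.\<close>

lemma linear_fun_right_inverse: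
  fixes f :: "('m \<Rightarrow> 'a::field) \<Rightarrow> ('r \<Rightarrow> 'a)"
  assumes add: "\<And>u v. f (\<lambda>x. u x + v x) = (\<lambda>y. f u y + f v y)" and scale: "\<And>c u. f (\<lambda>x. c * u x) = (\<lambda>y. c * f u y)"
    and V: "(\<lambda>x. 0) \<in> V" "\<And>u v. u \<in> V \<Longrightarrow> v \<in> V \<Longrightarrow> (\<lambda>x. u x + v x) \<in> V" "\<And>c u. u \<in> V \<Longrightarrow> (\<lambda>x. c * u x) \<in> V"
  shows "\<exists>g. range g \<subseteq> V \<and> (\<forall>u v. g (\<lambda>x. u x + v x) = (\<lambda>y. g u y + g v y)) \<and>
     (\<forall>c u. g (\<lambda>x. c * u x) = (\<lambda>y. c * g u y)) \<and> (\<forall>v\<in>f ` V. f (g v) = v)"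
proof -
  let ?s1 = "\<lambda>c (u :: 'm \<Rightarrow> 'a) x. c * u x" and ?s2 = "\<lambda>c (u :: 'r \<Rightarrow> 'a) x. c * u x"
  interpret vector_space_pair ?s1 ?s2
    by unfold_locales (auto simp: fun_eq_iff algebra_simps)
  have plus: "(\<lambda>x. u x + v x) = u + v" for u v :: "'m \<Rightarrow> 'a" by (simp add: fun_eq_iff)
  have plus2: "(\<lambda>x. u x + v x) = u + v" for u v :: "'r \<Rightarrow> 'a" by (simp add: fun_eq_iff)
  have lf: "Vector_Spaces.linear ?s1 ?s2 f"
    by unfold_locales (use add scale in \<open>simp_all add: plus plus2\<close>)
  have "vs1.subspace V"
    unfolding vs1.subspace_def using V by (simp add: plus zero_fun_def)
  from linear_exists_right_inverse_on[OF lf this] obtain g where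
    g: "range g \<subseteq> V" "Vector_Spaces.linear ?s2 ?s1 g" "\<forall>v\<in>f ` V. f (g v) = v" by blast
  interpret g: Vector_Spaces.linear ?s2 ?s1 g by (rule g(2))
  show ?thesis
    by (intro exI[of _ g] conjI g(1,3)) (simp_all add: plus plus2 g.add g.scale)
qed

lemma linear_fun_expand:
  fixes g :: "('m \<Rightarrow> 'a::field) \<Rightarrow> ('r \<Rightarrow> 'a)"
  assumes add: "\<And>u v. g (\<lambda>x. u x + v x) = (\<lambda>y. g u y + g v y)" and scale: "\<And>c u. g (\<lambda>x. c * u x) = (\<lambda>y. c * g u y)"
    and "finite R" "\<And>x. x \<notin> R \<Longrightarrow> u x = 0"
  shows "g u b = (\<Sum>r\<in>R. u r * g (\<lambda>x. if x = r then 1 else 0) b)"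
proof -
  have zero: "g (\<lambda>x. 0) = (\<lambda>y. 0)" using scale[of 0 "\<lambda>x. 0"] by simp
  have "g (\<lambda>x. if x \<in> R then u x else 0) b = (\<Sum>r\<in>R. u r * g (\<lambda>x. if x = r then 1 else 0) b)"
    using \<open>finite R\<close>
  proof (induction R rule: finite_induct)
    case (insert r R)
    have "(\<lambda>x. if x \<in> insert r R then u x else 0) = (\<lambda>x. (u r * (if x = r then 1 else 0)) + (if x \<in> R then u x else 0))"
      using insert.hyps by (auto simp: fun_eq_iff)
    then show ?case using insert by (simp add: add scale)
  qed (simp add: zero)
  moreover have "(\<lambda>x. if x \<in> R then u x else 0) = u" using assms(4) by (auto simp: fun_eq_iff)
  ultimately show ?thesis by simp
qed

text \<open>The statement that every form vanishing on the sections is a multiple of the pencil, as a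
  system of polynomial equations in the coefficients; this form is preserved by field
  homomorphisms.\<close>

lemma vanishing_certificate:
  fixes p :: "'v::finite monom \<times> nat \<Rightarrow> 'a::field" and \<Xi> :: "('v \<Rightarrow> 'a poly) set"
  assumes "finite \<Xi>"
    and mult: "\<And>f. (\<And>X. X \<in> \<Xi> \<Longrightarrow> beval (bimons d k) (\<lambda>a. [:a:]) f X [:0, 1:] = 0) \<Longrightarrow>
       (\<exists>q. \<forall>b\<in>bimons d k. f b = pmul N d k p q b)"
  shows "\<exists>A B D. \<forall>a\<in>bimons d k. \<forall>b\<in>bimons d k. (if b = a then 1 else 0) =
     pmul N d k p (A a) b + (\<Sum>r\<in>\<Xi> \<times> {..D}. coeff (bmon a (fst r) [:0, 1:]) (snd r) * B r b)"
proof -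
  let ?S = "bimons d k :: ('v monom \<times> nat) set"
  define ev where "ev f r = (if fst r \<in> \<Xi> then coeff (beval ?S (\<lambda>a. [:a:]) f (fst r) [:0, 1:]) (snd r) else 0)"
    for f :: "'v monom \<times> nat \<Rightarrow> 'a" and r :: "('v \<Rightarrow> 'a poly) \<times> nat"
  define mu where "mu q b = (if b \<in> ?S then pmul N d k p q b else 0)" for q b
  define V where "V = {f :: 'v monom \<times> nat \<Rightarrow> 'a. \<forall>b. b \<notin> ?S \<longrightarrow> f b = 0}"
  have ev_alt: "ev f r = (if fst r \<in> \<Xi> then \<Sum>b\<in>?S. f b * coeff (bmon b (fst r) [:0, 1:]) (snd r) else 0)" for f r
    by (simp add: ev_def beval_def coeff_sum)
  have ev_add: "ev (\<lambda>x. u x + v x) = (\<lambda>y. ev u y + ev v y)" for u v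
    by (auto simp: ev_alt fun_eq_iff distrib_right sum.distrib)
  have ev_scale: "ev (\<lambda>x. c * u x) = (\<lambda>y. c * ev u y)" for c u
    by (auto simp: ev_alt fun_eq_iff sum_distrib_left mult.assoc)
  have pm_add: "pmul N d k p (\<lambda>c. u c + v c) b = pmul N d k p u b + pmul N d k p v b" for u v b
    using pmul_add_shift[of N d k p u 1 v b] by simp
  have pm_scale: "pmul N d k p (\<lambda>c. r * u c) b = r * pmul N d k p u b" for r u b
    unfolding pmul_def sum_distrib_left by (intro sum.cong refl) auto
  have mu_add: "mu (\<lambda>x. u x + v x) = (\<lambda>y. mu u y + mu v y)" for u v
    by (auto simp: mu_def fun_eq_iff pm_add)
  have mu_scale: "mu (\<lambda>x. c * u x) = (\<lambda>y. c * mu u y)" for c u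
    by (auto simp: mu_def fun_eq_iff pm_scale)
  obtain B where B: "range B \<subseteq> V" "\<And>u v. B (\<lambda>x. u x + v x) = (\<lambda>y. B u y + B v y)"
    "\<And>c u. B (\<lambda>x. c * u x) = (\<lambda>y. c * B u y)" "\<And>v. v \<in> ev ` V \<Longrightarrow> ev (B v) = v"
  proof -
    have "(\<lambda>x. 0) \<in> V" "\<And>u v. u \<in> V \<Longrightarrow> v \<in> V \<Longrightarrow> (\<lambda>x. u x + v x) \<in> V" "\<And>c u. u \<in> V \<Longrightarrow> (\<lambda>x. c * u x) \<in> V"
      by (auto simp: V_def)
    from linear_fun_right_inverse[of ev V, OF ev_add ev_scale this] that show ?thesis by blast
  qed
  obtain A where A: "\<And>v. v \<in> mu ` UNIV \<Longrightarrow> mu (A v) = v"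
  proof -
    from linear_fun_right_inverse[of mu UNIV, OF mu_add mu_scale UNIV_I UNIV_I UNIV_I] that show ?thesis by blast
  qed
  \<comment> \<open>f - B (ev f) has the same values on the sections as 0, so it is a multiple of
    the pencil. This decomposes f linearly into a multiple and a part depending only on its
    values.\<close>
  have key: "f b = pmul N d k p (A (\<lambda>x. f x - B (ev f) x)) b + B (ev f) b" if f: "f \<in> V" and b: "b \<in> ?S" for f b
  proof -
    let ?f = "\<lambda>x. f x - B (ev f) x"
    have "ev ?f = (\<lambda>y. 0)"
    proof -
      have "ev ?f = (\<lambda>y. ev f y + ev (\<lambda>x. - 1 * B (ev f) x) y)" using ev_add[of f "\<lambda>x. - 1 * B (ev f) x"] by simp
      also have "\<dots> = (\<lambda>y. ev f y + - 1 * ev (B (ev f)) y)" by (simp only: ev_scale)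
      also have "ev (B (ev f)) = ev f" using B(4) f by blast
      finally show ?thesis by simp
    qed
    then have "beval ?S (\<lambda>a. [:a:]) ?f X [:0, 1:] = 0" if "X \<in> \<Xi>" for X
    proof (intro poly_eqI)
      fix n
      have "ev ?f (X, n) = 0" using \<open>ev ?f = (\<lambda>y. 0)\<close> by metis
      then show "coeff (beval ?S (\<lambda>a. [:a:]) ?f X [:0, 1:]) n = coeff 0 n" using that by (simp add: ev_def)
    qed
    from mult[OF this] obtain q where q: "\<forall>b\<in>?S. ?f b = pmul N d k p q b" by blast
    have "B (ev f) \<in> V" using B(1) by blast
    then have "?f = mu q" using q f by (auto simp: fun_eq_iff mu_def V_def)
    then have "mu (A ?f) = ?f" using A by blast
    then have "pmul N d k p (A ?f) b = ?f b" using b by (metis mu_def)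
    then show ?thesis by simp
  qed
  \<comment> \<open>Only coefficients up to D of the evaluated monomials can be nonzero, which makes
    the certificate a finite sum.\<close>
  define D where "D = Max (insert 0 ((\<lambda>(X, a). degree (bmon a X [:0, 1:])) ` (\<Xi> \<times> ?S)))"
  have D: "degree (bmon a X [:0, 1:]) \<le> D" if "X \<in> \<Xi>" "a \<in> ?S" for a X
    unfolding D_def using that assms(1) by (intro Max_ge) (auto intro!: image_eqI[of _ _ "(X, a)"])
  have "(if b = a then 1 else 0) = pmul N d k p (A (\<lambda>x. (if x = a then 1 else 0) - B (ev (\<lambda>x. if x = a then 1 else 0)) x)) b +
     (\<Sum>r\<in>\<Xi> \<times> {..D}. coeff (bmon a (fst r) [:0, 1:]) (snd r) * B (\<lambda>x. if x = r then 1 else 0) b)"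
    if a: "a \<in> ?S" and b: "b \<in> ?S" for a b
  proof -
    let ?d = "\<lambda>x. if x = a then 1 else (0::'a)"
    have evd: "ev ?d r = (if fst r \<in> \<Xi> then coeff (bmon a (fst r) [:0, 1:]) (snd r) else 0)" for r
    proof -
      have "(\<Sum>b\<in>?S. ?d b * coeff (bmon b (fst r) [:0, 1:]) (snd r)) = (\<Sum>b\<in>?S. if b = a then coeff (bmon a (fst r) [:0, 1:]) (snd r) else 0)"
        by (intro sum.cong) auto
      then show ?thesis using a by (simp add: ev_alt)
    qed
    have "B (ev ?d) b = (\<Sum>r\<in>\<Xi> \<times> {..D}. ev ?d r * B (\<lambda>x. if x = r then 1 else 0) b)"
    proof (rule linear_fun_expand[OF B(2,3)])
      show "finite (\<Xi> \<times> {..D})" using assms(1) by simp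
      fix r :: "('v \<Rightarrow> 'a poly) \<times> nat" assume r: "r \<notin> \<Xi> \<times> {..D}"
      show "ev ?d r = 0"
      proof (cases "fst r \<in> \<Xi>")
        case True
        then have "snd r > D" using r by (cases r) auto
        then have "coeff (bmon a (fst r) [:0, 1:]) (snd r) = 0" using D[OF True a] by (intro coeff_eq_0) simp
        then show ?thesis by (simp add: evd)
      qed (simp add: evd)
    qed
    also have "\<dots> = (\<Sum>r\<in>\<Xi> \<times> {..D}. coeff (bmon a (fst r) [:0, 1:]) (snd r) * B (\<lambda>x. if x = r then 1 else 0) b)"
      by (intro sum.cong refl) (auto simp: evd)
    finally show ?thesis using key[of ?d b] a b by (auto simp: V_def)
  qed
  then show ?thesis by (intro exI ballI)
qed

context
  fixes K :: "'a::field set" and h :: "'a \<Rightarrow> 'b::field"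
  assumes fh: "field_hom_on K h"
begin

lemma map_h_power: "P \<in> coeffs_in K \<Longrightarrow> P ^ n \<in> coeffs_in K \<and> map_poly h (P ^ n) = map_poly h P ^ n"
  by (induction n) (auto simp: coeffs_in_1[OF fh] map_h_1[OF fh] coeffs_in_mult[OF fh] map_h_mult[OF fh])

lemma map_h_prod:
  "(\<And>i. i \<in> A \<Longrightarrow> P i \<in> coeffs_in K) \<Longrightarrow> (\<Prod>i\<in>A. P i) \<in> coeffs_in K \<and> map_poly h (\<Prod>i\<in>A. P i) = (\<Prod>i\<in>A. map_poly h (P i))"
  by (induction A rule: infinite_finite_induct)
     (auto simp: coeffs_in_1[OF fh] map_h_1[OF fh] coeffs_in_mult[OF fh] map_h_mult[OF fh])

lemma map_h_bmon:
  assumes "\<And>v. X v \<in> coeffs_in K"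
  shows "bmon b X [:0, 1:] \<in> coeffs_in K \<and> map_poly h (bmon b X [:0, 1:]) = bmon b (\<lambda>v. map_poly h (X v)) [:0, 1:]"
proof -
  have T: "[:0, 1:] \<in> coeffs_in K" "map_poly h [:0, 1:] = [:0, 1:]"
    by (auto simp: coeffs_in_def[OF fh] coeff_pCons fh_0[OF fh] fh_1[OF fh] map_poly_pCons split: nat.splits)
  have m: "mon (fst b) X \<in> coeffs_in K \<and> map_poly h (mon (fst b) X) = mon (fst b) (\<lambda>v. map_poly h (X v))"
    unfolding mon_def using map_h_power[OF assms] map_h_prod[of "Poly_Mapping.keys (fst b)"] by simp
  show ?thesis unfolding bmon_def
    using m map_h_power[OF T(1)] T by (simp add: coeffs_in_mult[OF fh] map_h_mult[OF fh])
qed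

text \<open>After applying h to the certificate, each unit vector is a multiple of the new pencil
  plus a combination of evaluations. Combining these with the entries of f as weights, the
  evaluations cancel because f vanishes on the transferred sections.\<close>

lemma transfer_multiple_of_pencil:
  fixes p :: "'v::finite monom \<times> nat \<Rightarrow> 'a" and \<Xi> :: "('v \<Rightarrow> 'a poly) set" and f :: "'v monom \<times> nat \<Rightarrow> 'b"
  assumes "finite \<Xi>"
    and cert: "\<And>a b. a \<in> bimons d k \<Longrightarrow> b \<in> bimons d k \<Longrightarrow> (if b = a then 1 else 0) =
     pmul N d k p (A a) b + (\<Sum>r\<in>\<Xi> \<times> {..D}. coeff (bmon a (fst r) [:0, 1:]) (snd r) * B r b)"
    and inK: "\<And>a. a \<in> bimons N 1 \<Longrightarrow> p a \<in> K" "\<And>a c. a \<in> bimons d k \<Longrightarrow> c \<in> cobimons N d k \<Longrightarrow> A a c \<in> K"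
      "\<And>r b. r \<in> \<Xi> \<times> {..D} \<Longrightarrow> b \<in> bimons d k \<Longrightarrow> B r b \<in> K" "\<And>X v. X \<in> \<Xi> \<Longrightarrow> X v \<in> coeffs_in K"
    and van: "\<And>X. X \<in> \<Xi> \<Longrightarrow> beval (bimons d k) (\<lambda>a. [:a:]) f (\<lambda>v. map_poly h (X v)) [:0, 1:] = 0"
  shows "\<exists>q. \<forall>b\<in>bimons d k. f b = pmul N d k (\<lambda>a. h (p a)) q b"
proof -
  let ?S = "bimons d k :: ('v monom \<times> nat) set"
  let ?e = "\<lambda>a r. coeff (bmon a (\<lambda>v. map_poly h (fst r v)) [:0, 1:]) (snd r)"
  have cert': "(if b = a then 1 else 0) = pmul N d k (\<lambda>a. h (p a)) (\<lambda>c. h (A a c)) b + (\<Sum>r\<in>\<Xi> \<times> {..D}. ?e a r * h (B r b))"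
    if ab: "a \<in> ?S" "b \<in> ?S" for a b
  proof -
    have 1: "pmul N d k p (A a) b \<in> K" "h (pmul N d k p (A a) b) = pmul N d k (\<lambda>a. h (p a)) (\<lambda>c. h (A a c)) b"
    proof -
      define w where "w a' c = (if (fst a' + fst c, snd a' + snd c) = b then p a' * A a c else 0)" for a' c
      have t: "w a' c \<in> K" "h (w a' c) = (if (fst a' + fst c, snd a' + snd c) = b then h (p a') * h (A a c) else 0)"
        if "a' \<in> bimons N 1" "c \<in> cobimons N d k" for a' c
        using fh_mult[OF fh inK(1)[OF that(1)] inK(2)[OF ab(1) that(2)]] fh_0[OF fh] by (auto simp: w_def)
      have t2: "(\<Sum>c\<in>cobimons N d k. w a' c) \<in> K" if "a' \<in> bimons N 1" for a'
        by (intro fh_sum_in[OF fh] t that)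
      have pm: "pmul N d k p (A a) b = (\<Sum>a'\<in>bimons N 1. \<Sum>c\<in>cobimons N d k. w a' c)"
        by (simp add: pmul_def w_def)
      show "pmul N d k p (A a) b \<in> K" unfolding pm by (intro fh_sum_in[OF fh] t2)
      have "h (pmul N d k p (A a) b) = (\<Sum>a'\<in>bimons N 1. h (\<Sum>c\<in>cobimons N d k. w a' c))"
        unfolding pm by (intro fh_sum[OF fh] t2)
      also have "\<dots> = (\<Sum>a'\<in>bimons N 1. \<Sum>c\<in>cobimons N d k. h (w a' c))"
        by (intro sum.cong refl fh_sum[OF fh] t)
      also have "\<dots> = pmul N d k (\<lambda>a. h (p a)) (\<lambda>c. h (A a c)) b"
        unfolding pmul_def by (intro sum.cong refl t)
      finally show "h (pmul N d k p (A a) b) = pmul N d k (\<lambda>a. h (p a)) (\<lambda>c. h (A a c)) b" .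
    qed
    have 2: "coeff (bmon a (fst r) [:0, 1:]) (snd r) \<in> K" "h (coeff (bmon a (fst r) [:0, 1:]) (snd r)) = ?e a r"
      if r: "r \<in> \<Xi> \<times> {..D}" for r
    proof -
      have "fst r \<in> \<Xi>" using r by auto
      note m = map_h_bmon[OF inK(4)[OF this], of a]
      show "coeff (bmon a (fst r) [:0, 1:]) (snd r) \<in> K" using m by (simp add: coeffs_in_def[OF fh])
      show "h (coeff (bmon a (fst r) [:0, 1:]) (snd r)) = ?e a r"
        using m coeff_map_h[OF fh, of "bmon a (fst r) [:0, 1:]" "snd r"] by simp
    qed
    have 3: "(\<Sum>r\<in>\<Xi> \<times> {..D}. coeff (bmon a (fst r) [:0, 1:]) (snd r) * B r b) \<in> K"
      "h (\<Sum>r\<in>\<Xi> \<times> {..D}. coeff (bmon a (fst r) [:0, 1:]) (snd r) * B r b) = (\<Sum>r\<in>\<Xi> \<times> {..D}. ?e a r * h (B r b))"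
    proof -
      have t: "coeff (bmon a (fst r) [:0, 1:]) (snd r) * B r b \<in> K"
        "h (coeff (bmon a (fst r) [:0, 1:]) (snd r) * B r b) = ?e a r * h (B r b)" if "r \<in> \<Xi> \<times> {..D}" for r
        using fh_mult[OF fh 2(1)[OF that] inK(3)[OF that ab(2)]] 2(2)[OF that] by auto
      show "(\<Sum>r\<in>\<Xi> \<times> {..D}. coeff (bmon a (fst r) [:0, 1:]) (snd r) * B r b) \<in> K"
        by (intro fh_sum_in[OF fh] t)
      have "h (\<Sum>r\<in>\<Xi> \<times> {..D}. coeff (bmon a (fst r) [:0, 1:]) (snd r) * B r b) =
         (\<Sum>r\<in>\<Xi> \<times> {..D}. h (coeff (bmon a (fst r) [:0, 1:]) (snd r) * B r b))"
        by (intro fh_sum[OF fh] t)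
      also have "\<dots> = (\<Sum>r\<in>\<Xi> \<times> {..D}. ?e a r * h (B r b))" by (intro sum.cong refl t)
      finally show "h (\<Sum>r\<in>\<Xi> \<times> {..D}. coeff (bmon a (fst r) [:0, 1:]) (snd r) * B r b) = (\<Sum>r\<in>\<Xi> \<times> {..D}. ?e a r * h (B r b))" .
    qed
    have "(if b = a then 1 else 0) = h (if b = a then 1 else 0)" using fh_0[OF fh] fh_1[OF fh] by simp
    then show ?thesis unfolding cert[OF ab] using 1 3 by (simp add: fh_add[OF fh])
  qed
  have van': "(\<Sum>a\<in>?S. f a * ?e a r) = 0" if "r \<in> \<Xi> \<times> {..D}" for r
  proof -
    have "(\<Sum>a\<in>?S. f a * ?e a r) = coeff (beval ?S (\<lambda>a. [:a:]) f (\<lambda>v. map_poly h (fst r v)) [:0, 1:]) (snd r)"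
      by (simp add: beval_def coeff_sum)
    then show ?thesis using van[of "fst r"] that by auto
  qed
  have "f b = pmul N d k (\<lambda>a. h (p a)) (\<lambda>c. \<Sum>a\<in>?S. f a * h (A a c)) b" if b: "b \<in> ?S" for b
  proof -
    have "f b = (\<Sum>a\<in>?S. f a * (if b = a then 1 else 0))"
    proof -
      have "(\<Sum>a\<in>?S. f a * (if b = a then 1 else 0)) = (\<Sum>a\<in>?S. if b = a then f b else 0)" by (intro sum.cong) auto
      then show ?thesis using b by simp
    qed
    also have "\<dots> = (\<Sum>a\<in>?S. f a * pmul N d k (\<lambda>a. h (p a)) (\<lambda>c. h (A a c)) b) +
       (\<Sum>a\<in>?S. f a * (\<Sum>r\<in>\<Xi> \<times> {..D}. ?e a r * h (B r b)))"
      unfolding sum.distrib[symmetric] distrib_left[symmetric] by (intro sum.cong refl) (simp add: cert'[OF _ b, symmetric])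
    also have "(\<Sum>a\<in>?S. f a * (\<Sum>r\<in>\<Xi> \<times> {..D}. ?e a r * h (B r b))) = (\<Sum>r\<in>\<Xi> \<times> {..D}. (\<Sum>a\<in>?S. f a * ?e a r) * h (B r b))"
      unfolding sum_distrib_left sum_distrib_right by (subst sum.swap) (simp add: mult.assoc)
    also have "\<dots> = 0" using van' by (intro sum.neutral) auto
    also have "(\<Sum>a\<in>?S. f a * pmul N d k (\<lambda>a. h (p a)) (\<lambda>c. h (A a c)) b) = pmul N d k (\<lambda>a. h (p a)) (\<lambda>c. \<Sum>a\<in>?S. f a * h (A a c)) b"
    proof -
      have "(\<Sum>a\<in>?S. f a * pmul N d k (\<lambda>a. h (p a)) (\<lambda>c. h (A a c)) b) =
        (\<Sum>a'\<in>bimons N 1. \<Sum>c\<in>cobimons N d k. \<Sum>a\<in>?S. f a * (if (fst a' + fst c, snd a' + snd c) = b then h (p a') * h (A a c) else 0))"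
        unfolding pmul_def sum_distrib_left by (subst sum.swap) (intro sum.cong refl sum.swap)
      also have "\<dots> = pmul N d k (\<lambda>a. h (p a)) (\<lambda>c. \<Sum>a\<in>?S. f a * h (A a c)) b"
        unfolding pmul_def by (intro sum.cong refl) (auto simp: sum_distrib_left mult_ac)
      finally show ?thesis .
    qed
    finally show ?thesis by simp
  qed
  then show ?thesis by blast
qed

end

section \<open>Countability and algebraic independence\<close>

lemma countable_poly_mapping:
  assumes "countable A"
  shows "countable {P :: 'a \<Rightarrow>\<^sub>0 'b::{zero,countable}. Poly_Mapping.keys P \<subseteq> A}"
proof (rule countable_image_inj_on)
  let ?\<phi> = "\<lambda>P :: 'a \<Rightarrow>\<^sub>0 'b. (\<lambda>k. (k, Poly_Mapping.lookup P k)) ` Poly_Mapping.keys P"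
  have "?\<phi> ` {P. Poly_Mapping.keys P \<subseteq> A} \<subseteq> {B. finite B \<and> B \<subseteq> A \<times> UNIV}" by auto
  moreover have "countable {B :: ('a \<times> 'b) set. finite B \<and> B \<subseteq> A \<times> UNIV}"
    using assms by (intro countable_Collect_finite_subset) auto
  ultimately show "countable (?\<phi> ` {P. Poly_Mapping.keys P \<subseteq> A})" by (rule countable_subset)
  show "inj_on ?\<phi> {P. Poly_Mapping.keys P \<subseteq> A}"
  proof (rule inj_onI)
    fix P Q :: "'a \<Rightarrow>\<^sub>0 'b" assume eq: "?\<phi> P = ?\<phi> Q"
    have "Poly_Mapping.lookup P k = b \<longleftrightarrow> Poly_Mapping.lookup Q k = b" if "b \<noteq> 0" for k b
    proof -
      have "(k, b) \<in> ?\<phi> R \<longleftrightarrow> Poly_Mapping.lookup R k = b" for R :: "'a \<Rightarrow>\<^sub>0 'b" using that by (auto simp: in_keys_iff)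
      then show ?thesis using eq by blast
    qed
    then show "P = Q" by (intro poly_mapping_eqI) metis
  qed
qed

lemma countable_vars_in:
  assumes "countable V"
  shows "countable {P :: 'v monom \<Rightarrow>\<^sub>0 int. vars_in V P}"
proof -
  have "{P :: 'v monom \<Rightarrow>\<^sub>0 int. vars_in V P} = {P. Poly_Mapping.keys P \<subseteq> {m. Poly_Mapping.keys m \<subseteq> V}}"
    by (auto simp: vars_in_def)
  then show ?thesis using countable_poly_mapping[OF countable_poly_mapping[OF assms]] by simp
qed

lemma rhom_of_int: "rhom (of_int :: int \<Rightarrow> 'a::comm_ring_1)"
  by (simp add: rhom_def)

text \<open>Integer coefficients suffice, since denominators can be cleared, and leave only
  countably many relations to avoid.\<close>

definition alg_indep :: "'v set \<Rightarrow> ('v \<Rightarrow> 'a::comm_ring_1) \<Rightarrow> bool" where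
  "alg_indep V y \<longleftrightarrow> (\<forall>P. vars_in V P \<and> P \<noteq> 0 \<longrightarrow> evalp of_int P y \<noteq> 0)"

text \<open>By independence, evaluation at y and at z both have kernel zero on the integer
  polynomials in V, so the fraction fields correspond.\<close>

lemma field_hom_alg_indep:
  fixes y :: "'v \<Rightarrow> 'a::field" and z :: "'v \<Rightarrow> 'b::field"
  assumes "countable V" "alg_indep V y" "alg_indep V z"
  shows "\<exists>K h. field_hom_on K h \<and> countable K \<and> (\<forall>v\<in>V. y v \<in> K \<and> h (y v) = z v)"
proof -
  have "\<exists>K h. field_hom_on K h \<and> countable K \<and> (\<forall>P\<in>{P. vars_in V P}. evalp of_int P y \<in> K \<and> h (evalp of_int P y) = evalp of_int P z)"
  proof (rule fraction_field_hom)
    fix P :: "'v monom \<Rightarrow>\<^sub>0 int" assume "P \<in> {P. vars_in V P}"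
    then show "evalp of_int P y = 0 \<longleftrightarrow> evalp of_int P z = 0"
      using assms by (cases "P = 0") (auto simp: alg_indep_def)
  qed (simp_all add: vars_in_one vars_in_diff vars_in_mult countable_vars_in assms(1)
        evalp_one[OF rhom_of_int] evalp_mult[OF rhom_of_int] rhom_diff[OF rhom_evalp[OF rhom_of_int]])
  then obtain K h where K: "field_hom_on K h" "countable K"
     "\<And>P. vars_in V P \<Longrightarrow> evalp of_int P y \<in> K \<and> h (evalp of_int P y) = evalp of_int P z" by blast
  have "y v \<in> K \<and> h (y v) = z v" if "v \<in> V" for v
    using K(3)[OF vars_in_pvar[OF that]] by (simp add: evalp_pvar[OF rhom_of_int])
  then show ?thesis using K by blast
qed

lemma coeff_prod_top:
  fixes f :: "'i \<Rightarrow> 'a::comm_ring_1 poly"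
  assumes "finite A" "\<And>i. i \<in> A \<Longrightarrow> degree (f i) \<le> d i"
  shows "degree (\<Prod>i\<in>A. f i) \<le> (\<Sum>i\<in>A. d i) \<and> coeff (\<Prod>i\<in>A. f i) (\<Sum>i\<in>A. d i) = (\<Prod>i\<in>A. coeff (f i) (d i))"
  using assms
proof (induction A rule: finite_induct)
  case (insert a A)
  then show ?case using coeff_mult_top[of "f a" "d a" "\<Prod>i\<in>A. f i" "\<Sum>i\<in>A. d i"]
      degree_mult_le_add[of "f a" "d a" "\<Prod>i\<in>A. f i" "\<Sum>i\<in>A. d i"] by auto
qed auto

text \<open>The part of top degree of a polynomial relation between a + eps y would be a polynomial
  relation between the y.\<close>

lemma alg_indep_perturb:
  fixes a y :: "'v \<Rightarrow> complex"
  assumes "alg_indep V y"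
  shows "alg_indep V (\<lambda>v. fps_to_fls (fps_const (a v) + fps_X * fps_const (y v)))"
  unfolding alg_indep_def
proof (intro allI impI, elim conjE)
  fix P :: "'v monom \<Rightarrow>\<^sub>0 int" assume P: "vars_in V P" "P \<noteq> 0"
  define D where "D = Max (monom_degree ` Poly_Mapping.keys P)"
  define KD where "KD = {m \<in> Poly_Mapping.keys P. monom_degree m = D}"
  have K0: "Poly_Mapping.keys P \<noteq> {}" using P by simp
  have D: "monom_degree m \<le> D" if "m \<in> Poly_Mapping.keys P" for m
    unfolding D_def using that by (intro Max_ge) auto
  have "D \<in> monom_degree ` Poly_Mapping.keys P" unfolding D_def using K0 by (intro Max_in) auto
  then obtain m0 where m0: "m0 \<in> KD" by (auto simp: KD_def)
  define Q where "Q = (\<Sum>m\<in>KD. Poly_Mapping.single m (Poly_Mapping.lookup P m))"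
  have fin: "finite KD" by (simp add: KD_def)
  have lQ: "Poly_Mapping.lookup Q m = (if m \<in> KD then Poly_Mapping.lookup P m else 0)" for m
    using fin by (auto simp: Q_def lookup_sum lookup_single when_def sum.delta' cong: if_cong)
  have kQ: "Poly_Mapping.keys Q = KD" by (auto simp: in_keys_iff lQ KD_def split: if_splits)
  then have "vars_in V Q" "Q \<noteq> 0" using P(1) m0 by (auto simp: vars_in_def KD_def)
  then have nz: "evalp of_int Q y \<noteq> 0" using assms by (simp add: alg_indep_def)
  \<comment> \<open>As a polynomial in eps, a relation of degree D has at eps^D its part of degree D
    evaluated at y.\<close>
  define L where "L v = [:a v, y v:]" for v
  have mon: "degree (mon m L) \<le> monom_degree m \<and> coeff (mon m L) (monom_degree m) = mon m y" for m
  proof -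
    have pw: "degree (L v ^ n) \<le> n \<and> coeff (L v ^ n) n = y v ^ n" for v n
    proof -
      have "degree (\<Prod>i<n. L v) \<le> (\<Sum>i<n. 1) \<and> coeff (\<Prod>i<n. L v) (\<Sum>i<n. 1) = (\<Prod>i<n. coeff (L v) 1)"
        by (rule coeff_prod_top) (auto simp: L_def)
      then show ?thesis by (simp add: L_def)
    qed
    show ?thesis
      unfolding mon_def monom_degree_def
      using coeff_prod_top[of "Poly_Mapping.keys m" "\<lambda>v. L v ^ Poly_Mapping.lookup m v" "Poly_Mapping.lookup m"] pw by simp
  qed
  have "coeff (evalp of_int P L) D = (\<Sum>m\<in>Poly_Mapping.keys P. of_int (Poly_Mapping.lookup P m) * coeff (mon m L) D)"
    by (simp add: evalp_def coeff_sum of_int_poly)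
  also have "\<dots> = (\<Sum>m\<in>KD. of_int (Poly_Mapping.lookup P m) * mon m y)"
  proof (rule sum.mono_neutral_cong_right)
    show "\<forall>m\<in>Poly_Mapping.keys P - KD. of_int (Poly_Mapping.lookup P m) * coeff (mon m L) D = 0"
    proof
      fix m assume "m \<in> Poly_Mapping.keys P - KD"
      then have "monom_degree m < D" using D[of m] by (auto simp: KD_def)
      then have "coeff (mon m L) D = 0" using mon[of m] by (intro coeff_eq_0) auto
      then show "of_int (Poly_Mapping.lookup P m) * coeff (mon m L) D = 0" by simp
    qed
  qed (use mon in \<open>auto simp: KD_def\<close>)
  also have "\<dots> = evalp of_int Q y" by (simp add: evalp_def kQ lQ)
  finally have L0: "evalp of_int P L \<noteq> 0" using nz by auto
  have hp: "rhom (\<lambda>q :: complex poly. fps_to_fls (fps_of_poly q))"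
    by (simp add: rhom_def fps_of_poly_add fps_of_poly_mult fls_times_fps_to_fls)
  have ofi: "fps_to_fls (fps_of_poly (of_int n :: complex poly)) = of_int n" for n
  proof (cases n rule: int_diff_cases)
    case (diff i j)
    have "fps_to_fls (fps_of_poly (of_nat i :: complex poly)) = of_nat i" for i
      using rhom_sum[OF hp, of "\<lambda>_. 1" "{..<i}"] rhom_1[OF hp] by simp
    then show ?thesis using rhom_diff[OF hp] diff by simp
  qed
  have "(\<lambda>v. fps_to_fls (fps_const (a v) + fps_X * fps_const (y v))) = (\<lambda>v. fps_to_fls (fps_of_poly (L v)))"
    by (simp add: L_def fps_of_poly_pCons fps_of_poly_const mult.commute fun_eq_iff)
  then have "evalp of_int P (\<lambda>v. fps_to_fls (fps_const (a v) + fps_X * fps_const (y v))) = fps_to_fls (fps_of_poly (evalp of_int P L))"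
    unfolding evalp_rhom[OF hp] ofi by simp
  then show "evalp of_int P (\<lambda>v. fps_to_fls (fps_const (a v) + fps_X * fps_const (y v))) \<noteq> 0"
    using L0 by (metis fps_of_poly_eq_iff fps_of_poly_0 fps_to_fls_eq_0_iff)
qed

lemma map_h_sum:
  assumes fh: "field_hom_on K h" and P: "\<And>i. i \<in> A \<Longrightarrow> P i \<in> coeffs_in K"
  shows "(\<Sum>i\<in>A. P i) \<in> coeffs_in K \<and> map_poly h (\<Sum>i\<in>A. P i) = (\<Sum>i\<in>A. map_poly h (P i))"
  using P
  by (induction A rule: infinite_finite_induct)
     (auto simp: coeffs_in_0[OF fh] coeffs_in_add[OF fh] map_h_add[OF fh])

text \<open>The sections are the images of sections of the special pencil deformed towards g, under a field
  homomorphism that maps the coefficients of the deformation to those of g.\<close>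

lemma generic_pencil_sections:
  fixes i0 i1 i2 :: "'n::finite" and g :: "'n monom \<times> nat \<Rightarrow> complex"
  defines "N \<equiv> CARD('n)" and "J \<equiv> UNIV - {i0, i1, i2}"
  assumes dist: "i0 \<noteq> i1" "i0 \<noteq> i2" "i1 \<noteq> i2" and Jne: "J \<noteq> {}"
    and m1: "m1 = Poly_Mapping.single i0 N"
    and m2: "m2 = Poly_Mapping.single i1 3 + (\<Sum>j\<in>J. Poly_Mapping.single j 1)"
    and g: "g (m1, 0) = 1" "g (m1, 1) = 0" "g (m2, 0) = 0" "g (m2, 1) = 1"
    and indep: "alg_indep (bimons N 1 - {m1, m2} \<times> UNIV) g"
  shows "\<exists>\<Xi>. finite \<Xi> \<and> (\<forall>X\<in>\<Xi>. (\<exists>v. X v \<noteq> 0) \<and> beval (bimons N 1) (\<lambda>a. [:a:]) g X [:0, 1:] = 0) \<and>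
    (\<forall>f. (\<forall>X\<in>\<Xi>. beval (bimons d k) (\<lambda>a. [:a:]) f X [:0, 1:] = 0) \<longrightarrow>
       (\<exists>q. \<forall>b\<in>bimons d k. f b = pmul N d k g q b))"
proof -
  have J_alt: "J = UNIV - {i0, i1, i2}" by (simp add: J_def)
  obtain e x y z where e: "e \<ge> Suc (d + 3 * k)" and sec: "smooth_section e x y z"
    using smooth_section_exists by blast
  have e1: "e \<ge> 1" "e > d + 3 * k" using e by auto
  obtain c where c: "inj_on c J" "\<And>j. j \<in> J \<Longrightarrow> coeff (x - smult (c j) y) e \<noteq> 0"
    "\<And>j s. j \<in> J \<Longrightarrow> \<not> (poly (x - smult (c j) y) s = 0 \<and> poly (T * (y^3 - z^3)) s = 0)"
    using exists_transversal_lines[OF sec e1(1), of J] by auto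
  interpret special_pencil i0 i1 i2 J c
    by unfold_locales (use dist J_alt in auto)
  define V where "V = bimons N 1 - {m1, m2} \<times> UNIV"
  have m12: "m1 = local.m1" "m2 = local.m2" by (simp_all add: m1 m2 m1_def m2_def N_def)
  \<comment> \<open>Set to 0 at m1 and m2, so that the deformation leaves these four coefficients at
    their values for F1 and F2.\<close>
  define g' where "g' a = (if a \<in> V then g a else 0)" for a
  define p where "p a = fps_to_fls (deformation g' a)" for a
  have "\<exists>\<Xi>. finite \<Xi> \<and> (\<forall>X\<in>\<Xi>. (\<exists>v. X v \<noteq> 0) \<and> beval (bimons N 1) (\<lambda>a. [:a:]) (deformation g') X [:0, 1:] = 0) \<and>
    (\<forall>f. (\<forall>X\<in>\<Xi>. beval (bimons d k) (\<lambda>a. [:a:]) f X [:0, 1:] = 0) \<longrightarrow>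
       (\<exists>q. \<forall>b\<in>bimons d k. f b = pmul N d k (deformation g') q b))"
    unfolding N_def by (rule deformed_sections[OF sec e1(2) c])
  then obtain \<Xi> where \<Xi>12: "finite \<Xi>"
      "\<forall>X\<in>\<Xi>. (\<exists>v. X v \<noteq> 0) \<and> beval (bimons N 1) (\<lambda>a. [:a:]) (deformation g') X [:0, 1:] = 0"
      "\<forall>f. (\<forall>X\<in>\<Xi>. beval (bimons d k) (\<lambda>a. [:a:]) f X [:0, 1:] = 0) \<longrightarrow>
       (\<exists>q. \<forall>b\<in>bimons d k. f b = pmul N d k (deformation g') q b)"
    by (elim exE conjE) (rule that)
  have \<Xi>: "finite \<Xi>" "\<And>X. X \<in> \<Xi> \<Longrightarrow> \<exists>v. X v \<noteq> 0"
    "\<And>X. X \<in> \<Xi> \<Longrightarrow> beval (bimons N 1) (\<lambda>a. [:a:]) (deformation g') X [:0, 1:] = 0"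
    using \<Xi>12(1,2) by simp_all
  have \<Xi>4: "\<exists>q. \<forall>b\<in>bimons d k. f b = pmul N d k (deformation g') q b"
    if "\<And>X. X \<in> \<Xi> \<Longrightarrow> beval (bimons d k) (\<lambda>a. [:a:]) f X [:0, 1:] = 0" for f
    using \<Xi>12(3) that by simp
  define \<Xi>' where "\<Xi>' = (\<lambda>X v. map_poly fps_to_fls (X v)) ` \<Xi>"
  note mh = rhom_map_poly[OF rhom_fps_to_fls]
  have mT: "map_poly fps_to_fls [:0, 1 :: complex fps:] = [:0, 1:]" "map_poly fps_to_fls [:a :: complex fps:] = [:fps_to_fls a:]" for a
    by (simp_all add: map_poly_pCons)
  have fin': "finite \<Xi>'" using \<Xi>(1) by (simp add: \<Xi>'_def)
  have nz': "\<exists>v. X v \<noteq> 0" if X: "X \<in> \<Xi>'" for X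
  proof -
    obtain Y where Y: "Y \<in> \<Xi>" "X = (\<lambda>v. map_poly fps_to_fls (Y v))" using X by (auto simp: \<Xi>'_def)
    obtain v where "Y v \<noteq> 0" using \<Xi>(2) Y(1) by blast
    then obtain i where "coeff (Y v) i \<noteq> 0" by (metis leading_coeff_0_iff)
    then have "coeff (X v) i \<noteq> 0" by (simp add: Y(2) coeff_map_poly)
    then have "X v \<noteq> 0" by (metis coeff_0)
    then show ?thesis by (rule exI)
  qed
  have sec': "beval (bimons N 1) (\<lambda>a. [:a:]) p X [:0, 1:] = 0" if X: "X \<in> \<Xi>'" for X
  proof -
    obtain Y where Y: "Y \<in> \<Xi>" "X = (\<lambda>v. map_poly fps_to_fls (Y v))" using X by (auto simp: \<Xi>'_def)
    have "map_poly fps_to_fls (beval (bimons N 1) (\<lambda>a. [:a:]) (deformation g') Y [:0, 1:]) = 0"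
      using \<Xi>(3)[OF Y(1)] by simp
    then show ?thesis unfolding beval_rhom[OF mh] mT Y(2) by (simp add: beval_def p_def)
  qed
  have mult': "\<exists>q. \<forall>b\<in>bimons d k. f b = pmul N d k p q b"
    if "\<And>X. X \<in> \<Xi>' \<Longrightarrow> beval (bimons d k) (\<lambda>a. [:a:]) f X [:0, 1:] = 0" for f
    unfolding p_def[abs_def]
    by (rule multiple_of_pencil_fls[OF \<Xi>4]) (use that in \<open>auto simp: \<Xi>'_def\<close>)
  have "\<exists>A B D. \<forall>a\<in>bimons d k. \<forall>b\<in>bimons d k. (if b = a then 1 else 0) =
     pmul N d k p (A a) b + (\<Sum>r\<in>\<Xi>' \<times> {..D}. coeff (bmon a (fst r) [:0, 1:]) (snd r) * B r b)"
    by (rule vanishing_certificate[OF fin']) (rule mult')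
  then obtain A B D where cert0: "\<forall>a\<in>bimons d k. \<forall>b\<in>bimons d k. (if b = a then 1 else 0) =
     pmul N d k p (A a) b + (\<Sum>r\<in>\<Xi>' \<times> {..D}. coeff (bmon a (fst r) [:0, 1:]) (snd r) * B r b)"
    by (elim exE) (rule that)
  have cert: "(if b = a then 1 else 0) =
     pmul N d k p (A a) b + (\<Sum>r\<in>\<Xi>' \<times> {..D}. coeff (bmon a (fst r) [:0, 1:]) (snd r) * B r b)"
    if "a \<in> bimons d k" "b \<in> bimons d k" for a b
    using bspec[OF bspec[OF cert0 that(1)] that(2)] .
  have pV: "p a = fps_to_fls (fps_const (p0 a) + fps_X * fps_const (g a))" if "a \<in> V" for a
    using that by (simp add: p_def deformation_def g'_def)
  have "alg_indep V p"
    unfolding alg_indep_def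
  proof (intro allI impI, elim conjE)
    fix P :: "('n monom \<times> nat) monom \<Rightarrow>\<^sub>0 int" assume P: "vars_in V P" "P \<noteq> 0"
    have "evalp of_int P p = evalp of_int P (\<lambda>a. fps_to_fls (fps_const (p0 a) + fps_X * fps_const (g a)))"
      unfolding evalp_def mon_def
    proof (intro sum.cong prod.cong refl arg_cong2[where f = "(*)"])
      fix m a assume "m \<in> Poly_Mapping.keys P" "a \<in> Poly_Mapping.keys m"
      then have "a \<in> V" using P(1) by (auto simp: vars_in_def)
      then show "p a ^ Poly_Mapping.lookup m a = fps_to_fls (fps_const (p0 a) + fps_X * fps_const (g a)) ^ Poly_Mapping.lookup m a"
        by (simp add: pV)
    qed
    moreover have "alg_indep V (\<lambda>a. fps_to_fls (fps_const (p0 a) + fps_X * fps_const (g a)))"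
      by (rule alg_indep_perturb) (use indep in \<open>simp add: V_def\<close>)
    ultimately show "evalp of_int P p \<noteq> 0"
      using P by (simp add: alg_indep_def)
  qed
  moreover have "countable V" by (rule countable_finite) (simp add: V_def)
  moreover have "alg_indep V g" using indep by (simp add: V_def)
  ultimately have "\<exists>K h. field_hom_on K h \<and> countable K \<and> (\<forall>a\<in>V. p a \<in> K \<and> h (p a) = g a)"
    by (intro field_hom_alg_indep)
  then obtain K0 h0 where K0: "field_hom_on K0 h0" "countable K0" "\<forall>a\<in>V. p a \<in> K0 \<and> h0 (p a) = g a"
    by (elim exE conjE) (rule that)
  \<comment> \<open>Everything the homomorphism must be defined on beyond the coefficients of the
    pencil: the certificate and the sections, a finite set.\<close>
  define E where "E = (\<Union>a\<in>bimons d k. A a ` cobimons N d k) \<union> (\<Union>r\<in>\<Xi>' \<times> {..D}. B r ` bimons d k)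
     \<union> (\<Union>X\<in>\<Xi>'. \<Union>v. set (coeffs (X v)))"
  have "finite E" unfolding E_def using fin' by auto
  from field_hom_extend_finite[OF this K0(1,2)]
  obtain K h where K: "field_hom_on K h" "K0 \<union> E \<subseteq> K" "\<forall>x\<in>K0. h x = h0 x"
    by (elim exE conjE) (rule that)
  note fh = K(1)
  have pK: "p a \<in> K \<and> h (p a) = g a" if a: "a \<in> bimons N 1" for a
  proof (cases "a \<in> V")
    case True
    then show ?thesis using K0(3) K by auto
  next
    case False
    \<comment> \<open>At these indices p and g have the same value, 0 or 1, which every field
      homomorphism fixes.\<close>
    then have "a \<in> {(m1, 0), (m1, 1), (m2, 0), (m2, 1)}" using a by (auto simp: V_def bimons_def le_Suc_eq)
    moreover have "p a = fps_to_fls (fps_const (p0 a))" using False by (simp add: p_def deformation_def g'_def)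
    ultimately show ?thesis
      using g lookup_F_m1 lookup_F_m2[OF Jne] fh_0[OF fh] fh_1[OF fh] by (auto simp: p0_def m12)
  qed
  have XK: "X v \<in> coeffs_in K" if "X \<in> \<Xi>'" for X v
    unfolding coeffs_in_def[OF fh]
  proof (intro CollectI allI)
    fix i
    show "coeff (X v) i \<in> K"
    proof (cases "coeff (X v) i = 0")
      case False
      then have "coeff (X v) i \<in> set (coeffs (X v))"
        by (metis coeff_in_coeffs coeff_0 le_degree)
      then have "coeff (X v) i \<in> (\<Union>X\<in>\<Xi>'. \<Union>v. set (coeffs (X v)))"
        by (intro UN_I[OF \<open>X \<in> \<Xi>'\<close>] UN_I[OF UNIV_I])
      then have "coeff (X v) i \<in> E" unfolding E_def by (rule UnI2)
      then show ?thesis using K(2) by blast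
    qed (use fh_0[OF fh] in simp)
  qed
  define \<Xi>'' where "\<Xi>'' = (\<lambda>X v. map_poly h (X v)) ` \<Xi>'"
  show ?thesis
  proof (intro exI[of _ \<Xi>''] conjI ballI allI impI)
    show "finite \<Xi>''" using fin' by (simp add: \<Xi>''_def)
    fix X assume "X \<in> \<Xi>''"
    then obtain Y where Y: "Y \<in> \<Xi>'" "X = (\<lambda>v. map_poly h (Y v))" by (auto simp: \<Xi>''_def)
    show "\<exists>v. X v \<noteq> 0"
    proof -
      obtain v where "Y v \<noteq> 0" using nz' Y(1) by blast
      then obtain i where "coeff (Y v) i \<noteq> 0" by (metis leading_coeff_0_iff)
      moreover have "coeff (Y v) i \<in> K" using XK[OF Y(1)] by (simp add: coeffs_in_def[OF fh])
      ultimately have "coeff (X v) i \<noteq> 0" by (simp add: Y(2) coeff_map_h[OF fh] fh_eq_0_iff[OF fh])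
      then have "X v \<noteq> 0" by (metis coeff_0)
      then show ?thesis by (rule exI)
    qed
    have t: "[:p a:] * bmon a Y [:0, 1:] \<in> coeffs_in K \<and> map_poly h ([:p a:] * bmon a Y [:0, 1:]) = [:g a:] * bmon a X [:0, 1:]"
      if "a \<in> bimons N 1" for a
    proof -
      have "[:p a:] \<in> coeffs_in K" "map_poly h [:p a:] = [:g a:]"
        using pK[OF that] fh_0[OF fh] by (auto simp: coeffs_in_def[OF fh] coeff_pCons map_poly_pCons split: nat.splits)
      moreover have "bmon a Y [:0, 1:] \<in> coeffs_in K"
          "map_poly h (bmon a Y [:0, 1:]) = bmon a X [:0, 1:]"
        using map_h_bmon[OF fh XK[OF Y(1)], of a] by (simp_all only: Y(2))
      ultimately show ?thesis
        using coeffs_in_mult[OF fh] map_h_mult[OF fh] by (simp del: mult_pCons_left)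
    qed
    have "beval (bimons N 1) (\<lambda>a. [:a:]) g X [:0, 1:] = map_poly h (beval (bimons N 1) (\<lambda>a. [:a:]) p Y [:0, 1:])"
      unfolding beval_def using map_h_sum[OF fh, of "bimons N 1" "\<lambda>a. [:p a:] * bmon a Y [:0, 1:]"] t by simp
    then show "beval (bimons N 1) (\<lambda>a. [:a:]) g X [:0, 1:] = 0" using sec'[OF Y(1)] by simp
  next
    fix f assume van: "\<forall>X\<in>\<Xi>''. beval (bimons d k) (\<lambda>a. [:a:]) f X [:0, 1:] = 0"
    have "\<exists>q. \<forall>b\<in>bimons d k. f b = pmul N d k (\<lambda>a. h (p a)) q b"
    proof (rule transfer_multiple_of_pencil[OF fh fin' cert])
      show "beval (bimons d k) (\<lambda>a. [:a:]) f (\<lambda>v. map_poly h (X v)) [:0, 1:] = 0" if "X \<in> \<Xi>'" for X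
        using van that by (auto simp: \<Xi>''_def)
      show "A a c \<in> K" if "a \<in> bimons d k" "c \<in> cobimons N d k" for a c
      proof -
        have "A a c \<in> E" unfolding E_def using that by blast
        then show ?thesis using K(2) by blast
      qed
      show "B r b \<in> K" if "r \<in> \<Xi>' \<times> {..D}" "b \<in> bimons d k" for r b
      proof -
        have "B r b \<in> E" unfolding E_def using that by blast
        then show ?thesis using K(2) by blast
      qed
    qed (use pK XK in simp_all)
    moreover have "pmul N d k (\<lambda>a. h (p a)) q b = pmul N d k g q b" for q b
      unfolding pmul_def using pK by (intro sum.cong refl) auto
    ultimately show "\<exists>q. \<forall>b\<in>bimons d k. f b = pmul N d k g q b" by simp
  qed
qed

unbundle no fps_syntax
unbundle vec_syntax

section \<open>Sections over the projective line\<close>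

definition homogenize :: "nat \<Rightarrow> complex poly \<Rightarrow> complex \<Rightarrow> complex \<Rightarrow> complex" where
  "homogenize e P s t = (\<Sum>i\<le>e. coeff P i * s ^ (e - i) * t ^ i)"

lemma homogenize_1: "degree P \<le> e \<Longrightarrow> homogenize e P 1 t = poly P t"
  by (simp add: homogenize_def poly_altdef)
     (rule sum.mono_neutral_right, auto simp: coeff_eq_0)

lemma homogenize_scale: "homogenize e P (c * s) (c * t) = c ^ e * homogenize e P s t"
  unfolding homogenize_def sum_distrib_left
proof (intro sum.cong refl)
  fix i assume "i \<in> {..e}"
  then have "c ^ e = c ^ (e - i) * c ^ i" by (simp add: power_add[symmetric])
  then show "coeff P i * (c * s) ^ (e - i) * (c * t) ^ i = c ^ e * (coeff P i * s ^ (e - i) * t ^ i)"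
    by (simp add: power_mult_distrib)
qed

lemma homogenize_nz: "degree P \<le> e \<Longrightarrow> s \<noteq> 0 \<Longrightarrow> homogenize e P s t = s ^ e * poly P (t / s)"
  using homogenize_scale[of e P s 1 "t / s"] by (simp add: homogenize_1)

lemma homogenize_0: "homogenize e P 0 t = coeff P e * t ^ e"
proof -
  have "homogenize e P 0 t = (\<Sum>i\<le>e. if i = e then coeff P e * t ^ e else 0)"
    unfolding homogenize_def by (intro sum.cong refl) auto
  then show ?thesis by simp
qed

lemma homogenize_mult:
  assumes "degree P \<le> e" "degree Q \<le> e'"
  shows "homogenize e P s t * homogenize e' Q s t = homogenize (e + e') (P * Q) s t"
proof (cases "s = 0")
  case True
  then show ?thesis using coeff_mult_top[OF assms] by (simp add: homogenize_0 power_add)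
next
  case False
  then show ?thesis using assms degree_mult_le_add[OF assms] by (simp add: homogenize_nz power_add)
qed

definition binary_form :: "nat \<Rightarrow> (complex \<Rightarrow> complex \<Rightarrow> complex) \<Rightarrow> bool" where
  "binary_form k \<Phi> \<longleftrightarrow> (\<exists>q. degree q \<le> k \<and> (\<forall>s t. \<Phi> s t = homogenize k q s t))"

lemma binary_form_mult:
  "binary_form k \<Phi> \<Longrightarrow> binary_form l \<Psi> \<Longrightarrow> binary_form (k + l) (\<lambda>s t. \<Phi> s t * \<Psi> s t)"
  unfolding binary_form_def
  by (elim exE, rule_tac x = "q * qa" in exI) (auto simp: homogenize_mult intro: degree_mult_le_add)

lemma binary_form_one: "binary_form 0 (\<lambda>s t. 1)"
  unfolding binary_form_def by (intro exI[of _ 1]) (simp add: homogenize_def)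

lemma binary_form_linear: "binary_form 1 (\<lambda>s t. a * s + b * t)"
  unfolding binary_form_def by (intro exI[of _ "[:a, b:]"]) (simp add: homogenize_def)

lemma binary_form_power: "binary_form 1 \<Phi> \<Longrightarrow> binary_form k (\<lambda>s t. \<Phi> s t ^ k)"
proof (induction k)
  case (Suc k)
  then show ?case using binary_form_mult[of 1 \<Phi> k "\<lambda>s t. \<Phi> s t ^ k"] by simp
qed (simp add: binary_form_one)

definition hbeval :: "nat \<Rightarrow> ('v monom \<times> nat) set \<Rightarrow> ('v monom \<times> nat \<Rightarrow> complex) \<Rightarrow> ('v \<Rightarrow> complex) \<Rightarrow> complex \<Rightarrow> complex \<Rightarrow> complex" where
  "hbeval k S f x s t = (\<Sum>b\<in>S. f b * (mon (fst b) x * s ^ (k - snd b) * t ^ snd b))"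

lemma hbeval_1: "hbeval k S f x 1 t = beval S (\<lambda>c. c) f x t"
  by (simp add: hbeval_def beval_def bmon_def)

lemma hbeval_nz:
  assumes "s \<noteq> 0" "\<And>b. b \<in> S \<Longrightarrow> snd b \<le> k"
  shows "hbeval k S f x s t = s ^ k * beval S (\<lambda>c. c) f x (t / s)"
  unfolding hbeval_def beval_def sum_distrib_left bmon_def
proof (intro sum.cong refl)
  fix b assume "b \<in> S"
  then have "s ^ k = s ^ (k - snd b) * s ^ snd b" using assms by (simp add: power_add[symmetric])
  then show "f b * (mon (fst b) x * s ^ (k - snd b) * t ^ snd b) = s ^ k * (f b * (mon (fst b) x * (t / s) ^ snd b))"
    using assms(1) by (simp add: power_divide)
qed

lemma mon_Plus:
  fixes M :: "('m::finite + 'n::finite) monom"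
  shows "mon M (case_sum x y) = mon (Poly_Mapping.map_key Inl M) x * mon (Poly_Mapping.map_key Inr M) y"
proof -
  have "mon M (case_sum x y) = (\<Prod>v\<in>UNIV <+> UNIV. case_sum x y v ^ Poly_Mapping.lookup M v)"
    by (simp add: mon_superset[of UNIV])
  also have "\<dots> = (\<Prod>u\<in>UNIV. x u ^ Poly_Mapping.lookup M (Inl u)) * (\<Prod>v\<in>UNIV. y v ^ Poly_Mapping.lookup M (Inr v))"
    by (subst prod.Plus) auto
  also have "\<dots> = mon (Poly_Mapping.map_key Inl M) x * mon (Poly_Mapping.map_key Inr M) y"
    by (simp add: mon_superset[of UNIV] map_key.rep_eq)
  finally show ?thesis .
qed

text \<open>The closed set is given in the base coordinates of an arbitrary basis of the pencil, the
  sections in those of the echelon basis. After a linear change each base monomial of degree k is a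
  binary form of degree k, whose coefficients are collected by the monomial in x.\<close>

lemma bihomogeneous_substitution:
  fixes F :: "('n::finite + 2) cpoly"
  assumes F: "bihomogeneous d k F"
  shows "\<exists>f. \<forall>x s t. cpoly_eval F (case_sum x (\<lambda>i. if i = 1 then a * s + b * t else c * s + e * t)) = hbeval k (bimons d k) f x s t"
proof -
  let ?y = "\<lambda>s t (i::2). if i = 1 then a * s + b * t else c * s + e * t"
  let ?L = "\<lambda>M. Poly_Mapping.map_key Inl M" and ?R = "\<lambda>M. Poly_Mapping.map_key Inr M"
  have L: "monom_degree (?L M) = d" "monom_degree (?R M) = k" if "M \<in> Poly_Mapping.keys F" for M
  proof -
    have "Poly_Mapping.keys (?L M) = {u. Inl u \<in> Poly_Mapping.keys M}" "Poly_Mapping.keys (?R M) = {u. Inr u \<in> Poly_Mapping.keys M}"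
      by (auto simp: in_keys_iff map_key.rep_eq)
    then show "monom_degree (?L M) = d" "monom_degree (?R M) = k"
      using F that by (auto simp: bihomogeneous_def monom_degree_def map_key.rep_eq)
  qed
  have "\<exists>q. degree q \<le> k \<and> (\<forall>s t. mon (?R M) (?y s t) = homogenize k q s t)" if M: "M \<in> Poly_Mapping.keys F" for M
  proof -
    let ?i = "Poly_Mapping.lookup (?R M) 1" and ?j = "Poly_Mapping.lookup (?R M) 2"
    have "monom_degree (?R M) = ?i + ?j" by (subst monom_degree_superset[of UNIV]) (auto simp: sum_2)
    then have ij: "?i + ?j = k" using L(2)[OF M] by simp
    have "binary_form (?i + ?j) (\<lambda>s t. (a * s + b * t) ^ ?i * (c * s + e * t) ^ ?j)"
      by (intro binary_form_mult binary_form_power binary_form_linear)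
    moreover have "mon (?R M) (?y s t) = (a * s + b * t) ^ ?i * (c * s + e * t) ^ ?j" for s t
    proof -
      have "mon (?R M) (?y s t) = (\<Prod>i\<in>UNIV. ?y s t i ^ Poly_Mapping.lookup (?R M) i)"
        by (rule mon_superset) auto
      then show ?thesis by (simp add: UNIV_2)
    qed
    ultimately show ?thesis unfolding ij binary_form_def by simp
  qed
  then have "\<forall>M\<in>Poly_Mapping.keys F. \<exists>q. degree q \<le> k \<and> (\<forall>s t. mon (?R M) (?y s t) = homogenize k q s t)" by blast
  from bchoice[OF this] obtain q where q: "\<And>M s t. M \<in> Poly_Mapping.keys F \<Longrightarrow> mon (?R M) (?y s t) = homogenize k (q M) s t"
    by blast
  define f where "f b = (\<Sum>M\<in>Poly_Mapping.keys F. if ?L M = fst b then Poly_Mapping.lookup F M * coeff (q M) (snd b) else 0)" for b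
  have "cpoly_eval F (case_sum x (?y s t)) = hbeval k (bimons d k) f x s t" for x s t
  proof -
    have "hbeval k (bimons d k) f x s t = (\<Sum>b\<in>bimons d k. \<Sum>M\<in>Poly_Mapping.keys F.
        if ?L M = fst b then Poly_Mapping.lookup F M * coeff (q M) (snd b) * (mon (fst b) x * s ^ (k - snd b) * t ^ snd b) else 0)"
      unfolding hbeval_def f_def sum_distrib_right by (intro sum.cong refl) auto
    also have "\<dots> = (\<Sum>M\<in>Poly_Mapping.keys F. \<Sum>b\<in>bimons d k.
        if ?L M = fst b then Poly_Mapping.lookup F M * coeff (q M) (snd b) * (mon (fst b) x * s ^ (k - snd b) * t ^ snd b) else 0)"
      by (rule sum.swap)
    also have "\<dots> = (\<Sum>M\<in>Poly_Mapping.keys F. Poly_Mapping.lookup F M * mon M (case_sum x (?y s t)))"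
    proof (intro sum.cong refl)
      fix M assume M: "M \<in> Poly_Mapping.keys F"
      have "(\<Sum>b\<in>bimons d k. if ?L M = fst b then Poly_Mapping.lookup F M * coeff (q M) (snd b) * (mon (fst b) x * s ^ (k - snd b) * t ^ snd b) else 0)
        = (\<Sum>m\<in>mons d. \<Sum>j\<le>k. if ?L M = m then Poly_Mapping.lookup F M * coeff (q M) j * (mon m x * s ^ (k - j) * t ^ j) else 0)"
        unfolding bimons_def sum.cartesian_product by (intro sum.cong refl) auto
      also have "\<dots> = (\<Sum>m\<in>mons d. if ?L M = m then \<Sum>j\<le>k. Poly_Mapping.lookup F M * coeff (q M) j * (mon m x * s ^ (k - j) * t ^ j) else 0)"
        by (intro sum.cong refl) auto
      also have "\<dots> = (\<Sum>j\<le>k. Poly_Mapping.lookup F M * coeff (q M) j * (mon (?L M) x * s ^ (k - j) * t ^ j))"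
        using L(1)[OF M] by (simp add: mons_def finite_monom_degree)
      also have "\<dots> = Poly_Mapping.lookup F M * (mon (?L M) x * homogenize k (q M) s t)"
        unfolding homogenize_def sum_distrib_left by (intro sum.cong refl) (simp add: mult_ac)
      also have "\<dots> = Poly_Mapping.lookup F M * mon M (case_sum x (?y s t))"
        unfolding mon_Plus q[OF M] ..
      finally show "(\<Sum>b\<in>bimons d k. if ?L M = fst b then Poly_Mapping.lookup F M * coeff (q M) (snd b) * (mon (fst b) x * s ^ (k - snd b) * t ^ snd b) else 0)
        = Poly_Mapping.lookup F M * mon M (case_sum x (?y s t))" .
    qed
    also have "\<dots> = cpoly_eval F (case_sum x (?y s t))"
      by (simp add: cpoly_eval_evalp evalp_def)
    finally show ?thesis ..
  qed
  then show ?thesis by blast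
qed

lemma eq_0_by_continuity:
  fixes \<Phi> :: "complex \<Rightarrow> complex"
  assumes "continuous_on UNIV \<Phi>" "\<And>s. s \<noteq> 0 \<Longrightarrow> \<Phi> s = 0"
  shows "\<Phi> s = 0"
proof (cases "s = 0")
  case True
  have "(\<Phi> \<longlongrightarrow> \<Phi> 0) (at 0)" using assms(1) by (simp add: continuous_on_def)
  moreover have "(\<Phi> \<longlongrightarrow> 0) (at 0)"
  proof (rule Lim_transform_eventually)
    show "((\<lambda>_. 0) \<longlongrightarrow> (0::complex)) (at 0)" by simp
    show "\<forall>\<^sub>F s in at 0. 0 = \<Phi> s" using assms(2) by (auto simp: eventually_at intro!: exI[of _ 1])
  qed
  ultimately show ?thesis using True by (metis LIM_unique)
qed (use assms in simp)

lemma continuous_on_mon: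
  assumes "\<And>v. continuous_on S (\<lambda>s. X s v :: complex)"
  shows "continuous_on S (\<lambda>s. mon m (X s))"
  unfolding mon_def by (intro continuous_on_prod continuous_on_power assms)

lemma continuous_on_hbeval: "continuous_on S (\<lambda>s. hbeval k B f x s t)"
  unfolding hbeval_def by (intro continuous_intros)

lemma continuous_on_homogenize: "continuous_on S (\<lambda>s. homogenize e P s t)"
  unfolding homogenize_def by (intro continuous_intros)

text \<open>Dehomogenising loses the fibre s = 0; continuity in s recovers it.\<close>

lemma multiple_vanishes_on_total_space:
  fixes g :: "'v::finite monom \<times> nat \<Rightarrow> complex"
  assumes f: "\<And>b. b \<in> bimons d k \<Longrightarrow> f b = pmul N d k g q b"
    and 0: "hbeval 1 (bimons N 1) g x s t = 0"
  shows "hbeval k (bimons d k) f x s t = 0"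
proof -
  define R where "R s = hbeval (k - 1) (cobimons N d k) q x s t" for s
  have "hbeval k (bimons d k) f x s t - hbeval 1 (bimons N 1) g x s t * R s = 0" for s
  proof (rule eq_0_by_continuity[where \<Phi> = "\<lambda>s. hbeval k (bimons d k) f x s t - hbeval 1 (bimons N 1) g x s t * R s"])
    show "continuous_on UNIV (\<lambda>s. hbeval k (bimons d k) f x s t - hbeval 1 (bimons N 1) g x s t * R s)"
      unfolding R_def by (intro continuous_intros continuous_on_hbeval)
    fix s :: complex assume s: "s \<noteq> 0"
    have "hbeval k (bimons d k) f x s t = s ^ k * beval (bimons d k) (\<lambda>c. c) (pmul N d k g q) x (t / s)"
      using s f by (subst hbeval_nz) (auto simp: beval_def bimons_def)
    also have "\<dots> = s ^ k * (beval (bimons N 1) (\<lambda>c. c) g x (t / s) * beval (cobimons N d k) (\<lambda>c. c) q x (t / s))"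
      unfolding beval_pmul[OF rhom_id] ..
    also have "\<dots> = hbeval 1 (bimons N 1) g x s t * R s"
    \<comment> \<open>For k = 0 there are no cofactors and both sides vanish, so the truncated k - 1
      does no harm.\<close>
    proof (cases "k = 0")
      case True
      then have "cobimons N d k = ({} :: ('v monom \<times> nat) set)" by (auto simp: cobimons_def)
      then show ?thesis by (simp add: beval_def R_def hbeval_def)
    next
      case False
      then have "R s = s ^ (k - 1) * beval (cobimons N d k) (\<lambda>c. c) q x (t / s)"
        unfolding R_def using s by (subst hbeval_nz) (auto simp: cobimons_def split: if_splits)
      moreover have "hbeval 1 (bimons N 1) g x s t = s * beval (bimons N 1) (\<lambda>c. c) g x (t / s)"
        using s by (subst hbeval_nz) (auto simp: bimons_def)
      moreover have "s ^ k = s * s ^ (k - 1)" using False by (simp add: power_eq_if)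
      ultimately show ?thesis by simp
    qed
    finally show "hbeval k (bimons d k) f x s t - hbeval 1 (bimons N 1) g x s t * R s = 0" by simp
  qed
  then show ?thesis using 0 by simp
qed

text \<open>A transferred section may have coordinates with common roots, where it defines no point.
  Common linear factors are divided out; the degree of a nonzero coordinate decreases each
  time.\<close>

lemma remove_common_zeros:
  fixes X :: "'v \<Rightarrow> complex poly"
  assumes "X v0 \<noteq> 0"
  shows "\<exists>\<gamma> Y. \<gamma> \<noteq> 0 \<and> (\<forall>v. X v = \<gamma> * Y v) \<and> (\<forall>s. \<exists>v. poly (Y v) s \<noteq> 0)"
  using assms
proof (induction "degree (X v0)" arbitrary: X rule: less_induct)
  case less
  show ?case
  proof (cases "\<exists>r. \<forall>v. poly (X v) r = 0")
    case True
    then obtain r where "\<forall>v. [:- r, 1:] dvd X v" by (auto simp: poly_eq_0_iff_dvd)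
    then obtain X' where X': "\<And>v. X v = [:- r, 1:] * X' v" unfolding dvd_def by metis
    then have "X' v0 \<noteq> 0" using less.prems by auto
    moreover then have "degree (X' v0) < degree (X v0)" unfolding X' by (subst degree_mult_eq) auto
    ultimately obtain \<gamma> Y where "\<gamma> \<noteq> 0" "\<forall>v. X' v = \<gamma> * Y v" "\<forall>s. \<exists>v. poly (Y v) s \<noteq> 0"
      using less.hyps by blast
    then show ?thesis using X' by (intro exI[of _ "[:- r, 1:] * \<gamma>"] exI[of _ Y]) (auto simp: mult.assoc simp del: mult_pCons_left)
  next
    case False
    then show ?thesis by (intro exI[of _ 1] exI[of _ X]) auto
  qed
qed

lemma beval_scale:
  fixes Y :: "'v \<Rightarrow> 'a::comm_ring_1"
  shows "beval (bimons d k) h f (\<lambda>v. r * Y v) t = r ^ d * beval (bimons d k) h f Y t"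
  unfolding beval_def sum_distrib_left
  by (intro sum.cong refl) (auto simp: bmon_def bimons_def mons_def mon_scale mult_ac)

section \<open>Points, scaling and morphisms of projective spaces\<close>

lemma proj_space_span:
  assumes "M \<in> proj_space" "s \<in> M" "s \<noteq> 0"
  shows "M = vec.span {s}"
proof
  have M: "vec.subspace M" "vec.dim M = 1" using assms by (auto simp: proj_space_def)
  show "vec.span {s} \<subseteq> M" using M assms by (intro vec.span_minimal) auto
  show "M \<subseteq> vec.span {s}"
    using assms M by (intro vec.card_ge_dim_independent) (auto simp: vec.dependent_single)
qed

lemma proj_space_nonzero:
  fixes M :: "(complex ^ 'n) set"
  assumes "M \<in> proj_space" shows "\<exists>s\<in>M. s \<noteq> 0"
proof (rule ccontr)
  assume "\<not> ?thesis"
  then have "M \<subseteq> {0}" by auto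
  then have "vec.dim M \<le> vec.dim {0 :: complex ^ 'n}" by (rule vec.dim_subset)
  moreover have "vec.dim {0 :: complex ^ 'n} = 0" by (metis vec.dim_empty vec.dim_span vec.span_empty)
  moreover have "vec.dim M = 1" using assms by (simp add: proj_space_def)
  ultimately show False by linarith
qed

lemma span_in_proj_space: assumes "v \<noteq> 0" shows "vec.span {v} \<in> proj_space"
proof -
  have "vec.dim (vec.span {v}) = card {v}"
    using assms by (subst vec.dim_span) (intro vec.dim_eq_card_independent, simp add: vec.dependent_single)
  then show ?thesis by (simp add: proj_space_def vec.subspace_span)
qed

lemma line_scale:
  fixes v :: "complex ^ 'n"
  assumes "c \<noteq> 0" "v \<noteq> 0" shows "vec.span {c *s v} = vec.span {v}"
  by (rule proj_space_span[symmetric, OF span_in_proj_space[OF assms(2)]])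
     (use assms in \<open>auto intro: vec.span_scale vec.span_base simp: vec.scale_eq_0_iff\<close>)

lemma hform_power: "hform d F \<Longrightarrow> hform (k * d) (\<lambda>x. F x ^ k)"
proof (induction k)
  case 0
  then show ?case using hform_const[of 1] by simp
next
  case (Suc k)
  then show ?case using hform_mult[of d F "k * d" "\<lambda>x. F x ^ k"] by simp
qed

lemma proj_closed_empty: "proj_closed {}"
proof -
  have "{L \<in> proj_space. \<forall>F\<in>{1}. \<forall>x\<in>L. cpoly_eval F (\<lambda>i. x $ i) = 0} = {}"
    using proj_space_nonzero by (auto simp: cpoly_eval_evalp evalp_one[OF rhom_id])
  then show ?thesis unfolding proj_closed_def
    by (intro exI[of _ "{1}"]) (auto simp: homogeneous_one intro!: exI[of _ 0])
qed

text \<open>One homogeneous representative without zeros works on the whole source, so the excluded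
  closed set is always empty.\<close>

lemma proj_morphismI:
  fixes h :: "complex ^ 'm \<Rightarrow> complex ^ 'n" and \<phi> :: "(complex ^ 'm) set \<Rightarrow> (complex ^ 'n) set"
  assumes h: "\<And>i. hform d (\<lambda>x. h (\<chi> j. x j) $ i)" and nz: "\<And>x. x \<noteq> 0 \<Longrightarrow> h x \<noteq> 0"
    and \<phi>: "\<And>M x. M \<in> proj_space \<Longrightarrow> x \<in> M \<Longrightarrow> x \<noteq> 0 \<Longrightarrow> \<phi> M = vec.span {h x}"
  shows "proj_morphism \<phi>"
proof -
  have "\<forall>i. \<exists>P. homogeneous d P \<and> (\<forall>x. h (\<chi> j. x j) $ i = cpoly_eval P x)"
    using h by (auto simp: hform_def cpoly_eval_evalp)
  then obtain F where F: "\<And>i. homogeneous d (F i)" "\<And>i x. h (\<chi> j. x j) $ i = cpoly_eval (F i) x" by metis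
  have "(\<chi> i. cpoly_eval (F i) (\<lambda>j. x $ j)) = h x" for x
    by (simp add: F(2)[symmetric] vec_eq_iff)
  then show ?thesis unfolding proj_morphism_def
    using F(1) nz \<phi> proj_closed_empty by (intro ballI exI[of _ "{}"] exI[of _ d] exI[of _ F]) auto
qed

text \<open>g holds the echelon basis, and (a, b), (c, e) are the coordinates of f1, f2 in it.
  Accordingly \<open>ls\<close> and \<open>lt\<close> below are the base coordinates with respect to
  the echelon basis.\<close>

locale based_pencil =
  fixes g :: "'n::finite monom \<times> nat \<Rightarrow> complex" and f1 f2 :: "'n cpoly" and a b c e :: complex and N :: nat
  assumes f1: "\<And>x. cpoly_eval f1 x = hbeval 1 (bimons N 1) g x a b"
    and f2: "\<And>x. cpoly_eval f2 x = hbeval 1 (bimons N 1) g x c e"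
    and det: "a * e - b * c \<noteq> 0"
begin

definition ls :: "complex ^ 2 \<Rightarrow> complex" where "ls s = a * s $ 1 + c * s $ 2"
definition lt :: "complex ^ 2 \<Rightarrow> complex" where "lt s = b * s $ 1 + e * s $ 2"

lemma hbeval_linear: "hbeval 1 (bimons N 1) g x s t = s * hbeval 1 (bimons N 1) g x 1 0 + t * hbeval 1 (bimons N 1) g x 0 1"
  unfolding hbeval_def sum_distrib_left sum.distrib[symmetric]
proof (intro sum.cong refl)
  fix a :: "'n monom \<times> nat" assume "a \<in> bimons N 1"
  then have "snd a = 0 \<or> snd a = 1" by (auto simp: bimons_def)
  then show "g a * (mon (fst a) x * s ^ (1 - snd a) * t ^ snd a) =
    s * (g a * (mon (fst a) x * 1 ^ (1 - snd a) * 0 ^ snd a)) + t * (g a * (mon (fst a) x * 0 ^ (1 - snd a) * 1 ^ snd a))"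
    by auto
qed

lemma pencil_eq: "s $ 1 * cpoly_eval f1 x + s $ 2 * cpoly_eval f2 x = hbeval 1 (bimons N 1) g x (ls s) (lt s)"
  unfolding f1 f2 hbeval_linear[of x a b] hbeval_linear[of x c e] hbeval_linear[of x "ls s" "lt s"]
  by (simp add: ls_def lt_def algebra_simps)

lemma l_zero: assumes "ls s = 0" "lt s = 0" shows "s = 0"
proof -
  have "(a * e - b * c) * s $ 1 = e * ls s - c * lt s" "(a * e - b * c) * s $ 2 = a * lt s - b * ls s"
    by (simp_all add: ls_def lt_def algebra_simps)
  then have "s $ 1 = 0" "s $ 2 = 0" using assms det by auto
  then show ?thesis by (simp add: vec_eq_iff forall_2)
qed

text \<open>Homogenising to the maximal degree d leaves some top coefficient nonzero, so there is no
  common zero at infinity either and the homogenised coordinates define a morphism.\<close>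

lemma section_of_coprime:
  fixes Y :: "'n \<Rightarrow> complex poly"
  assumes Y: "beval (bimons N 1) (\<lambda>a. [:a:]) g Y [:0, 1:] = 0" and cop: "\<And>s. \<exists>v. poly (Y v) s \<noteq> 0"
  shows "\<exists>\<sigma> d. pencil_section f1 f2 \<sigma> \<and> (\<forall>v. degree (Y v) \<le> d) \<and>
    (\<forall>M\<in>proj_space. \<forall>s\<in>M. (\<chi> v. homogenize d (Y v) (ls s) (lt s)) \<in> fst (\<sigma> M))"
proof -
  define d where "d = Max (range (\<lambda>v. degree (Y v)))"
  have d: "degree (Y v) \<le> d" for v by (simp add: d_def)
  have "\<exists>v. coeff (Y v) d \<noteq> 0"
  proof (cases "d = 0")
    case True
    obtain v where v: "poly (Y v) 0 \<noteq> 0" using cop by blast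
    then show ?thesis using True by (intro exI[of _ v]) (simp add: poly_0_coeff_0)
  next
    case False
    have "d \<in> range (\<lambda>v. degree (Y v))" unfolding d_def by (intro Max_in) auto
    then obtain v where "degree (Y v) = d" by auto
    then show ?thesis using False by (intro exI[of _ v]) auto
  qed
  then obtain v0 where v0: "coeff (Y v0) d \<noteq> 0" by blast
  define h where "h s = (\<chi> v. homogenize d (Y v) (ls s) (lt s))" for s
  have hscale: "h (r *s s) = r ^ d *s h s" for r s
  proof -
    have "ls (r *s s) = r * ls s" "lt (r *s s) = r * lt s" by (simp_all add: ls_def lt_def algebra_simps)
    then show ?thesis by (simp add: h_def vec_eq_iff homogenize_scale)
  qed
  have hnz: "h s \<noteq> 0" if "s \<noteq> 0" for s
  proof (cases "ls s = 0")
    case True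
    then have "lt s \<noteq> 0" using l_zero that by blast
    then have "h s $ v0 \<noteq> 0" using v0 True by (simp add: h_def homogenize_0)
    then show ?thesis by auto
  next
    case False
    obtain v where "poly (Y v) (lt s / ls s) \<noteq> 0" using cop by blast
    then have "h s $ v \<noteq> 0" using False by (simp add: h_def homogenize_nz[OF d])
    then show ?thesis by auto
  qed
  have eq0: "hbeval 1 (bimons N 1) g (\<lambda>v. homogenize d (Y v) s t) s t = 0" for s t
  proof (rule eq_0_by_continuity[where \<Phi> = "\<lambda>s. hbeval 1 (bimons N 1) g (\<lambda>v. homogenize d (Y v) s t) s t"])
    show "continuous_on UNIV (\<lambda>s. hbeval 1 (bimons N 1) g (\<lambda>v. homogenize d (Y v) s t) s t)"
      unfolding hbeval_def by (intro continuous_intros continuous_on_mon continuous_on_homogenize)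
    fix s :: complex assume s: "s \<noteq> 0"
    have ev: "rhom (\<lambda>p. poly p (t / s))" by (simp add: rhom_def)
    have "poly (beval (bimons N 1) (\<lambda>a. [:a:]) g Y [:0, 1:]) (t / s) = 0" using Y by simp
    then have "beval (bimons N 1) (\<lambda>c. c) g (\<lambda>v. poly (Y v) (t / s)) (t / s) = 0"
      unfolding beval_rhom[OF ev] by simp
    then have "beval (bimons N 1) (\<lambda>c. c) g (\<lambda>v. s ^ d * poly (Y v) (t / s)) (t / s) = 0"
      unfolding beval_scale by simp
    then show "hbeval 1 (bimons N 1) g (\<lambda>v. homogenize d (Y v) s t) s t = 0"
      using s by (subst hbeval_nz) (auto simp: bimons_def homogenize_nz[OF d])
  qed
  \<comment> \<open>Any nonzero vector of the line M gives the same span, because h is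
    homogeneous.\<close>
  define \<sigma> where "\<sigma> M = (vec.span {h (SOME s. s \<in> M \<and> s \<noteq> 0)}, M)" for M
  have \<sigma>: "fst (\<sigma> M) = vec.span {h s}" if M: "M \<in> proj_space" and s: "s \<in> M" "s \<noteq> 0" for M and s :: "complex ^ 2"
  proof -
    define s0 where "s0 = (SOME s. s \<in> M \<and> s \<noteq> 0)"
    have "\<exists>s. s \<in> M \<and> s \<noteq> 0" using proj_space_nonzero[OF M] by blast
    then have s0: "s0 \<in> M \<and> s0 \<noteq> 0" unfolding s0_def by (rule someI_ex)
    then have "s0 \<in> vec.span {s}" using proj_space_span[OF M s] by simp
    then obtain r where r: "s0 = r *s s" by (auto simp: vec.span_singleton)
    then have "r \<noteq> 0" using s0 by auto
    then have "vec.span {h s0} = vec.span {h s}" unfolding r hscale using hnz[OF s(2)] by (intro line_scale) auto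
    then show ?thesis by (simp add: \<sigma>_def s0_def)
  qed
  have "proj_morphism (fst \<circ> \<sigma>)"
  proof (rule proj_morphismI[where h = h and d = d])
    fix i
    have l1: "hform 1 (\<lambda>x. p * x j + q * x j')" for p q and j j' :: 2
      using hform_var_power[of 1 p j] hform_var_power[of 1 q j'] by (intro hform_add) simp_all
    have "hform d (\<lambda>x :: 2 \<Rightarrow> complex. \<Sum>k\<le>d. coeff (Y i) k * (a * x 1 + c * x 2) ^ (d - k) * (b * x 1 + e * x 2) ^ k)"
    proof (rule hform_sum)
      fix k assume "k \<in> {..d}"
      then have "0 + (d - k) * 1 + k * 1 = d" by simp
      moreover have "hform (0 + (d - k) * 1 + k * 1) (\<lambda>x :: 2 \<Rightarrow> complex. coeff (Y i) k * (a * x 1 + c * x 2) ^ (d - k) * (b * x 1 + e * x 2) ^ k)"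
        by (intro hform_mult hform_power hform_const l1)
      ultimately show "hform d (\<lambda>x :: 2 \<Rightarrow> complex. coeff (Y i) k * (a * x 1 + c * x 2) ^ (d - k) * (b * x 1 + e * x 2) ^ k)" by simp
    qed
    then show "hform d (\<lambda>x. h (\<chi> j. x j) $ i)" by (simp add: h_def homogenize_def ls_def lt_def)
  qed (use hnz \<sigma> in auto)
  moreover have "proj_morphism (snd \<circ> \<sigma>)"
  proof (rule proj_morphismI[where h = "\<lambda>x. x" and d = 1])
    show "hform 1 (\<lambda>x. (\<chi> j. x j) $ i)" for i :: 2 using hform_var_power[of 1 1 i] by simp
  qed (use proj_space_span in \<open>auto simp: \<sigma>_def\<close>)
  moreover have "\<sigma> M \<in> pencil_total f1 f2 \<and> snd (\<sigma> M) = M" if M: "M \<in> proj_space" for M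
  proof -
    obtain s where s: "s \<in> M" "s \<noteq> 0" using proj_space_nonzero[OF M] by blast
    have fs: "fst (\<sigma> M) = vec.span {h s}" using \<sigma>[OF M s] .
    have "s' $ 1 * cpoly_eval f1 (\<lambda>i. x $ i) + s' $ 2 * cpoly_eval f2 (\<lambda>i. x $ i) = 0"
      if x: "x \<in> vec.span {h s}" and s': "s' \<in> M" for x :: "complex ^ 'n" and s' :: "complex ^ 2"
    proof -
      obtain r where r: "x = r *s h s" using x by (auto simp: vec.span_singleton)
      obtain r' where r': "s' = r' *s s" using s' proj_space_span[OF M s] by (auto simp: vec.span_singleton)
      have l: "ls s' = r' * ls s" "lt s' = r' * lt s" by (simp_all add: r' ls_def lt_def algebra_simps)
      have "hbeval 1 (bimons N 1) g (\<lambda>v. r * homogenize d (Y v) (ls s) (lt s)) s0 t0 = r ^ N * hbeval 1 (bimons N 1) g (\<lambda>v. homogenize d (Y v) (ls s) (lt s)) s0 t0" for s0 t0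
      unfolding hbeval_def sum_distrib_left
        by (intro sum.cong refl) (auto simp: bimons_def mons_def mon_scale mult_ac)
      moreover have "hbeval 1 (bimons N 1) g y (r' * s0) (r' * t0) = r' * hbeval 1 (bimons N 1) g y s0 t0" for y s0 t0
        using hbeval_linear[of y "r' * s0" "r' * t0"] hbeval_linear[of y s0 t0] by (simp add: algebra_simps)
      moreover have "(\<lambda>i. x $ i) = (\<lambda>v. r * homogenize d (Y v) (ls s) (lt s))"
        by (simp add: r h_def fun_eq_iff)
      ultimately show ?thesis
        unfolding pencil_eq l using eq0[of "ls s" "lt s"] by simp
    qed
    then have "(vec.span {h s}, M) \<in> pencil_total f1 f2"
      using M hnz[OF s(2)] span_in_proj_space by (auto simp: pencil_total_def)
    moreover have "\<sigma> M = (vec.span {h s}, M)" using fs by (simp add: \<sigma>_def)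
    ultimately show ?thesis by simp
  qed
  ultimately have "pencil_section f1 f2 \<sigma>" by (simp add: pencil_section_def)
  moreover have "h s \<in> fst (\<sigma> M)" if M: "M \<in> proj_space" and s: "s \<in> M" for M and s :: "complex ^ 2"
  proof (cases "s = 0")
    case True
    obtain s' where s': "s' \<in> M" "s' \<noteq> 0" using proj_space_nonzero[OF M] by blast
    have "h s \<in> vec.span {h s'}"
    proof -
      \<comment> \<open>The power 0^d also covers d = 0, where h is constant and does not vanish at
        0.\<close>
      have "h s = 0 ^ d *s h s'" using hscale[of 0 s'] True by simp
      then show ?thesis by (simp add: vec.span_scale vec.span_base)
    qed
    then show ?thesis using \<sigma>[OF M s'] by simp
  next
    case False
    then show ?thesis using \<sigma>[OF M s False] by (simp add: vec.span_base)
  qed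
  ultimately show ?thesis using d unfolding h_def by blast
qed

text \<open>A form that defines Z vanishes on the sections, hence on the vectors X of its own
  bidegree, hence is a multiple of the pencil and vanishes on the whole total space.\<close>

lemma dense_sections:
  assumes sec: "\<And>d k. \<exists>\<Xi>. (\<forall>X\<in>\<Xi>. (\<exists>v. X v \<noteq> 0) \<and> beval (bimons N 1) (\<lambda>a. [:a:]) g X [:0, 1:] = 0) \<and>
    (\<forall>f. (\<forall>X\<in>\<Xi>. beval (bimons d k) (\<lambda>a. [:a:]) f X [:0, 1:] = 0) \<longrightarrow>
       (\<exists>q. \<forall>b\<in>bimons d k. f b = pmul N d k g q b))"
  shows "biproj_dense_in (pencil_total f1 f2) (\<Union>\<sigma>\<in>{\<sigma>. pencil_section f1 f2 \<sigma>}. \<sigma> ` proj_space)"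
  unfolding biproj_dense_in_def
proof (intro conjI allI impI)
  let ?A = "\<Union>\<sigma>\<in>{\<sigma>. pencil_section f1 f2 \<sigma>}. \<sigma> ` proj_space"
  show "?A \<subseteq> pencil_total f1 f2" by (auto simp: pencil_section_def)
  fix Z assume Z: "biproj_closed Z \<and> ?A \<subseteq> Z"
  then obtain S where S: "\<forall>F\<in>S. \<exists>d e. bihomogeneous d e F"
    "Z = {(L, M) \<in> proj_space \<times> proj_space. \<forall>F\<in>S. \<forall>x\<in>L. \<forall>y\<in>M. cpoly_eval F (case_sum (\<lambda>i. x $ i) (\<lambda>j. y $ j)) = 0}"
    by (auto simp: biproj_closed_def)
  have "cpoly_eval F (case_sum (\<lambda>i. x $ i) (\<lambda>j. s $ j)) = 0"
    if F: "F \<in> S" and tot: "(L, M) \<in> pencil_total f1 f2" and x: "x \<in> L" and s: "s \<in> M" for F L M and x :: "complex ^ 'n" and s :: "complex ^ 2"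
  proof -
    obtain d k where dk: "bihomogeneous d k F" using S(1) F by blast
    define D where "D = a * e - b * c"
    \<comment> \<open>The inverse of the base change s -> (\<open>ls\<close> s, \<open>lt\<close>
      s).\<close>
    let ?inv = "\<lambda>s t. (\<lambda>i::2. if i = 1 then (e / D) * s + (- c / D) * t else (- b / D) * s + (a / D) * t)"
    obtain f where f: "\<And>x s t. cpoly_eval F (case_sum x (?inv s t)) = hbeval k (bimons d k) f x s t"
      using bihomogeneous_substitution[OF dk, of "e / D" "- c / D" "- b / D" "a / D"] by blast
    have inv: "?inv (ls s) (lt s) = (\<lambda>j. s $ j)" for s
    proof
      fix j :: 2
      have D0: "D \<noteq> 0" using det by (simp add: D_def)
      have "(e / D) * ls s + (- c / D) * lt s = (D * s $ 1) / D" "(- b / D) * ls s + (a / D) * lt s = (D * s $ 2) / D"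
        by (simp_all add: ls_def lt_def D_def diff_divide_distrib add_divide_distrib algebra_simps)
      then show "?inv (ls s) (lt s) j = s $ j" using D0 exhaust_2[of j] by auto
    qed
    have Ff: "cpoly_eval F (case_sum y (\<lambda>j. s $ j)) = hbeval k (bimons d k) f y (ls s) (lt s)" for y s
      using f[of y "ls s" "lt s"] unfolding inv .
    obtain \<Xi> where \<Xi>: "\<And>X. X \<in> \<Xi> \<Longrightarrow> (\<exists>v. X v \<noteq> 0) \<and> beval (bimons N 1) (\<lambda>a. [:a:]) g X [:0, 1:] = 0"
      "(\<forall>X\<in>\<Xi>. beval (bimons d k) (\<lambda>a. [:a:]) f X [:0, 1:] = 0) \<longrightarrow> (\<exists>q. \<forall>b\<in>bimons d k. f b = pmul N d k g q b)"
      using sec[of d k] by blast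
    have "beval (bimons d k) (\<lambda>a. [:a:]) f X [:0, 1:] = 0" if X: "X \<in> \<Xi>" for X
    proof -
      obtain v where "X v \<noteq> 0" using \<Xi>(1)[OF X] by blast
      from remove_common_zeros[of X v, OF this] obtain \<gamma> Y where
        \<gamma>: "\<gamma> \<noteq> 0" "\<And>v. X v = \<gamma> * Y v" "\<And>s. \<exists>v. poly (Y v) s \<noteq> 0" by blast
      have XY: "X = (\<lambda>v. \<gamma> * Y v)" using \<gamma>(2) by auto
      have "\<gamma> ^ N * beval (bimons N 1) (\<lambda>a. [:a:]) g Y [:0, 1:] = 0"
        using \<Xi>(1)[OF X] unfolding XY beval_scale by blast
      then have "beval (bimons N 1) (\<lambda>a. [:a:]) g Y [:0, 1:] = 0" using \<gamma>(1) by simp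
      from section_of_coprime[OF this \<gamma>(3)] obtain \<sigma> n where \<sigma>: "pencil_section f1 f2 \<sigma>" "\<And>v. degree (Y v) \<le> n"
        "\<And>M s. M \<in> proj_space \<Longrightarrow> s \<in> M \<Longrightarrow> (\<chi> v. homogenize n (Y v) (ls s) (lt s)) \<in> fst (\<sigma> M)" by blast
      have "poly (beval (bimons d k) (\<lambda>a. [:a:]) f Y [:0, 1:]) t = 0" for t
      proof -
        \<comment> \<open>The base point with echelon coordinates (1, t), over which the section
          takes the value Y(t).\<close>
        define s :: "complex ^ 2" where "s = (\<chi> j. ?inv 1 t j)"
        have D0: "D \<noteq> 0" using det by (simp add: D_def)
        have "ls s = (a * e - b * c) / D" "lt s = (a * e - b * c) * t / D"
          by (simp_all add: s_def ls_def lt_def diff_divide_distrib add_divide_distrib algebra_simps)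
        then have l: "ls s = 1" "lt s = t" using D0 by (simp_all add: D_def)
        then have s0: "s \<noteq> 0" by (auto simp: ls_def)
        define M where "M = vec.span {s}"
        have M: "M \<in> proj_space" "s \<in> M" using span_in_proj_space[OF s0] by (auto simp: M_def vec.span_base)
        have h: "(\<chi> v. poly (Y v) t) \<in> fst (\<sigma> M)" using \<sigma>(3)[OF M] by (simp add: l homogenize_1[OF \<sigma>(2)])
        have "\<sigma> M \<in> Z" using Z \<sigma>(1) M(1) by blast
        moreover have "snd (\<sigma> M) = M" using \<sigma>(1) M(1) by (simp add: pencil_section_def)
        ultimately have "\<forall>x\<in>fst (\<sigma> M). \<forall>y\<in>M. cpoly_eval F (case_sum (\<lambda>i. x $ i) (\<lambda>j. y $ j)) = 0"
          using F unfolding S(2) by (cases "\<sigma> M") auto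
        from bspec[OF bspec[OF this h] M(2)]
        have "cpoly_eval F (case_sum (\<lambda>v. poly (Y v) t) (\<lambda>j. s $ j)) = 0" by simp
        then have "beval (bimons d k) (\<lambda>c. c) f (\<lambda>v. poly (Y v) t) t = 0"
          unfolding Ff l by (simp add: hbeval_1)
        moreover have "rhom (\<lambda>p. poly p t)" by (simp add: rhom_def)
        ultimately show ?thesis by (simp add: beval_rhom[where g = "\<lambda>p. poly p t"])
      qed
      then have "beval (bimons d k) (\<lambda>a. [:a:]) f Y [:0, 1:] = 0" using poly_all_0_iff_0 by blast
      then show ?thesis unfolding XY beval_scale by simp
    qed
    then obtain q where q: "\<And>b. b \<in> bimons d k \<Longrightarrow> f b = pmul N d k g q b" using \<Xi>(2) by blast
    have "hbeval 1 (bimons N 1) g (\<lambda>i. x $ i) (ls s) (lt s) = 0"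
      using tot x s unfolding pencil_eq[symmetric] by (auto simp: pencil_total_def)
    from multiple_vanishes_on_total_space[OF q this] show ?thesis unfolding Ff .
  qed
  then show "pencil_total f1 f2 \<subseteq> Z" unfolding S(2) by (auto simp: pencil_total_def)
qed

end

section \<open>Very general pencils\<close>

lemma mon_sum: "mon (\<Sum>i\<in>A. f i) x = (\<Prod>i\<in>A. mon (f i) x)"
  by (induction A rule: infinite_finite_induct) (auto simp: mon_add)

lemma monom_degree_sum: "monom_degree (\<Sum>i\<in>A. f i) = (\<Sum>i\<in>A. monom_degree (f i))"
  by (induction A rule: infinite_finite_induct) (auto simp: monom_degree_add)

text \<open>The composite of P and phi, homogenised by the variable u. The extra power of u makes the form
  vanish where u does, so that P = 1 gives the closed set u = 0.\<close>

definition pullback_form :: "('v \<Rightarrow> 'w) \<Rightarrow> 'w \<Rightarrow> ('v monom \<Rightarrow>\<^sub>0 int) \<Rightarrow> 'w cpoly" where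
  "pullback_form \<phi> u P = (\<Sum>m\<in>Poly_Mapping.keys P. Poly_Mapping.single
     ((\<Sum>v\<in>Poly_Mapping.keys m. Poly_Mapping.single (\<phi> v) (Poly_Mapping.lookup m v)) +
       Poly_Mapping.single u (Suc (\<Sum>m\<in>Poly_Mapping.keys P. monom_degree m) - monom_degree m))
     (of_int (Poly_Mapping.lookup P m)))"

lemma homogeneous_pullback_form:
  "homogeneous (Suc (\<Sum>m\<in>Poly_Mapping.keys P. monom_degree m)) (pullback_form \<phi> u P)"
  unfolding pullback_form_def
proof (intro homogeneous_sum homogeneous_single)
  fix m assume "m \<in> Poly_Mapping.keys P"
  then have "monom_degree m \<le> (\<Sum>m\<in>Poly_Mapping.keys P. monom_degree m)"
    by (intro member_le_sum) auto
  moreover have "(\<Sum>v\<in>Poly_Mapping.keys m. Poly_Mapping.lookup m v) = monom_degree m"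
    by (simp add: monom_degree_def)
  ultimately show "monom_degree ((\<Sum>v\<in>Poly_Mapping.keys m. Poly_Mapping.single (\<phi> v) (Poly_Mapping.lookup m v)) +
       Poly_Mapping.single u (Suc (\<Sum>m\<in>Poly_Mapping.keys P. monom_degree m) - monom_degree m)) =
     Suc (\<Sum>m\<in>Poly_Mapping.keys P. monom_degree m)"
    by (simp add: monom_degree_add monom_degree_sum)
qed

lemma cpoly_eval_pullback_form:
  "cpoly_eval (pullback_form \<phi> u P) x =
     x u ^ Suc (\<Sum>m\<in>Poly_Mapping.keys P. monom_degree m) * evalp of_int P (\<lambda>v. x (\<phi> v) / x u)"
proof -
  define D where "D = Suc (\<Sum>m\<in>Poly_Mapping.keys P. monom_degree m)"
  have "of_int (Poly_Mapping.lookup P m) * ((\<Prod>v\<in>Poly_Mapping.keys m. x (\<phi> v) ^ Poly_Mapping.lookup m v) * x u ^ (D - monom_degree m))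
    = x u ^ D * (of_int (Poly_Mapping.lookup P m) * mon m (\<lambda>v. x (\<phi> v) / x u))" if "m \<in> Poly_Mapping.keys P" for m
  proof -
    have "monom_degree m \<le> (\<Sum>m\<in>Poly_Mapping.keys P. monom_degree m)"
      using that by (intro member_le_sum) auto
    then have d: "monom_degree m < D" by (simp add: D_def)
    show ?thesis
    proof (cases "x u = 0")
      case True
      then show ?thesis using d by (simp add: D_def)
    next
      case False
      have "x u ^ D = x u ^ (D - monom_degree m) * x u ^ monom_degree m"
        using d by (simp add: power_add[symmetric])
      moreover have "x u ^ monom_degree m * mon m (\<lambda>v. x (\<phi> v) / x u) = (\<Prod>v\<in>Poly_Mapping.keys m. x (\<phi> v) ^ Poly_Mapping.lookup m v)"
        using False by (simp add: mon_def monom_degree_def power_sum prod.distrib[symmetric] power_divide)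
      ultimately show ?thesis by (simp add: mult_ac)
    qed
  qed
  then show ?thesis
    unfolding cpoly_eval_evalp pullback_form_def evalp_sum[OF rhom_id] evalp_single[OF rhom_id] mon_add mon_sum mon_single
      D_def[symmetric]
    unfolding evalp_def sum_distrib_left
    by (intro sum.cong refl)
qed

section \<open>Pluecker coordinates and the echelon form of a pencil\<close>

lemma span_pair: "h \<in> cpoly.span {f, g} \<longleftrightarrow> (\<exists>r s. h = cpoly_scale r f + cpoly_scale s g)"
  unfolding cpoly.span_insert cpoly.span_singleton by (auto simp: diff_eq_eq add.commute)

lemma pluecker_span:
  assumes "f \<in> cpoly.span {f0, g0}" "g \<in> cpoly.span {f0, g0}"
  shows "\<exists>r. \<forall>v. pluecker f g v = r * pluecker f0 g0 v"
proof -
  obtain r s r' s' where "f = cpoly_scale r f0 + cpoly_scale s g0" "g = cpoly_scale r' f0 + cpoly_scale s' g0"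
    using assms unfolding span_pair by blast
  then have "pluecker f g v = (r * s' - s * r') * pluecker f0 g0 v" for v
    by (cases v) (simp add: pluecker_def lookup_add algebra_simps)
  then show ?thesis by blast
qed

text \<open>Cramer's rule: the quotients of Pluecker coordinates are the coefficients at m of the
  basis dual to the coefficients at m1 and m2.\<close>

lemma lookup_echelon:
  assumes "f \<in> cpoly.span {f0, g0}" "pluecker f0 g0 (m1, m2) \<noteq> 0"
  shows "Poly_Mapping.lookup f m =
    Poly_Mapping.lookup f m1 * (pluecker f0 g0 (m, m2) / pluecker f0 g0 (m1, m2)) +
    Poly_Mapping.lookup f m2 * (pluecker f0 g0 (m1, m) / pluecker f0 g0 (m1, m2))"
proof -
  obtain r s where f: "f = cpoly_scale r f0 + cpoly_scale s g0" using assms(1) unfolding span_pair by blast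
  have "Poly_Mapping.lookup f m * pluecker f0 g0 (m1, m2) =
    Poly_Mapping.lookup f m1 * pluecker f0 g0 (m, m2) + Poly_Mapping.lookup f m2 * pluecker f0 g0 (m1, m)"
    unfolding f by (simp add: pluecker_def lookup_add algebra_simps)
  then show ?thesis using assms(2) by (simp add: field_simps)
qed

text \<open>The Pluecker coordinate that, divided by the one at (m1, m2), gives entry b of the
  reduced echelon form.\<close>

definition echelon_var :: "'v monom \<Rightarrow> 'v monom \<Rightarrow> 'v monom \<times> nat \<Rightarrow> 'v monom \<times> 'v monom" where
  "echelon_var m1 m2 b = (if snd b = 0 then (fst b, m2) else (m1, fst b))"

definition echelon_coeffs :: "'v monom \<Rightarrow> 'v monom \<Rightarrow> 'v cpoly \<Rightarrow> 'v cpoly \<Rightarrow> 'v monom \<times> nat \<Rightarrow> complex" where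
  "echelon_coeffs m1 m2 f g b = pluecker f g (echelon_var m1 m2 b) / pluecker f g (m1, m2)"

lemma echelon_coeffs_eq:
  assumes "cpoly.span {f, g} = cpoly.span {f', g'}" "pluecker f g (m1, m2) \<noteq> 0"
  shows "pluecker f' g' (m1, m2) \<noteq> 0" "echelon_coeffs m1 m2 f g = echelon_coeffs m1 m2 f' g'"
proof -
  have "f \<in> cpoly.span {f', g'}" "g \<in> cpoly.span {f', g'}"
    using cpoly.span_base[of _ "{f, g}"] assms(1) by auto
  then obtain r where r: "\<And>v. pluecker f g v = r * pluecker f' g' v" using pluecker_span by blast
  then show "pluecker f' g' (m1, m2) \<noteq> 0" using assms(2) by auto
  show "echelon_coeffs m1 m2 f g = echelon_coeffs m1 m2 f' g'"
    using assms(2) by (auto simp: echelon_coeffs_def fun_eq_iff r)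
qed

lemma evalp_cong_vars:
  assumes "vars_in V P" "\<And>v. v \<in> V \<Longrightarrow> x v = y v"
  shows "evalp h P x = evalp h P y"
  unfolding evalp_def mon_def
  using assms by (intro sum.cong prod.cong refl arg_cong2[where f = "(*)"] arg_cong2[where f = power])
     (auto simp: vars_in_def)

text \<open>The pencils that have no echelon form with respect to m1 and m2, or whose echelon
  entries satisfy the relation P.\<close>

definition special_locus :: "nat \<Rightarrow> 'v monom \<Rightarrow> 'v monom \<Rightarrow> (('v monom \<times> nat) monom \<Rightarrow>\<^sub>0 int) \<Rightarrow> 'v cpoly set set" where
  "special_locus N m1 m2 P = {W \<in> pencils N. \<forall>f g. W = cpoly.span {f, g} \<longrightarrow>
     cpoly_eval (pullback_form (echelon_var m1 m2) (m1, m2) P) (pluecker f g) = 0}"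

lemma pencils_closed_special_locus: "pencils_closed N (special_locus N m1 m2 P)"
proof -
  have "\<exists>e. homogeneous e (pullback_form (echelon_var m1 m2) (m1, m2) P)"
    by (rule exI) (rule homogeneous_pullback_form)
  then show ?thesis
    unfolding pencils_closed_def special_locus_def
    by (intro exI[of _ "{pullback_form (echelon_var m1 m2) (m1, m2) P}"]) auto
qed

text \<open>P is nonzero at some point y0, and the pencil whose echelon entries are given by y0 lies
  outside.\<close>

lemma special_locus_neq:
  fixes m1 m2 :: "'v::finite monom"
  assumes m: "m1 \<in> mons N" "m2 \<in> mons N" "m1 \<noteq> m2"
    and P: "P \<noteq> 0" "vars_in (bimons N 1 - {m1, m2} \<times> UNIV) P"
  shows "special_locus N m1 m2 P \<noteq> pencils N"
proof -
  define V where "V = bimons N 1 - {m1, m2} \<times> UNIV"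
  obtain m0 where m0: "m0 \<in> Poly_Mapping.keys P" using P(1) by (metis keys_eq_empty ex_in_conv)
  obtain y0 where y0: "(\<Sum>m\<in>Poly_Mapping.keys P. complex_of_int (Poly_Mapping.lookup P m) * mon m y0) \<noteq> 0"
    using nonzero_polynomial_nonvanishing[of "Poly_Mapping.keys P" m0 "\<lambda>m. of_int (Poly_Mapping.lookup P m)"] m0
    by (auto simp: in_keys_iff)
  \<comment> \<open>The entries y0, with the identity matrix inserted in the positions m1 and m2,
    where P has no variables.\<close>
  define y where "y b = (if fst b = m1 then if snd b = 0 then 1 else 0 else
      if fst b = m2 then if snd b = 0 then 0 else 1 else y0 b)" for b :: "'v monom \<times> nat"
  have "evalp complex_of_int P y = evalp of_int P y0"
    by (rule evalp_cong_vars[OF P(2)]) (auto simp: y_def)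
  then have y: "evalp complex_of_int P y \<noteq> 0" using y0 by (simp add: evalp_def)
  define f where "f j = (\<Sum>m\<in>mons N. Poly_Mapping.single m (y (m, j)))" for j
  have lf: "Poly_Mapping.lookup (f j) m = (if m \<in> mons N then y (m, j) else 0)" for j m
    by (simp add: f_def lookup_sum lookup_single when_def)
  define W where "W = cpoly.span {f 0, f 1}"
  have ne: "f 0 \<noteq> f 1" using lf[of 0 m1] lf[of 1 m1] m by (auto simp: y_def)
  have "f 0 \<noteq> 0" using lf[of 0 m1] m by (auto simp: y_def)
  moreover have "f 1 \<notin> cpoly.span {f 0}"
  proof
    assume "f 1 \<in> cpoly.span {f 0}"
    then obtain r where "f 1 = cpoly_scale r (f 0)" by (auto simp: cpoly.span_singleton)
    then have "Poly_Mapping.lookup (f 1) m2 = r * Poly_Mapping.lookup (f 0) m2" by simp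
    then show False unfolding lf using m by (auto simp: y_def)
  qed
  ultimately have "cpoly.independent {f 1, f 0}"
    using ne by (simp add: cpoly.independent_insert)
  then have "cpoly.dim W = card {f 0, f 1}"
    unfolding W_def by (subst cpoly.dim_span) (intro cpoly.dim_eq_card_independent, simp add: insert_commute)
  moreover have "homogeneous N (cpoly_scale r (f j))" for r j
    using lf[of j] by (auto simp: homogeneous_def in_keys_iff mons_def split: if_splits)
  then have "homogeneous N h" if "h \<in> W" for h
    using that unfolding W_def span_pair by (auto intro: homogeneous_add)
  ultimately have W: "W \<in> pencils N" using ne by (simp add: pencils_def W_def)
  have "pluecker (f 0) (f 1) (m1, m2) = 1" using m by (simp add: pluecker_def lf y_def)
  moreover have "pluecker (f 0) (f 1) (echelon_var m1 m2 b) = y b" if "b \<in> V" for b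
    using that m by (cases b) (auto simp: V_def bimons_def le_Suc_eq pluecker_def lf y_def echelon_var_def)
  then have "evalp complex_of_int P (\<lambda>b. pluecker (f 0) (f 1) (echelon_var m1 m2 b)) = evalp of_int P y"
    by (intro evalp_cong_vars[OF P(2)]) (simp add: V_def)
  ultimately have "cpoly_eval (pullback_form (echelon_var m1 m2) (m1, m2) P) (pluecker (f 0) (f 1)) \<noteq> 0"
    using y by (simp add: cpoly_eval_pullback_form)
  then have "W \<notin> special_locus N m1 m2 P" by (auto simp: special_locus_def W_def)
  then show ?thesis using W by blast
qed

lemma outside_special_loci:
  assumes W: "W \<in> pencils N" "\<And>P. P \<noteq> 0 \<Longrightarrow> vars_in V P \<Longrightarrow> W \<notin> special_locus N m1 m2 P"
    and W12: "W = cpoly.span {f1, f2}"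
  shows "pluecker f1 f2 (m1, m2) \<noteq> 0" "alg_indep V (echelon_coeffs m1 m2 f1 f2)"
proof -
  have *: "pluecker f1 f2 (m1, m2) \<noteq> 0 \<and> evalp of_int P (echelon_coeffs m1 m2 f1 f2) \<noteq> 0"
    if P: "P \<noteq> 0" "vars_in V P" for P
  proof -
    obtain f g where fg: "W = cpoly.span {f, g}"
        "cpoly_eval (pullback_form (echelon_var m1 m2) (m1, m2) P) (pluecker f g) \<noteq> 0"
      using W(1) W(2)[OF P] by (auto simp: special_locus_def)
    then have "pluecker f g (m1, m2) \<noteq> 0" "evalp of_int P (echelon_coeffs m1 m2 f g) \<noteq> 0"
      by (auto simp: cpoly_eval_pullback_form echelon_coeffs_def[abs_def])
    then show ?thesis using echelon_coeffs_eq[of f g f1 f2 m1 m2] fg(1) W12 by simp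
  qed
  then show "alg_indep V (echelon_coeffs m1 m2 f1 f2)" by (auto simp: alg_indep_def)
  show "pluecker f1 f2 (m1, m2) \<noteq> 0" using *[of 1] by (simp add: vars_in_one)
qed

lemma cpoly_eval_echelon:
  fixes f :: "'n::finite cpoly"
  assumes f: "f \<in> cpoly.span {f1, f2}" "homogeneous N f" and nz: "pluecker f1 f2 (m1, m2) \<noteq> 0"
  shows "cpoly_eval f x = hbeval 1 (bimons N 1) (echelon_coeffs m1 m2 f1 f2) x (Poly_Mapping.lookup f m1) (Poly_Mapping.lookup f m2)"
proof -
  let ?g = "echelon_coeffs m1 m2 f1 f2"
  have "cpoly_eval f x = (\<Sum>m\<in>mons N. Poly_Mapping.lookup f m * mon m x)"
    unfolding cpoly_eval_evalp
    by (rule evalp_superset[OF rhom_id]) (use f(2) in \<open>auto simp: homogeneous_def mons_def finite_monom_degree\<close>)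
  also have "\<dots> = (\<Sum>m\<in>mons N. \<Sum>j\<le>1. ?g (m, j) * (mon m x * Poly_Mapping.lookup f m1 ^ (1 - j) * Poly_Mapping.lookup f m2 ^ j))"
  proof (intro sum.cong refl)
    fix m
    have "Poly_Mapping.lookup f m = Poly_Mapping.lookup f m1 * ?g (m, 0) + Poly_Mapping.lookup f m2 * ?g (m, 1)"
      using lookup_echelon[OF f(1) nz, of m] by (simp only: echelon_coeffs_def echelon_var_def) simp
    then have "Poly_Mapping.lookup f m * mon m x = (Poly_Mapping.lookup f m1 * ?g (m, 0) + Poly_Mapping.lookup f m2 * ?g (m, 1)) * mon m x"
      by (rule arg_cong)
    also have "\<dots> = (\<Sum>j\<le>1. ?g (m, j) * (mon m x * Poly_Mapping.lookup f m1 ^ (1 - j) * Poly_Mapping.lookup f m2 ^ j))"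
      by (simp add: algebra_simps)
    finally show "Poly_Mapping.lookup f m * mon m x =
      (\<Sum>j\<le>1. ?g (m, j) * (mon m x * Poly_Mapping.lookup f m1 ^ (1 - j) * Poly_Mapping.lookup f m2 ^ j))" .
  qed
  also have "\<dots> = hbeval 1 (bimons N 1) ?g x (Poly_Mapping.lookup f m1) (Poly_Mapping.lookup f m2)"
    unfolding hbeval_def bimons_def sum.cartesian_product by (intro sum.cong refl) auto
  finally show ?thesis .
qed

theorem theorem12:
  fixes n :: nat
  assumes "n \<ge> 4" and "CARD('n::finite) = n + 1"
  shows "very_general_pencil (n + 1) (\<lambda>W :: 'n cpoly set.
           \<forall>f1 f2. W = cpoly.span {f1, f2} \<longrightarrow>
             biproj_dense_in (pencil_total f1 f2)
               (\<Union>\<sigma>\<in>{\<sigma>. pencil_section f1 f2 \<sigma>}. \<sigma> ` proj_space))"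
proof -
  have "4 \<le> card (UNIV :: 'n set)" using assms by simp
  then obtain A :: "'n set" where A: "card A = 4" by (rule obtain_subset_with_card_n)
  obtain i0 i1 i2 i3 :: 'n where "A = {i0, i1, i2, i3}" and d: "i0 \<noteq> i1" "i0 \<noteq> i2" "i1 \<noteq> i2" "i3 \<notin> {i0, i1, i2}"
    using A by (auto simp: card_Suc_eq numeral_eq_Suc)
  define J where "J = UNIV - {i0, i1, i2}"
  have "i3 \<in> J" using d by (simp add: J_def)
  then have Jne: "J \<noteq> {}" by blast
  define N where "N = n + 1"
  have N: "CARD('n) = N" using assms by (simp add: N_def)
  \<comment> \<open>Needed only for m1 and m2, which do not depend on c; the actual c is chosen for
    each bidegree within \<open>generic_pencil_sections\<close>.\<close>
  interpret special_pencil i0 i1 i2 J "\<lambda>_. 0"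
    by unfold_locales (use d J_def in auto)
  have m: "m1 \<in> mons N" "m2 \<in> mons N" "m1 \<noteq> m2"
    using monom_degree_m m1_neq_m2 by (simp_all add: mons_def N)
  define V where "V = bimons N 1 - {m1, m2} \<times> UNIV"
  \<comment> \<open>One closed set for each nonzero integer relation, fixed before any bidegree is
    considered.\<close>
  define \<Z> where "\<Z> = special_locus N m1 m2 ` ({P. vars_in V P} - {0})"
  have "countable V" by (rule countable_finite) (simp add: V_def)
  then have "countable \<Z>" unfolding \<Z>_def by (intro countable_image countable_Diff countable_vars_in)
  moreover have "\<forall>Z\<in>\<Z>. pencils_closed N Z \<and> Z \<noteq> pencils N"
    using special_locus_neq[OF m] by (auto simp: \<Z>_def V_def pencils_closed_special_locus)
  moreover have "biproj_dense_in (pencil_total f1 f2) (\<Union>\<sigma>\<in>{\<sigma>. pencil_section f1 f2 \<sigma>}. \<sigma> ` proj_space)"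
    if W: "W \<in> pencils N - \<Union>\<Z>" "W = cpoly.span {f1, f2}" for W :: "'n cpoly set" and f1 f2
  proof -
    have "W \<notin> special_locus N m1 m2 P" if "P \<noteq> 0" "vars_in V P" for P
      using W(1) that by (auto simp: \<Z>_def)
    note o = outside_special_loci[OF _ this W(2)]
    have nz: "pluecker f1 f2 (m1, m2) \<noteq> 0" and indep: "alg_indep V (echelon_coeffs m1 m2 f1 f2)"
      using o W(1) by auto
    define g where "g = echelon_coeffs m1 m2 f1 f2"
    have f12: "f1 \<in> cpoly.span {f1, f2}" "f2 \<in> cpoly.span {f1, f2}" by (auto intro: cpoly.span_base)
    have hom: "homogeneous N f1" "homogeneous N f2" using W f12 by (auto simp: pencils_def)
    have g: "g (m1, 0) = 1" "g (m1, 1) = 0" "g (m2, 0) = 0" "g (m2, 1) = 1"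
      using nz by (simp_all add: g_def echelon_coeffs_def echelon_var_def) (simp_all add: pluecker_def)
    have indep': "alg_indep (bimons CARD('n) 1 - {m1, m2} \<times> UNIV) g"
      using indep by (simp add: N g_def V_def)
    interpret based_pencil g f1 f2 "Poly_Mapping.lookup f1 m1" "Poly_Mapping.lookup f1 m2"
        "Poly_Mapping.lookup f2 m1" "Poly_Mapping.lookup f2 m2" N
    proof
      show "Poly_Mapping.lookup f1 m1 * Poly_Mapping.lookup f2 m2 - Poly_Mapping.lookup f1 m2 * Poly_Mapping.lookup f2 m1 \<noteq> 0"
        using nz by (simp add: pluecker_def)
    qed (use cpoly_eval_echelon[OF _ _ nz] f12 hom in \<open>simp_all add: g_def\<close>)
    show ?thesis
    proof (rule dense_sections)
      fix d k
      show "\<exists>\<Xi>. (\<forall>X\<in>\<Xi>. (\<exists>v. X v \<noteq> 0) \<and> beval (bimons N 1) (\<lambda>a. [:a:]) g X [:0, 1:] = 0) \<and>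
        (\<forall>f. (\<forall>X\<in>\<Xi>. beval (bimons d k) (\<lambda>a. [:a:]) f X [:0, 1:] = 0) \<longrightarrow>
           (\<exists>q. \<forall>b\<in>bimons d k. f b = pmul N d k g q b))"
        using generic_pencil_sections[OF d(1-3), folded J_def, OF Jne m1_def m2_def g indep', where d = d and k = k]
        unfolding N by (elim exE conjE) (intro exI conjI)
    qed
  qed
  ultimately show ?thesis
    unfolding very_general_pencil_def N_def[symmetric] by (intro exI[of _ \<Z>]) blast
qed

end
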